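(* Let $K\in C^2_{loc}(\mathbb{R}_+)$ be a known relaxation kernel, $q\in C^2_{loc}(\mathbb{R}_+)$ the unknown potential of the system with memory, and $T>0$. Let $c_T$ be the kernel of $C_T=J_TC^TJ_T-I$, where $C^T$ is the connecting operator of the system; $c_T$ is determined by the response operator $R^{2T}$ and $K$. Solving the integral equation (Gelfand–Levitan equation) $$z(x,s)+c_T(x,s)+\int_x^Tc_T(s,\tau)z(x,\tau)\,d\tau=0,\qquad 0<x<s<T,$$ for all $x\in(0,T)$, one can recover the potential using $$q(x)=2\frac{d}{dx}z(x,x).$$
   Context: For a relaxation kernel $K$, a potential $q$ and a boundary control $f\in L_2(\mathbb{R}_+)$, $u^f$ denotes the solution of $$u_{tt}(x,t)-u_{xx}(x,t)+q(x)u(x,t)+\int_0^tK(t-s)u(x,s)\,ds=0,\quad x>0,\ t>0,$$ $$u(x,0)=0,\quad u_t(x,0)=0,\quad x\ge 0,\qquad u(0,t)=f(t),\quad t\ge 0.$$ The response operator $R$ acts in $L_{2,loc}(\mathbb{R}_+)$ by $(Rf)(t)=u^f_x(0,t)$, and $R^{2T}:=R|_{L_2(0,2T)}$. The inverse problem is: with $K$ known and $T>0$ fixed, recover $q(x)$, $x\in(0,T)$, from $R^{2T}$. Let $\mathcal{F}^T=L_2(0,T)$ and $\mathcal{H}^T=L_2(0,T)$ with the standard inner products. The connecting operator $C^T:\mathcal{F}^T\to\mathcal{F}^T$ is defined by $(C^Tf,g)_{\mathcal{F}^T}=(u^f(\cdot,T),u^g(\cdot,T))_{\mathcal{H}^T}$,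 and $(J_Tf)(t)=f(T-t)$. The kernel $c_T$ is given by $(C_Tf)(t)=\int_0^Tc_T(t,s)f(s)\,ds$ for $C_T:=J_TC^TJ_T-I$. The function $z$ in the integral equation is the kernel of the operator $L$, $(Lf)(x)=\int_x^Tz(x,s)f(s)\,ds$, in the representation $(W^T)^{-1}=J_T(I+L)$ of the inverse of the control operator $W^T:\mathcal{F}^T\to\mathcal{H}^T$, $(W^Tf)(x)=u^f(x,T)$.
   Formalization: The printed integral term, of c_T(s,τ)z(x,τ) over τ in (x,T), is replaced by that of c_T(x,τ)z(τ,s) over τ in (0,s); as printed, q=2 d/dx z(x,x) fails whenever the integral of q over (0,T) is nonzero (e.g. K=0, q=3, T=1). *)

theory Defs
  imports "HOL-Analysis.Analysis"
begin

(* C^2 on the closed half-line, with one-sided derivatives at 0. *)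
definition C2_loc :: "(real \<Rightarrow> real) \<Rightarrow> bool" where
  "C2_loc f \<longleftrightarrow> (\<exists>f' f''.
     (\<forall>x\<ge>0. (f has_real_derivative f' x) (at x within {0..})
           \<and> (f' has_real_derivative f'' x) (at x within {0..}))
     \<and> continuous_on {0..} f'')"


subsection \<open>The system with memory, classical solutions\<close>

definition C1_grad ::
  "(real \<times> real) set \<Rightarrow> (real \<Rightarrow> real \<Rightarrow> real) \<Rightarrow> (real \<Rightarrow> real \<Rightarrow> real) \<Rightarrow> (real \<Rightarrow> real \<Rightarrow> real) \<Rightarrow> bool"
where
  "C1_grad S u ux ut \<longleftrightarrow>
     (\<forall>x t. (x, t) \<in> S \<longrightarrow>
        ((\<lambda>(x, t). u x t) has_derivative (\<lambda>(h, k). ux x t * h + ut x t * k)) (at (x, t) within S))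
     \<and> continuous_on S (\<lambda>(x, t). ux x t) \<and> continuous_on S (\<lambda>(x, t). ut x t)"

(* u is a C^2 solution up to the boundary of the strip x >= 0, 0 <= t <= tau, and ux is its
   x-derivative. Such a u exists only for controls f that are C^2 with
   f(0) = f'(0) = f''(0) = 0. *)
definition classical_solution ::
  "(real \<Rightarrow> real) \<Rightarrow> (real \<Rightarrow> real) \<Rightarrow> real \<Rightarrow> (real \<Rightarrow> real)
     \<Rightarrow> (real \<Rightarrow> real \<Rightarrow> real) \<Rightarrow> (real \<Rightarrow> real \<Rightarrow> real) \<Rightarrow> bool"
where
  "classical_solution q K \<tau> f u ux \<longleftrightarrow> (\<exists>ut uxx uxt utt.
     C1_grad ({0..} \<times> {0..\<tau>}) u ux ut
     \<and> C1_grad ({0..} \<times> {0..\<tau>}) ux uxx uxt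
     \<and> C1_grad ({0..} \<times> {0..\<tau>}) ut uxt utt
     \<and> (\<forall>x>0. \<forall>t. 0 < t \<and> t < \<tau> \<longrightarrow>
          utt x t - uxx x t + q x * u x t + integral {0..t} (\<lambda>s. K (t - s) * u x s) = 0)
     \<and> (\<forall>x\<ge>0. u x 0 = 0 \<and> ut x 0 = 0)
     \<and> (\<forall>t\<in>{0..\<tau>}. u 0 t = f t))"

(* The graph of the (unbounded) response operator f |-> u_x(0, .) on (0, tau), on the dense
   set of controls that admit a classical solution. *)
definition response_operator ::
  "(real \<Rightarrow> real) \<Rightarrow> (real \<Rightarrow> real) \<Rightarrow> real \<Rightarrow> ((real \<Rightarrow> real) \<times> (real \<Rightarrow> real)) set"
where
  "response_operator q K \<tau> =
     {(f, g). \<exists>u ux. classical_solution q K \<tau> f u ux \<and> (\<forall>t\<in>{0..\<tau>}. g t = ux 0 t)}"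


subsection \<open>Square-integrable controls\<close>

(* Elements of L_2 are represented by functions; equality in L_2 is written AE. *)
definition L2 :: "'a measure \<Rightarrow> ('a \<Rightarrow> real) set" where
  "L2 M = {f \<in> borel_measurable M. integrable M (\<lambda>x. (f x)\<^sup>2)}"

definition L2_tendsto :: "'a measure \<Rightarrow> (nat \<Rightarrow> 'a \<Rightarrow> real) \<Rightarrow> ('a \<Rightarrow> real) \<Rightarrow> bool" where
  "L2_tendsto M F f \<longleftrightarrow> (\<forall>n. F n \<in> L2 M) \<and> f \<in> L2 M
     \<and> (\<lambda>n. \<integral>x. (F n x - f x)\<^sup>2 \<partial>M) \<longlonglongrightarrow> 0"

abbreviation L2_measure :: "real \<Rightarrow> real measure" where
  "L2_measure T \<equiv> lebesgue_on {0<..<T}"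

(* u = u^f for f in L_2(0,T): the limit of classical solutions whose controls tend to f. *)
definition L2_solution ::
  "(real \<Rightarrow> real) \<Rightarrow> (real \<Rightarrow> real) \<Rightarrow> real \<Rightarrow> (real \<Rightarrow> real) \<Rightarrow> (real \<Rightarrow> real \<Rightarrow> real) \<Rightarrow> bool"
where
  "L2_solution q K T f u \<longleftrightarrow> (\<exists>F U Ux.
     (\<forall>n. classical_solution q K T (F n) (U n) (Ux n))
     \<and> L2_tendsto (L2_measure T) F f
     \<and> (\<forall>t\<in>{0..T}. L2_tendsto (lebesgue_on {0<..}) (\<lambda>n x. U n x t) (\<lambda>x. u x t)))"

(* The graph of the control operator W^T. *)
definition control_operator ::
  "(real \<Rightarrow> real) \<Rightarrow> (real \<Rightarrow> real) \<Rightarrow> real \<Rightarrow> (real \<Rightarrow> real) \<Rightarrow> (real \<Rightarrow> real) \<Rightarrow> bool"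
where
  "control_operator q K T f h \<longleftrightarrow>
     (\<exists>u. L2_solution q K T f u \<and> (AE x in L2_measure T. h x = u x T))"

definition connecting_operator ::
  "(real \<Rightarrow> real) \<Rightarrow> (real \<Rightarrow> real) \<Rightarrow> real \<Rightarrow> ((real \<Rightarrow> real) \<Rightarrow> real \<Rightarrow> real) \<Rightarrow> bool"
where
  "connecting_operator q K T C \<longleftrightarrow>
     (\<forall>f \<in> L2 (L2_measure T). C f \<in> L2 (L2_measure T))
     \<and> (\<forall>f \<in> L2 (L2_measure T). \<forall>g \<in> L2 (L2_measure T). \<forall>u v.
          L2_solution q K T f u \<longrightarrow> L2_solution q K T g v \<longrightarrow>
          (\<integral>t. C f t * g t \<partial>L2_measure T) = (\<integral>x. u x T * v x T \<partial>L2_measure T))"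

definition J :: "real \<Rightarrow> (real \<Rightarrow> real) \<Rightarrow> real \<Rightarrow> real" where
  "J T f = (\<lambda>t. f (T - t))"

(* c is the continuous kernel of C_T = J_T C^T J_T - I. *)
definition connecting_kernel ::
  "(real \<Rightarrow> real) \<Rightarrow> (real \<Rightarrow> real) \<Rightarrow> real \<Rightarrow> (real \<Rightarrow> real \<Rightarrow> real) \<Rightarrow> bool"
where
  "connecting_kernel q K T c \<longleftrightarrow>
     continuous_on ({0..T} \<times> {0..T}) (\<lambda>(t, s). c t s)
     \<and> (\<exists>C. connecting_operator q K T C
          \<and> (\<forall>f \<in> L2 (L2_measure T). AE t in L2_measure T.
               J T (C (J T f)) t - f t = (\<integral>s. c t s * f s \<partial>L2_measure T)))"


subsection \<open>The Gelfand-Levitan equation\<close>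

definition L_operator :: "real \<Rightarrow> (real \<Rightarrow> real \<Rightarrow> real) \<Rightarrow> (real \<Rightarrow> real) \<Rightarrow> real \<Rightarrow> real" where
  "L_operator T z f x = (\<integral>s. z x s * f s \<partial>lebesgue_on {x<..<T})"

(* (W^T)^{-1} = J_T (I + L): the graph of W^T is the converse of the graph of J_T (I + L). *)
definition inverse_control_kernel ::
  "(real \<Rightarrow> real) \<Rightarrow> (real \<Rightarrow> real) \<Rightarrow> real \<Rightarrow> (real \<Rightarrow> real \<Rightarrow> real) \<Rightarrow> bool"
where
  "inverse_control_kernel q K T z \<longleftrightarrow>
     (\<forall>f \<in> L2 (L2_measure T). \<forall>h \<in> L2 (L2_measure T).
        control_operator q K T f h \<longleftrightarrow>
        (AE t in L2_measure T. f t = J T (\<lambda>x. h x + L_operator T z h x) t))"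

(* Write A' for the adjoint of A. From C^T = (W^T)' W^T and (W^T)^{-1} = J_T (I + L) one gets
   (I + C_T) (I + L) = ((I + L)')^{-1}, whose kernel vanishes above the diagonal; reading this
   off at x < s, where z(tau,s) = 0 for tau > s, gives the equation below.
   The literature also has the integral term "c_T(s,tau) z(x,tau) over tau in (x,T)". That form
   belongs to the kernel c_T(T-t,T-s) of C^T - I and the unknown z(T-s,T-x). With the c_T
   used here it would force z(T,T) = -c_T(T,T), whereas the kernel of L has
   z(T,T) = (1/2) int_0^T q; the two agree only if int_0^T q = 0.
   Continuity up to the diagonal fixes the values z(x,x). *)
definition gelfand_levitan :: "real \<Rightarrow> (real \<Rightarrow> real \<Rightarrow> real) \<Rightarrow> (real \<Rightarrow> real \<Rightarrow> real) \<Rightarrow> bool" where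
  "gelfand_levitan T c z \<longleftrightarrow>
     continuous_on {(x, s). 0 \<le> x \<and> x \<le> s \<and> s \<le> T} (\<lambda>(x, s). z x s)
     \<and> (\<forall>x s. 0 < x \<and> x < s \<and> s < T \<longrightarrow>
          z x s + c x s + integral {0..s} (\<lambda>\<tau>. c x \<tau> * z \<tau> s) = 0)"

end

theory Submission
  imports Defs
begin

text \<open>Writing the solution for a singular control as \<open>\<delta>(t - x) + w(x, t)\<close>, the remainder \<open>w\<close> solves
  a Goursat problem in \<open>x \<le> t\<close> with \<open>w(x, x) = - 1/2 \<integral>\<^sub>0\<^sup>x q\<close>, and
  \<open>u\<^sup>f(x, t) = f(t - x) + \<integral>\<^sub>x\<^sup>t w(x, s) f(t - s) ds\<close>. Hence \<open>W\<^sup>T = (I + M) J\<^sub>T\<close> with the Volterra operator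
  \<open>M\<close> of kernel \<open>w\<close>, \<open>I + C\<^sub>T = (I + M)' (I + M)\<close>, and \<open>(W\<^sup>T)\<^sup>-\<^sup>1 = J\<^sub>T (I + L)\<close> where \<open>I + L\<close> inverts \<open>I + M\<close>.
  The Gelfand--Levitan equation says, on each column, that \<open>(I + C\<^sub>T) z = (I + M)' (I + M) z\<close> takes the value
  forced by \<open>(I + M) z = - w\<close>; both factors are Volterra operators, so its solution is the kernel of \<open>L\<close>,
  whose diagonal is \<open>- w(x, x)\<close>.

  The response operator is \<open>f \<mapsto> - f' + r * f\<close> with \<open>r = w\<^sub>x(0, \<cdot>)\<close>. Given \<open>r\<close> on \<open>(0, 2T)\<close>, the equation
  for \<open>w\<close> is a Cauchy problem in the direction of \<open>x\<close>, and the condition on the diagonal returns \<open>q\<close>;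
  a Gronwall argument then shows that \<open>r\<close> determines \<open>w\<close> in \<open>x + t \<le> 2T\<close>, hence \<open>c\<^sub>T\<close>.\<close>

subsection \<open>Integral estimates and Volterra equations\<close>

text \<open>The constant in \<open>w(x, x)\<close> comes from inserting \<delta>(t - x) + w into the
  equation: \<open>w\<close> jumps across t = x, so w_tt - w_xx contributes 2 (d/dx) w(x, x)
  \<delta>(t - x), which has to cancel q(x) \<delta>(t - x). The memory term applied to the singular
  part leaves the free term K(t - x). With the delay t - x as a variable, the region x \<le> t
  becomes a quadrant and the side conditions become integration limits, so the kernel is a fixed
  point of an integral operator.

  Solutions for square-integrable controls are given only as limits, so the representation has to
  hold for every classical solution, not just for constructed ones; this calls for uniqueness, and
  for a dense supply of smooth controls so that limits exist at all. Operators and L_2 functions are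
  known only almost everywhere, while the conclusion concerns values on the diagonal; continuity of
  the kernels bridges the gap. The horizon is never small: the Volterra arguments rest on
  exponential weights directed along the variable of evolution.\<close>

text \<open>Replaces Gronwall's inequality: \<open>P B\<close> will be an exponentially weighted bound with constant
  \<open>B\<close>, which the equation at hand improves to \<open>P (B / 2)\<close>.\<close>

lemma nonpos_of_halving:
  fixes a c B :: real
  assumes "P B" "B \<ge> 0" "\<And>B. B \<ge> 0 \<Longrightarrow> P B \<Longrightarrow> P (B / 2)" "\<And>B. P B \<Longrightarrow> a \<le> B * c"
  shows "a \<le> 0"
proof -
  have P: "P (B / 2 ^ n)" for n
  proof (induction n)
    case 0
    then show ?case using assms(1) by simp
  next
    case (Suc n)
    then show ?case using assms(3)[of "B / 2 ^ n"] assms(2) by (simp add: field_simps)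
  qed
  have "(\<lambda>n. (B * c) * (1 / 2) ^ n) \<longlonglongrightarrow> (B * c) * 0"
    by (intro tendsto_intros LIMSEQ_power_zero) auto
  then have "(\<lambda>n. B / 2 ^ n * c) \<longlonglongrightarrow> 0"
    by (simp add: power_divide mult_ac)
  then show ?thesis
    using assms(4)[OF P] by (intro LIMSEQ_le_const) auto
qed

text \<open>Integrability of \<open>f\<close> is irrelevant: a non-integrable function has integral \<open>0\<close>.\<close>

lemma abs_integral_le:
  fixes f g :: "real \<Rightarrow> real"
  assumes "g integrable_on S" "\<And>x. x \<in> S \<Longrightarrow> \<bar>f x\<bar> \<le> g x"
  shows "\<bar>integral S f\<bar> \<le> integral S g"
proof (cases "f integrable_on S")
  case True
  then show ?thesis
    using integral_norm_bound_integral[of f S g] assms by simp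
next
  case False
  have "0 \<le> integral S g"
    using assms by (intro integral_nonneg) (auto intro: order_trans[OF abs_ge_zero])
  then show ?thesis
    using False by (simp add: not_integrable_integral)
qed

lemma has_integral_exp:
  fixes a b l B :: real
  assumes "a \<le> b" "l \<noteq> 0"
  shows "((\<lambda>s. B * exp (l * s)) has_integral (B / l * exp (l * b) - B / l * exp (l * a))) {a..b}"
  using assms
  by (intro fundamental_theorem_of_calculus)
     (auto intro!: derivative_eq_intros simp flip: has_real_derivative_iff_has_vector_derivative)

text \<open>The gain of \<open>1 / l\<close> over the size of the integrand is the source of the
  contractions: \<open>l\<close> is later taken large against the coefficients.\<close>

lemma abs_integral_exp_le:
  fixes f :: "real \<Rightarrow> real"
  assumes "l > 0" "B \<ge> 0" "\<And>s. s \<in> {a..b} \<Longrightarrow> \<bar>f s\<bar> \<le> B * exp (l * s)"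
  shows "\<bar>integral {a..b} f\<bar> \<le> B / l * exp (l * b)"
proof (cases "a \<le> b")
  case True
  note I = has_integral_exp[OF True, of l B]
  have "\<bar>integral {a..b} f\<bar> \<le> integral {a..b} (\<lambda>s. B * exp (l * s))"
    using I assms by (intro abs_integral_le) auto
  also have "\<dots> = B / l * exp (l * b) - B / l * exp (l * a)"
    using I assms by (intro integral_unique) auto
  also have "\<dots> \<le> B / l * exp (l * b)"
    using assms by simp
  finally show ?thesis .
qed (use assms in auto)

lemma abs_integral_le_const:
  fixes f :: "real \<Rightarrow> real"
  assumes "\<And>s. s \<in> {a..b} \<Longrightarrow> \<bar>f s\<bar> \<le> C" "a \<le> b"
  shows "\<bar>integral {a..b} f\<bar> \<le> C * (b - a)"
  using abs_integral_le[of "\<lambda>_. C" "{a..b}" f] assms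
  by (simp add: mult.commute integrable_const_ivl)

text \<open>Rescaling to the unit interval moves the parameter from the range of integration into
  the integrand, where continuity under a fixed integral applies.\<close>

lemma continuous_on_integral_upto:
  fixes G :: "'p::topological_space \<Rightarrow> real \<Rightarrow> real"
  assumes G: "continuous_on {(p, r). p \<in> S \<and> 0 \<le> r \<and> r \<le> m p} (\<lambda>(p, r). G p r)"
    and m: "continuous_on S m" "\<And>p. p \<in> S \<Longrightarrow> 0 \<le> m p"
  shows "continuous_on S (\<lambda>p. integral {0..m p} (G p))"
proof -
  have eq: "integral {0..m p} (G p) = integral (cbox 0 1) (\<lambda>r. m p * G p (m p * r))"
    if p: "p \<in> S" for p
  proof -
    have "continuous_on {0..m p} (G p)"
      using p by (intro continuous_on_compose2[OF G, where f = "\<lambda>r. (p, r)", simplified])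
        (auto intro!: continuous_intros)
    then have "((\<lambda>r. m p *\<^sub>R G p (m p * r)) has_integral (integral {m p * 0..m p * 1} (G p))) {0..1}"
      using m(2)[OF p]
      by (intro has_integral_substitution[where c = 0 and d = "m p"])
         (auto intro!: derivative_eq_intros simp: mult_left_le)
    from integral_unique[OF this] show ?thesis by simp
  qed
  have "continuous_on (S \<times> cbox 0 1) (\<lambda>(p, r). m p * G p (m p * r))"
    unfolding split_beta
    using m
    by (intro continuous_intros continuous_on_compose2[OF G, where f = "\<lambda>z. (fst z, m (fst z) * snd z)",
          simplified split_beta fst_conv snd_conv] continuous_on_compose2[OF m(1)])
       (auto simp: mult_left_le)
  then have "continuous_on S (\<lambda>p. integral (cbox 0 1) (\<lambda>r. m p * G p (m p * r)))"
    by (intro integral_continuous_on_param)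
  then show ?thesis
    by (subst continuous_on_cong[OF refl eq]) auto
qed

text \<open>Extended by zero off the compact triangle, \<open>g\<close> is Lebesgue integrable on
  the plane although no longer continuous, so Fubini for \<open>lborel\<close> applies to
  \<open>h\<close>.\<close>

lemma integral_triangle_swap:
  fixes g :: "real \<Rightarrow> real \<Rightarrow> real"
  assumes g: "continuous_on {(s, r). 0 \<le> r \<and> r \<le> s \<and> s \<le> a} (\<lambda>(s, r). g s r)"
  shows "integral {0..a} (\<lambda>s. integral {0..s} (g s)) = integral {0..a} (\<lambda>r. integral {r..a} (\<lambda>s. g s r))"
proof -
  define D where "D = {(s, r). 0 \<le> r \<and> r \<le> s \<and> s \<le> (a::real)}"
  have "D = (cbox 0 a \<times> cbox 0 a) \<inter> {z. snd z \<le> fst z}"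
    by (auto simp: D_def)
  moreover have "closed {z :: real \<times> real. snd z \<le> fst z}"
    by (intro closed_Collect_le continuous_intros)
  ultimately have D: "compact D"
    by (auto intro!: compact_Int_closed compact_Times)
  define h where "h = (\<lambda>s r. indicator D (s, r) * g s r)"
  have h: "integrable (lborel \<Otimes>\<^sub>M lborel) (\<lambda>(s, r). h s r)"
    using borel_integrable_compact[OF D g[folded D_def]]
    unfolding h_def lborel_prod by (simp add: split_beta')
  have i1: "(\<integral>r. h s r \<partial>lborel) = indicator {0..a} s * integral {0..s} (g s)" for s
  proof (cases "s \<in> {0..a}")
    case True
    have "continuous_on {0..s} (g s)"
      using True by (intro continuous_on_compose2[OF g, where f = "\<lambda>r. (s, r)", simplified])
        (auto intro!: continuous_intros)
    then have "set_integrable lborel {0..s} (g s)"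
      by (intro borel_integrable_atLeastAtMost')
    then have "(LINT r:{0..s}|lborel. g s r) = integral {0..s} (g s)"
      by (rule set_borel_integral_eq_integral)
    moreover have "h s r = indicator {0..s} r *\<^sub>R g s r" for r
      using True by (auto simp: h_def D_def indicator_def)
    ultimately show ?thesis
      using True by (simp add: set_lebesgue_integral_def)
  next
    case False
    then have "h s r = 0" for r by (auto simp: h_def D_def)
    then show ?thesis using False by simp
  qed
  have i2: "(\<integral>s. h s r \<partial>lborel) = indicator {0..a} r * integral {r..a} (\<lambda>s. g s r)" for r
  proof (cases "r \<in> {0..a}")
    case True
    have "continuous_on {r..a} (\<lambda>s. g s r)"
      using True by (intro continuous_on_compose2[OF g, where f = "\<lambda>s. (s, r)", simplified])
        (auto intro!: continuous_intros)
    then have "set_integrable lborel {r..a} (\<lambda>s. g s r)"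
      by (intro borel_integrable_atLeastAtMost')
    then have "(LINT s:{r..a}|lborel. g s r) = integral {r..a} (\<lambda>s. g s r)"
      by (rule set_borel_integral_eq_integral)
    moreover have "h s r = indicator {r..a} s *\<^sub>R g s r" for s
      using True by (auto simp: h_def D_def indicator_def)
    ultimately show ?thesis
      using True by (simp add: set_lebesgue_integral_def)
  next
    case False
    then have "h s r = 0" for s by (auto simp: h_def D_def)
    then show ?thesis using False by simp
  qed
  have I1: "integrable lborel (\<lambda>s. \<integral>r. h s r \<partial>lborel)"
    using lborel_pair.integrable_fst'[OF h] by simp
  have I2: "integrable lborel (\<lambda>r. \<integral>s. h s r \<partial>lborel)"
    using lborel_pair.integrable_snd[OF h] by simp
  have "(\<integral>r. (\<integral>s. h s r \<partial>lborel) \<partial>lborel) = (\<integral>s. (\<integral>r. h s r \<partial>lborel) \<partial>lborel)"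
    using lborel_pair.Fubini_integral[OF h] .
  then show ?thesis
    using set_borel_integral_eq_integral(2)[of "{0..a}" "\<lambda>s. integral {0..s} (g s)"]
      set_borel_integral_eq_integral(2)[of "{0..a}" "\<lambda>r. integral {r..a} (\<lambda>s. g s r)"] I1 I2
    by (simp add: i1 i2 set_lebesgue_integral_def set_integrable_def)
qed

text \<open>Only the restriction of \<open>u\<close> to \<open>R n\<close> enters \<open>A u\<close> on \<open>R n\<close>, so the Neumann series
  converges locally uniformly although no global bound is available.\<close>

lemma volterra_fixpoint:
  fixes A :: "('a::metric_space \<Rightarrow> real) \<Rightarrow> 'a \<Rightarrow> real" and R :: "nat \<Rightarrow> 'a set" and D :: "'a set"
  assumes A: "\<And>u. continuous_on D u \<Longrightarrow> continuous_on D (A u)"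
    and R: "\<And>n. compact (R n)" "\<And>n. R n \<subseteq> D"
    and exh: "\<And>x. x \<in> D \<Longrightarrow> \<exists>n e. e > 0 \<and> D \<inter> ball x e \<subseteq> R n"
    and om: "\<And>n x. x \<in> R n \<Longrightarrow> 1 \<le> om n x \<and> om n x \<le> Om n"
    and contr: "\<And>u v n B. continuous_on D u \<Longrightarrow> continuous_on D v \<Longrightarrow> B \<ge> 0 \<Longrightarrow>
        (\<And>x. x \<in> R n \<Longrightarrow> \<bar>u x - v x\<bar> \<le> B * om n x) \<Longrightarrow>
        (\<And>x. x \<in> R n \<Longrightarrow> \<bar>A u x - A v x\<bar> \<le> B / 2 * om n x)"
  shows "\<exists>w. continuous_on D w \<and> (\<forall>x\<in>D. w x = A w x)"
proof -
  define u where "u = (\<lambda>k. (A ^^ k) (\<lambda>_. 0))"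
  have u_Suc: "u (Suc k) = A (u k)" for k by (simp add: u_def)
  have uc: "continuous_on D (u k)" for k
    by (induction k) (auto simp: u_def A)
  define w where "w = (\<lambda>x. \<Sum>k. u (Suc k) x - u k x)"
  have "\<exists>B\<ge>0. \<forall>k. \<forall>x\<in>R n. \<bar>u (Suc k) x - u k x\<bar> \<le> B / 2 ^ k * om n x" for n
  proof -
    have "continuous_on (R n) (\<lambda>x. u (Suc 0) x - u 0 x)"
      using uc R(2) by (intro continuous_intros) (auto intro: continuous_on_subset)
    from compact_imp_bounded[OF compact_continuous_image[OF this R(1)]]
    obtain B where B: "B > 0" "\<And>x. x \<in> R n \<Longrightarrow> \<bar>u (Suc 0) x - u 0 x\<bar> \<le> B"
      unfolding bounded_pos by auto
    have "\<forall>x\<in>R n. \<bar>u (Suc k) x - u k x\<bar> \<le> B / 2 ^ k * om n x" for k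
    proof (induction k)
      case 0
      have "B * 1 \<le> B * om n x" if "x \<in> R n" for x
        using om[OF that] B(1) by (intro mult_left_mono) auto
      then show ?case using B(2) by force
    next
      case (Suc k)
      then show ?case
        using contr[OF uc[of "Suc k"] uc[of k], of "B / 2 ^ k" n] B(1)
        by (auto simp: u_Suc field_simps)
    qed
    then show ?thesis using B(1) by (intro exI[of _ B]) auto
  qed
  then obtain B where B: "\<And>n. B n \<ge> 0"
    "\<And>n k x. x \<in> R n \<Longrightarrow> \<bar>u (Suc k) x - u k x\<bar> \<le> B n / 2 ^ k * om n x" by metis
  have ul: "uniform_limit (R n) u w sequentially" for n
  proof -
    have "uniform_limit (R n) (\<lambda>m x. \<Sum>k<m. u (Suc k) x - u k x) w sequentially"
      unfolding w_def
    proof (rule Weierstrass_m_test)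
      fix k x assume x: "x \<in> R n"
      have "B n / 2 ^ k * om n x \<le> B n / 2 ^ k * Om n"
        using om[OF x] B(1) by (intro mult_left_mono) auto
      then show "norm (u (Suc k) x - u k x) \<le> (B n * Om n) * (1 / 2) ^ k"
        using B(2)[OF x, of k] by (simp add: power_divide)
    qed (intro summable_mult summable_geometric, simp)
    moreover have "(\<Sum>k<m. u (Suc k) x - u k x) = u m x" for m x
      by (subst sum_lessThan_telescope) (simp add: u_def)
    ultimately show ?thesis by simp
  qed
  have wR: "continuous_on (R n) w" for n
    by (rule uniform_limit_theorem[OF _ ul]) (auto intro!: always_eventually continuous_on_subset[OF uc R(2)])
  \<comment> \<open>Continuity on each \<open>R n\<close> passes to \<open>D\<close> because some
    \<open>R n\<close> contains a whole relative neighbourhood of the point.\<close>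
  have wc: "continuous_on D w"
    unfolding continuous_on_eq_continuous_within
  proof
    fix x assume x: "x \<in> D"
    obtain n e where e: "e > 0" "D \<inter> ball x e \<subseteq> R n" using exh[OF x] by blast
    then have "x \<in> R n" using x by auto
    then have "continuous (at x within R n) w"
      using wR[of n] by (simp add: continuous_on_eq_continuous_within)
    then have "continuous (at x within (D \<inter> ball x e)) w"
      using e(2) continuous_within_subset by blast
    moreover have "at x within (D \<inter> ball x e) = at x within D"
      using e(1) by (intro at_within_nhd[of x "ball x e"]) auto
    ultimately show "continuous (at x within D) w" by simp
  qed
  have "w x = A w x" if x: "x \<in> D" for x
  proof -
    obtain n e where e: "e > 0" "D \<inter> ball x e \<subseteq> R n" using exh[OF x] by blast
    then have xR: "x \<in> R n" using x by auto
    have "(\<lambda>k. A (u k) x) \<longlonglongrightarrow> A w x"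
    proof (rule LIMSEQ_I)
      fix r :: real assume r: "r > 0"
      have Om: "Om n \<ge> 1" using om[OF xR] by linarith
      from uniform_limitD[OF ul[of n], of "r / Om n"] r Om
      obtain N where N: "\<And>k y. k \<ge> N \<Longrightarrow> y \<in> R n \<Longrightarrow> \<bar>u k y - w y\<bar> < r / Om n"
        unfolding eventually_sequentially dist_real_def by (auto simp: Om)
      show "\<exists>N. \<forall>k\<ge>N. norm (A (u k) x - A w x) < r"
      proof (intro exI allI impI)
        fix k assume k: "k \<ge> N"
        have "\<bar>u k y - w y\<bar> \<le> r / Om n * om n y" if "y \<in> R n" for y
        proof -
          have "r / Om n * 1 \<le> r / Om n * om n y"
            using om[OF that] r Om by (intro mult_left_mono) auto
          then show ?thesis using N[OF k that] by linarith
        qed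
        then have "\<bar>A (u k) x - A w x\<bar> \<le> r / Om n / 2 * om n x"
          using contr[OF uc wc _ _ xR, of "r / Om n" k] r Om by auto
        also have "\<dots> \<le> r / Om n / 2 * Om n"
          using om[OF xR] r Om by (intro mult_left_mono) auto
        also have "\<dots> < r" using r Om by simp
        finally show "norm (A (u k) x - A w x) < r" by simp
      qed
    qed
    moreover have "(\<lambda>k. A (u k) x) \<longlonglongrightarrow> w x"
      using LIMSEQ_Suc[OF tendsto_uniform_limitI[OF ul xR]] by (simp add: u_Suc)
    ultimately show ?thesis by (rule LIMSEQ_unique[symmetric])
  qed
  with wc show ?thesis by blast
qed

text \<open>Existence of both partial derivatives and continuity of the second give the total
  derivative; the mean value argument behind \<open>has_derivative_partialsI\<close> runs along
  segments in \<open>Y\<close>, hence the convexity. That rule wants the second partial as a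
  continuous family of bounded linear maps.\<close>

lemma C1_gradI:
  fixes u ux ut :: "real \<Rightarrow> real \<Rightarrow> real"
  assumes "\<And>x t. x \<in> X \<Longrightarrow> t \<in> Y \<Longrightarrow> ((\<lambda>x. u x t) has_real_derivative ux x t) (at x within X)"
    and "\<And>x t. x \<in> X \<Longrightarrow> t \<in> Y \<Longrightarrow> ((\<lambda>t. u x t) has_real_derivative ut x t) (at t within Y)"
    and "continuous_on (X \<times> Y) (\<lambda>(x, t). ux x t)" "continuous_on (X \<times> Y) (\<lambda>(x, t). ut x t)"
    and "convex Y"
  shows "C1_grad (X \<times> Y) u ux ut"
  unfolding C1_grad_def
proof (intro conjI allI impI assms)
  fix x t assume xt: "(x, t) \<in> X \<times> Y"
  have "continuous_on (X \<times> Y) (\<lambda>(x, t). blinfun_mult_right (ut x t))"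
    using assms(4) unfolding split_beta by (intro continuous_intros)
  then have "((\<lambda>(x, t). u x t) has_derivative (\<lambda>(h, k). ux x t * h + blinfun_mult_right (ut x t) k)) (at (x, t) within X \<times> Y)"
    using assms xt
    by (intro has_derivative_partialsI)
       (auto simp: has_field_derivative_def continuous_on_eq_continuous_within mult_commute_abs)
  then show "((\<lambda>(x, t). u x t) has_derivative (\<lambda>(h, k). ux x t * h + ut x t * k)) (at (x, t) within X \<times> Y)"
    by simp
qed

subsection \<open>The Goursat problem\<close>

abbreviation quadrant :: "(real \<times> real) set" where
  "quadrant \<equiv> {0..} \<times> {0..}"

text \<open>The second variable is the delay \<open>e = t - x\<close> throughout. For \<open>w(x, t) = W x (t - x)\<close> with
  \<open>w\<^sub>t\<^sub>t - w\<^sub>x\<^sub>x = - mem_force q K W x e\<close>, the derivative of \<open>w\<close> along \<open>t + x\<close> is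
  \<open>- char_slope q K W x e / 2\<close>; the curve \<open>(x + (e - r) / 2, r)\<close> is the characteristic \<open>t + x = const\<close>.\<close>

definition mem_force ::
  "(real \<Rightarrow> real) \<Rightarrow> (real \<Rightarrow> real) \<Rightarrow> (real \<Rightarrow> real \<Rightarrow> real) \<Rightarrow> real \<Rightarrow> real \<Rightarrow> real" where
  "mem_force q K u x e = q x * u x e + K e + integral {0..e} (\<lambda>s. K (e - s) * u x s)"

definition char_slope ::
  "(real \<Rightarrow> real) \<Rightarrow> (real \<Rightarrow> real) \<Rightarrow> (real \<Rightarrow> real \<Rightarrow> real) \<Rightarrow> real \<Rightarrow> real \<Rightarrow> real" where
  "char_slope q K u x e = q (x + e / 2) + integral {0..e} (\<lambda>r. mem_force q K u (x + (e - r) / 2) r)"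

text \<open>The singular part alone meets the boundary condition, so the remainder vanishes at
  \<open>x = 0\<close>; integrating its slope from there along \<open>t - x = const\<close> gives
  this operator. The condition on the diagonal is built into \<open>char_slope\<close> through
  \<open>q (x + e / 2)\<close>.\<close>

abbreviation goursat_op ::
  "(real \<Rightarrow> real) \<Rightarrow> (real \<Rightarrow> real) \<Rightarrow> (real \<Rightarrow> real \<Rightarrow> real) \<Rightarrow> real \<Rightarrow> real \<Rightarrow> real" where
  "goursat_op q K u x e \<equiv> (- 1 / 2) * integral {0..x} (\<lambda>y. char_slope q K u y e)"

lemma continuous_on_char_integral:
  fixes f :: "real \<Rightarrow> real \<Rightarrow> real"
  assumes "continuous_on quadrant (\<lambda>(x, e). f x e)"
  shows "continuous_on quadrant (\<lambda>(x, e). integral {0..e} (\<lambda>r. f (x + (e - r) / 2) r))"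
proof -
  have "continuous_on quadrant (\<lambda>p. integral {0..snd p} (\<lambda>r. f (fst p + (snd p - r) / 2) r))"
  proof (rule continuous_on_integral_upto[where G = "\<lambda>p r. f (fst p + (snd p - r) / 2) r" and m = snd])
    show "continuous_on {(p, r). p \<in> quadrant \<and> 0 \<le> r \<and> r \<le> snd p}
        (\<lambda>(p, r). f (fst p + (snd p - r) / 2) r)"
      unfolding split_beta
      by (rule continuous_on_compose2[OF assms, where
            f = "\<lambda>z. (fst (fst z) + (snd (fst z) - snd z) / 2, snd z)", unfolded split_beta fst_conv snd_conv])
         (auto intro!: continuous_intros)
  qed (auto intro!: continuous_intros)
  then show ?thesis by (simp add: split_beta')
qed

lemma continuous_on_mem_conv:
  fixes u :: "real \<Rightarrow> real \<Rightarrow> real"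
  assumes u: "continuous_on quadrant (\<lambda>(x, e). u x e)" and K: "continuous_on {0..} K"
  shows "continuous_on quadrant (\<lambda>(x, e). integral {0..e} (\<lambda>s. K (e - s) * u x s))"
proof -
  have "continuous_on quadrant (\<lambda>p. integral {0..snd p} (\<lambda>s. K (snd p - s) * u (fst p) s))"
  proof (rule continuous_on_integral_upto[where G = "\<lambda>p s. K (snd p - s) * u (fst p) s" and m = snd])
    show "continuous_on {(p, r). p \<in> quadrant \<and> 0 \<le> r \<and> r \<le> snd p} (\<lambda>(p, r). K (snd p - r) * u (fst p) r)"
      unfolding split_beta
      by (intro continuous_intros continuous_on_compose2[OF K]
          continuous_on_compose2[OF u, where f = "\<lambda>z. (fst (fst z), snd z)", unfolded split_beta fst_conv snd_conv])
         (auto intro!: continuous_intros)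
  qed (auto intro!: continuous_intros)
  then show ?thesis by (simp add: split_beta')
qed

lemma continuous_on_fst_comp:
  fixes f :: "real \<Rightarrow> real"
  assumes "continuous_on {0..} f"
  shows "continuous_on quadrant (\<lambda>(x, e). f x)" "continuous_on quadrant (\<lambda>(x, e). f e)"
    "continuous_on quadrant (\<lambda>(x, e). f (x + e / 2))"
  unfolding split_beta
  by (auto intro!: continuous_on_compose2[OF assms] continuous_intros)

lemma continuous_on_mem_force:
  assumes "continuous_on quadrant (\<lambda>(x, e). u x e)" "continuous_on {0..} q" "continuous_on {0..} K"
  shows "continuous_on quadrant (\<lambda>(x, e). mem_force q K u x e)"
  using continuous_on_add[OF continuous_on_add[OF continuous_on_mult[OF continuous_on_fst_comp(1)[OF assms(2)] assms(1)]
        continuous_on_fst_comp(2)[OF assms(3)]] continuous_on_mem_conv[OF assms(1,3)]]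
  unfolding mem_force_def by (simp add: split_beta')

lemma continuous_on_char_slope:
  assumes "continuous_on quadrant (\<lambda>(x, e). u x e)" "continuous_on {0..} q" "continuous_on {0..} K"
  shows "continuous_on quadrant (\<lambda>(x, e). char_slope q K u x e)"
  using continuous_on_add[OF continuous_on_fst_comp(3)[OF assms(2)]
      continuous_on_char_integral[OF continuous_on_mem_force[OF assms]]]
  unfolding char_slope_def by (simp add: split_beta')

lemma continuous_on_slice:
  assumes "continuous_on (X \<times> Y) (\<lambda>(x, t). f x t)"
  shows "x \<in> X \<Longrightarrow> continuous_on Y (f x)" "t \<in> Y \<Longrightarrow> continuous_on X (\<lambda>x. f x t)"
  by (auto intro!: continuous_on_compose2[OF assms, of _ "\<lambda>t. (x, t)", simplified]
      continuous_on_compose2[OF assms, of _ "\<lambda>x. (x, t)", simplified] continuous_intros)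

lemma conv_integrable:
  fixes K v :: "real \<Rightarrow> real"
  assumes K: "continuous_on {0..} K" and v: "continuous_on {0..} v" 
  shows "(\<lambda>s. K (e - s) * v s) integrable_on {0..e}"
  by (intro integrable_continuous_interval continuous_intros continuous_on_compose2[OF K]
      continuous_on_subset[OF v]) auto

text \<open>Two potentials are allowed because the formula serves twice: with \<open>p = q\<close>
  in the contraction, with different ones in the comparison of two systems. The free term
  \<open>K e\<close> cancels in both.\<close>

lemma mem_force_diff:
  assumes u: "continuous_on quadrant (\<lambda>(x, e). u x e)" and v: "continuous_on quadrant (\<lambda>(x, e). v x e)"
    and K: "continuous_on {0..} K" and xe: "0 \<le> x" "0 \<le> e"
  shows "mem_force q K u x e - mem_force p K v x e
    = q x * (u x e - v x e) + (q x - p x) * v x e + integral {0..e} (\<lambda>s. K (e - s) * (u x s - v x s))"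
proof -
  have "continuous_on {0..} (u x)" "continuous_on {0..} (v x)"
    using continuous_on_slice(1)[OF u] continuous_on_slice(1)[OF v] xe by auto
  then show ?thesis
    unfolding mem_force_def
    by (simp add: right_diff_distrib Henstock_Kurzweil_Integration.integral_diff conv_integrable K)
       (simp add: algebra_simps)
qed

lemma char_integrable:
  fixes f :: "real \<Rightarrow> real \<Rightarrow> real"
  assumes f: "continuous_on quadrant (\<lambda>(x, e). f x e)" and "0 \<le> x" "0 \<le> e"
  shows "(\<lambda>r. f (x + (e - r) / 2) r) integrable_on {0..e}"
  using assms(2,3)
  by (intro integrable_continuous_interval
      continuous_on_compose2[OF f, of _ "\<lambda>r. (x + (e - r) / 2, r)", unfolded split_beta fst_conv snd_conv])
     (auto intro!: continuous_intros)

lemma char_slope_diff: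
  assumes u: "continuous_on quadrant (\<lambda>(x, e). u x e)" and v: "continuous_on quadrant (\<lambda>(x, e). v x e)"
    and K: "continuous_on {0..} K" and q: "continuous_on {0..} q" "continuous_on {0..} p" and xe: "0 \<le> x" "0 \<le> e"
  shows "char_slope q K u x e - char_slope p K v x e = q (x + e / 2) - p (x + e / 2)
    + integral {0..e} (\<lambda>r. mem_force q K u (x + (e - r) / 2) r - mem_force p K v (x + (e - r) / 2) r)"
  unfolding char_slope_def
  using char_integrable[OF continuous_on_mem_force[OF u q(1) K] xe]
    char_integrable[OF continuous_on_mem_force[OF v q(2) K] xe]
  by (simp add: Henstock_Kurzweil_Integration.integral_diff)

lemma continuous_bounded_Icc:
  fixes f :: "real \<Rightarrow> real"
  assumes "continuous_on {0..} f"
  obtains C where "C \<ge> 0" "\<And>x. 0 \<le> x \<Longrightarrow> x \<le> b \<Longrightarrow> \<bar>f x\<bar> \<le> C"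
proof -
  have "continuous_on {0..b} f"
    by (rule continuous_on_subset[OF assms]) auto
  from compact_imp_bounded[OF compact_continuous_image[OF this compact_Icc]]
  obtain C where "C > 0" "\<And>x. x \<in> {0..b} \<Longrightarrow> \<bar>f x\<bar> \<le> C"
    unfolding bounded_pos by auto
  then show ?thesis using that[of C] by auto
qed

text \<open>The region \<open>2 * x + e \<le> N\<close> is a domain of dependence:
  \<open>2 * x + e\<close> is constant on the characteristic \<open>(x + (e - r) / 2, r)\<close> and
  decreases with \<open>x\<close> at fixed delay. A weight in the delay alone suffices, since the
  outer integral in \<open>x\<close> costs at most a factor \<open>N\<close>.\<close>

lemma goursat_contraction:
  assumes q: "continuous_on {0..} q" and K: "continuous_on {0..} K" and N: "N \<ge> 0"
  shows "\<exists>l>0. \<forall>u v B. continuous_on quadrant (\<lambda>(x, e). u x e) \<longrightarrow> continuous_on quadrant (\<lambda>(x, e). v x e) \<longrightarrow>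
     B \<ge> 0 \<longrightarrow> (\<forall>x e. 0 \<le> x \<and> 0 \<le> e \<and> 2 * x + e \<le> N \<longrightarrow> \<bar>u x e - v x e\<bar> \<le> B * exp (l * e)) \<longrightarrow>
     (\<forall>x e. 0 \<le> x \<and> 0 \<le> e \<and> 2 * x + e \<le> N \<longrightarrow>
       \<bar>goursat_op q K u x e - goursat_op q K v x e\<bar> \<le> B / 2 * exp (l * e))"
proof -
  obtain Cq where Cq: "Cq \<ge> 0" "\<And>x. 0 \<le> x \<Longrightarrow> x \<le> N \<Longrightarrow> \<bar>q x\<bar> \<le> Cq"
    using continuous_bounded_Icc[OF q] by metis
  obtain CK where CK: "CK \<ge> 0" "\<And>x. 0 \<le> x \<Longrightarrow> x \<le> N \<Longrightarrow> \<bar>K x\<bar> \<le> CK"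
    using continuous_bounded_Icc[OF K] by metis
  \<comment> \<open>The \<open>1 / l\<close> from the characteristic integral has to beat both
    coefficients and the length \<open>N\<close> of the outer integral; the contraction factor
    \<open>1 / 2\<close> is then the one in \<open>goursat_op\<close>.\<close>
  define l where "l = 1 + N * (Cq + CK)"
  have l: "l \<ge> 1" using Cq(1) CK(1) N by (simp add: l_def)
  show ?thesis
  proof (intro exI[of _ l] conjI allI impI)
    show "l > 0" using l by simp
    fix u v :: "real \<Rightarrow> real \<Rightarrow> real" and B x e :: real
    assume u: "continuous_on quadrant (\<lambda>(x, e). u x e)" and v: "continuous_on quadrant (\<lambda>(x, e). v x e)"
      and B: "B \<ge> 0" and uv: "\<forall>x e. 0 \<le> x \<and> 0 \<le> e \<and> 2 * x + e \<le> N \<longrightarrow> \<bar>u x e - v x e\<bar> \<le> B * exp (l * e)"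
      and xe: "0 \<le> x \<and> 0 \<le> e \<and> 2 * x + e \<le> N"
    have F: "\<bar>mem_force q K u y r - mem_force q K v y r\<bar> \<le> (Cq + CK) * B * exp (l * r)"
      if yr: "0 \<le> y" "0 \<le> r" "2 * y + r \<le> N" for y r
    proof -
      have "\<bar>integral {0..r} (\<lambda>s. K (r - s) * (u y s - v y s))\<bar> \<le> CK * B / l * exp (l * r)"
      proof (rule abs_integral_exp_le)
        fix s assume s: "s \<in> {0..r}"
        have "\<bar>K (r - s)\<bar> * \<bar>u y s - v y s\<bar> \<le> CK * (B * exp (l * s))"
          using s yr CK uv by (intro mult_mono) auto
        then show "\<bar>K (r - s) * (u y s - v y s)\<bar> \<le> CK * B * exp (l * s)"
          by (simp add: abs_mult)
      qed (use l B CK in auto)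
      \<comment> \<open>The gain of the memory integral is given away, since the term with
        \<open>q y\<close> has no such gain to match.\<close>
      also have "\<dots> \<le> CK * B * exp (l * r)"
        using l B CK frac_le[of "CK * B" "CK * B" 1 l] by (intro mult_right_mono) auto
      finally have "\<bar>integral {0..r} (\<lambda>s. K (r - s) * (u y s - v y s))\<bar> \<le> CK * B * exp (l * r)" .
      moreover have "\<bar>q y * (u y r - v y r)\<bar> \<le> Cq * (B * exp (l * r))"
        unfolding abs_mult using yr Cq uv by (intro mult_mono) auto
      ultimately show ?thesis
        unfolding mem_force_diff[OF u v K yr(1,2)] by (simp add: algebra_simps)
    qed
    have S: "\<bar>char_slope q K u y e - char_slope q K v y e\<bar> \<le> (Cq + CK) * B / l * exp (l * e)"
      if y: "y \<in> {0..x}" for y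
    proof -
      have "\<bar>integral {0..e} (\<lambda>r. mem_force q K u (y + (e - r) / 2) r - mem_force q K v (y + (e - r) / 2) r)\<bar>
        \<le> (Cq + CK) * B / l * exp (l * e)"
        using l B Cq CK xe y
        by (intro abs_integral_exp_le F) (auto simp: field_simps)
      moreover have "0 \<le> y" "0 \<le> e" using y xe by auto
      ultimately show ?thesis
        using char_slope_diff[OF u v K q q, of y e] by simp
    qed
    have i: "(\<lambda>y. char_slope q K u y e) integrable_on {0..x}" "(\<lambda>y. char_slope q K v y e) integrable_on {0..x}"
      using continuous_on_slice(2)[OF continuous_on_char_slope[OF u q K], of e]
        continuous_on_slice(2)[OF continuous_on_char_slope[OF v q K], of e] xe
      by (auto intro!: integrable_continuous_interval intro: continuous_on_subset)
    have "\<bar>integral {0..x} (\<lambda>y. char_slope q K u y e - char_slope q K v y e)\<bar> \<le> (Cq + CK) * B / l * exp (l * e) * (x - 0)"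
      by (rule abs_integral_le_const) (use S xe in auto)
    also have "\<dots> \<le> (Cq + CK) * B / l * exp (l * e) * N"
      using xe B Cq CK l by (intro mult_left_mono) auto
    also have "\<dots> = (N * (Cq + CK)) / l * (B * exp (l * e))" by simp
    also have "\<dots> \<le> 1 * (B * exp (l * e))"
      using B l by (intro mult_right_mono) (auto simp: l_def)
    finally have "\<bar>integral {0..x} (\<lambda>y. char_slope q K u y e) - integral {0..x} (\<lambda>y. char_slope q K v y e)\<bar> \<le> B * exp (l * e)"
      by (simp add: Henstock_Kurzweil_Integration.integral_diff i)
    then show "\<bar>goursat_op q K u x e - goursat_op q K v x e\<bar>
         \<le> B / 2 * exp (l * e)" by linarith
  qed
qed

text \<open>\<open>q\<close> and \<open>K\<close> are bounded only on bounded sets, so the rate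
  \<open>l n\<close> depends on the region \<open>R n\<close>; this is what the exhaustion in
  \<open>volterra_fixpoint\<close> accommodates.\<close>

lemma goursat_kernel_exists:
  assumes q: "continuous_on {0..} q" and K: "continuous_on {0..} K"
  shows "\<exists>W. continuous_on quadrant (\<lambda>(x, e). W x e) \<and>
    (\<forall>x\<ge>0. \<forall>e\<ge>0. W x e = goursat_op q K W x e)"
proof -
  define R where "R = (\<lambda>n::nat. {(x, e). 0 \<le> x \<and> 0 \<le> e \<and> 2 * x + e \<le> real n})"
  define A where "A = (\<lambda>U (x, e). goursat_op q K (curry U) x e)"
  obtain l where l: "\<And>n::nat. l n > 0" and contr: "\<And>n::nat. \<forall>u v B. continuous_on quadrant (\<lambda>(x, e). u x e) \<longrightarrow> continuous_on quadrant (\<lambda>(x, e). v x e) \<longrightarrow>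
     B \<ge> 0 \<longrightarrow> (\<forall>x e. 0 \<le> x \<and> 0 \<le> e \<and> 2 * x + e \<le> real n \<longrightarrow> \<bar>u x e - v x e\<bar> \<le> B * exp (l n * e)) \<longrightarrow>
     (\<forall>x e. 0 \<le> x \<and> 0 \<le> e \<and> 2 * x + e \<le> real n \<longrightarrow>
       \<bar>goursat_op q K u x e - goursat_op q K v x e\<bar> \<le> B / 2 * exp (l n * e))"
    using goursat_contraction[OF q K, of "real n" for n] by (auto simp only: of_nat_0_le_iff) metis
  have "\<exists>w. continuous_on quadrant w \<and> (\<forall>p\<in>quadrant. w p = A w p)"
  proof (rule volterra_fixpoint[where R = R and om = "\<lambda>n p. exp (l n * snd p)" and Om = "\<lambda>n. exp (l n * n)"])
    fix u :: "real \<times> real \<Rightarrow> real" assume "continuous_on quadrant u"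
    then have u: "continuous_on quadrant (\<lambda>(x, e). curry u x e)" by simp
    have "continuous_on quadrant (\<lambda>p. integral {0..fst p} (\<lambda>y. char_slope q K (curry u) y (snd p)))"
    proof (rule continuous_on_integral_upto)
      show "continuous_on {(p, r). p \<in> quadrant \<and> 0 \<le> r \<and> r \<le> fst p} (\<lambda>(p, r). char_slope q K (curry u) r (snd p))"
        unfolding split_beta
        by (rule continuous_on_compose2[OF continuous_on_char_slope[OF u q K], of _ "\<lambda>z. (snd z, snd (fst z))",
              unfolded split_beta fst_conv snd_conv])
           (auto intro!: continuous_intros)
    qed (auto intro!: continuous_intros)
    then show "continuous_on quadrant (A u)"
      unfolding A_def split_beta' by (intro continuous_intros)
  next
    fix n
    have "R n = cbox (0, 0) (real n, real n) \<inter> {p. 2 * fst p + snd p \<le> real n}"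
      by (auto simp: R_def cbox_Pair_eq)
    moreover have "closed {p :: real \<times> real. 2 * fst p + snd p \<le> real n}"
      by (intro closed_Collect_le continuous_intros)
    ultimately show "compact (R n)"
      by (simp add: compact_Int_closed)
    show "R n \<subseteq> quadrant" by (auto simp: R_def)
  next
    fix p :: "real \<times> real" assume p: "p \<in> quadrant"
    \<comment> \<open>The 3 absorbs the variation of \<open>2 * fst p + snd p\<close> over a ball of
      radius 1.\<close>
    obtain n :: nat where n: "2 * fst p + snd p + 3 \<le> real n"
      using real_arch_simple by blast
    have "quadrant \<inter> ball p 1 \<subseteq> R n"
    proof
      fix z assume z: "z \<in> quadrant \<inter> ball p 1"
      then have "\<bar>fst p - fst z\<bar> < 1" "\<bar>snd p - snd z\<bar> < 1"
        using dist_fst_le[of p z] dist_snd_le[of p z] by (auto simp: dist_real_def)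
      then show "z \<in> R n" using z n by (auto simp: R_def split_beta)
    qed
    then show "\<exists>n e. e > 0 \<and> quadrant \<inter> ball p e \<subseteq> R n"
      by (intro exI[of _ n] exI[of _ 1]) auto
  next
    fix n p assume "p \<in> R n"
    then show "1 \<le> exp (l n * snd p) \<and> exp (l n * snd p) \<le> exp (l n * real n)"
      using l[of n] by (auto simp: R_def)
  next
    fix u v :: "real \<times> real \<Rightarrow> real" and n B p
    assume "continuous_on quadrant u" "continuous_on quadrant v" "B \<ge> 0" 
      "\<And>x. x \<in> R n \<Longrightarrow> \<bar>u x - v x\<bar> \<le> B * exp (l n * snd x)" "p \<in> R n"
    then show "\<bar>A u p - A v p\<bar> \<le> B / 2 * exp (l n * snd p)"
      using contr[of n, rule_format, of "curry u" "curry v" B "fst p" "snd p"]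
      by (auto simp: R_def A_def split_beta)
  qed
  then obtain w where w: "continuous_on quadrant w" "\<And>p. p \<in> quadrant \<Longrightarrow> w p = A w p" by blast
  then show ?thesis
    by (intro exI[of _ "curry w"]) (auto simp: A_def)
qed

subsection \<open>Regularity of the Goursat kernel\<close>

lemma integral_has_real_derivative_atLeast:
  assumes "continuous_on {0..} g" "0 \<le> x"
  shows "((\<lambda>x. integral {0..x} g) has_real_derivative g x) (at x within {0..})"
proof -
  have "continuous_on {0..x + 1} g"
    by (rule continuous_on_subset[OF assms(1)]) auto
  then have "((\<lambda>x. integral {0..x} g) has_real_derivative g x) (at x within {0..x + 1})"
    using assms by (intro integral_has_real_derivative) auto
  moreover have "at x within {0..x + 1} = at x within {0..}"
    by (intro at_within_nhd[of x "{..<x + 1}"]) auto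
  ultimately show ?thesis by simp
qed

lemma deriv_shift_atLeast:
  assumes "\<And>y. 0 \<le> y \<Longrightarrow> (f has_real_derivative f' y) (at y within {0..})" "0 \<le> x" "0 \<le> c"
  shows "((\<lambda>x. f (x + c)) has_real_derivative f' (x + c)) (at x within {0..})"
proof -
  have "(f has_real_derivative f' (x + c)) (at (x + c) within (\<lambda>x. x + c) ` {0..})"
    using assms by (intro DERIV_subset[OF assms(1)]) auto
  moreover have "((\<lambda>x. x + c) has_real_derivative 1) (at x within {0..})"
    by (auto intro!: derivative_eq_intros)
  ultimately show ?thesis
    using DERIV_image_chain[of f "f' (x + c)" "\<lambda>x. x + c" x "{0..}" 1] by (simp add: o_def)
qed

text \<open>Differentiating an integral along characteristics across the characteristics:
  the integrand itself is expanded by the fundamental theorem, so that no values outside the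
  quadrant are needed.\<close>

lemma deriv_char_integral:
  fixes p p1 :: "real \<Rightarrow> real \<Rightarrow> real"
  assumes p: "continuous_on quadrant (\<lambda>(x, e). p x e)" and p1: "continuous_on quadrant (\<lambda>(x, e). p1 x e)"
    and d: "\<And>x e. 0 \<le> x \<Longrightarrow> 0 \<le> e \<Longrightarrow> ((\<lambda>x. p x e) has_real_derivative p1 x e) (at x within {0..})"
    and x: "0 \<le> x" and e: "0 \<le> e"
  shows "((\<lambda>e. integral {0..e} (\<lambda>r. p (x + (e - r) / 2) r)) has_real_derivative
     p x e + 1 / 2 * integral {0..e} (\<lambda>r. p1 (x + (e - r) / 2) r)) (at e within {0..})"
proof -
  \<comment> \<open>\<open>G\<close> is the claimed derivative as a function of the upper limit.
    Once \<open>eq\<close> exhibits the characteristic integral as its antiderivative, the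
    fundamental theorem finishes.\<close>
  define G where "G = (\<lambda>s. p x s + 1 / 2 * integral {0..s} (\<lambda>r. p1 (x + (s - r) / 2) r))"
  have G: "continuous_on {0..} G"
    unfolding G_def using x continuous_on_slice(1)[OF p] continuous_on_slice(1)[OF continuous_on_char_integral[OF p1]]
    by (intro continuous_intros) auto
  have eq: "integral {0..e} (\<lambda>r. p (x + (e - r) / 2) r) = integral {0..e} G" if e: "0 \<le> e" for e
  proof -
    have tri: "continuous_on {(s, r). 0 \<le> r \<and> r \<le> s \<and> s \<le> e} (\<lambda>(s, r). 1 / 2 * p1 (x + (s - r) / 2) r)"
      unfolding split_beta using x
      by (intro continuous_intros continuous_on_compose2[OF p1, of _ "\<lambda>z. (x + (fst z - snd z) / 2, snd z)",
              unfolded split_beta fst_conv snd_conv])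
         (auto intro!: continuous_intros)
    have c1: "continuous_on {0..e} (p x)"
      using x by (intro continuous_on_subset[OF continuous_on_slice(1)[OF p]]) auto
    have c3: "continuous_on {0..e} (\<lambda>s. integral {0..s} (\<lambda>r. p1 (x + (s - r) / 2) r))"
      using x by (intro continuous_on_subset[OF continuous_on_slice(1)[OF continuous_on_char_integral[OF p1]]]) auto
    have F: "integral {r..e} (\<lambda>s. 1 / 2 * p1 (x + (s - r) / 2) r) = p (x + (e - r) / 2) r - p x r"
      if r: "r \<in> {0..e}" for r
    proof -
      have "((\<lambda>s. 1 / 2 * p1 (x + (s - r) / 2) r) has_integral p (x + (e - r) / 2) r - p (x + (r - r) / 2) r) {r..e}"
      proof (rule fundamental_theorem_of_calculus)
        fix s assume s: "s \<in> {r..e}"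
        have "((\<lambda>y. p y r) has_real_derivative p1 (x + (s - r) / 2) r) (at (x + (s - r) / 2) within (\<lambda>s. x + (s - r) / 2) ` {r..e})"
          using x r s by (intro DERIV_subset[OF d]) auto
        moreover have "((\<lambda>s. x + (s - r) / 2) has_real_derivative 1 / 2) (at s within {r..e})"
          by (auto intro!: derivative_eq_intros)
        ultimately have "((\<lambda>s. p (x + (s - r) / 2) r) has_real_derivative p1 (x + (s - r) / 2) r * (1 / 2)) (at s within {r..e})"
          using DERIV_image_chain[of "\<lambda>y. p y r" _ "\<lambda>s. x + (s - r) / 2" s "{r..e}" "1 / 2"] by (simp add: o_def)
        then show "((\<lambda>s. p (x + (s - r) / 2) r) has_vector_derivative 1 / 2 * p1 (x + (s - r) / 2) r) (at s within {r..e})"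
          by (simp add: has_real_derivative_iff_has_vector_derivative mult.commute)
      qed (use r in auto)
      from integral_unique[OF this] show ?thesis by simp
    qed
    have "integral {0..e} (\<lambda>s. 1 / 2 * integral {0..s} (\<lambda>r. p1 (x + (s - r) / 2) r))
      = integral {0..e} (\<lambda>r. integral {r..e} (\<lambda>s. 1 / 2 * p1 (x + (s - r) / 2) r))"
      using integral_triangle_swap[OF tri] by simp
    also have "\<dots> = integral {0..e} (\<lambda>r. p (x + (e - r) / 2) r - p x r)"
      by (rule Henstock_Kurzweil_Integration.integral_cong) (rule F)
    also have "\<dots> = integral {0..e} (\<lambda>r. p (x + (e - r) / 2) r) - integral {0..e} (p x)"
      using c1 char_integrable[OF p x e]
      by (intro Henstock_Kurzweil_Integration.integral_diff) (auto intro: integrable_continuous_interval)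
    moreover have "integral {0..e} G = integral {0..e} (p x)
        + integral {0..e} (\<lambda>s. 1 / 2 * integral {0..s} (\<lambda>r. p1 (x + (s - r) / 2) r))"
      unfolding G_def using c1 c3
      by (intro Henstock_Kurzweil_Integration.integral_add integrable_continuous_interval continuous_intros)
    ultimately show ?thesis by linarith
  qed
  show ?thesis
    by (rule has_field_derivative_transform_within[OF integral_has_real_derivative_atLeast[OF G e, unfolded G_def], of 1])
       (use e eq in \<open>auto simp: G_def\<close>)
qed

locale goursat_kernel =
  fixes q q1 K :: "real \<Rightarrow> real" and W :: "real \<Rightarrow> real \<Rightarrow> real"
  assumes q: "\<And>x. 0 \<le> x \<Longrightarrow> (q has_real_derivative q1 x) (at x within {0..})"
    and q1: "continuous_on {0..} q1"
    and K: "continuous_on {0..} K"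
    and W: "continuous_on quadrant (\<lambda>(x, e). W x e)"
    and W_eq: "\<And>x e. 0 \<le> x \<Longrightarrow> 0 \<le> e \<Longrightarrow> W x e = goursat_op q K W x e"
begin

lemma q_cont: "continuous_on {0..} q"
  using q by (auto intro: DERIV_continuous_on)

text \<open>At fixed delay, \<open>W1\<close> and \<open>W2\<close> are the first two
  \<open>x\<close>-derivatives of \<open>W\<close>, and \<open>F1\<close> is that of
  \<open>mem_force\<close>. No delay derivative of \<open>W\<close> itself is formed: in the
  explicit solutions time derivatives fall on the control.\<close>

definition W1 where "W1 x e = (- 1 / 2) * char_slope q K W x e"

definition F1 where
  "F1 x e = q1 x * W x e + q x * W1 x e + integral {0..e} (\<lambda>s. K (e - s) * W1 x s)"

definition W2 where
  "W2 x e = (- 1 / 2) * (q1 (x + e / 2) + integral {0..e} (\<lambda>r. F1 (x + (e - r) / 2) r))"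

lemma W1_cont: "continuous_on quadrant (\<lambda>(x, e). W1 x e)"
  unfolding W1_def using continuous_on_char_slope[OF W q_cont K] unfolding split_beta
  by (intro continuous_intros)

lemma F1_cont: "continuous_on quadrant (\<lambda>(x, e). F1 x e)"
  unfolding F1_def
  using continuous_on_mem_conv[OF W1_cont K] continuous_on_fst_comp(1)[OF q1] W W1_cont continuous_on_fst_comp(1)[OF q_cont]
  unfolding split_beta by (intro continuous_intros)

lemma W2_cont: "continuous_on quadrant (\<lambda>(x, e). W2 x e)"
  unfolding W2_def
  using continuous_on_char_integral[OF F1_cont] continuous_on_fst_comp(3)[OF q1]
  unfolding split_beta by (intro continuous_intros)

lemma W_deriv:
  assumes "0 \<le> x" "0 \<le> e"
  shows "((\<lambda>x. W x e) has_real_derivative W1 x e) (at x within {0..})"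
proof -
  have "continuous_on {0..} (\<lambda>y. char_slope q K W y e)"
    using continuous_on_slice(2)[OF continuous_on_char_slope[OF W q_cont K]] assms by auto
  from integral_has_real_derivative_atLeast[OF this assms(1)]
  have "((\<lambda>x. (- 1 / 2) * integral {0..x} (\<lambda>y. char_slope q K W y e)) has_real_derivative W1 x e) (at x within {0..})"
    unfolding W1_def by (rule DERIV_cmult)
  then show ?thesis
    by (rule has_field_derivative_transform_within[of _ _ _ _ 1]) (use assms W_eq in auto)
qed

lemma force_deriv:
  assumes "0 \<le> x" "0 \<le> e"
  shows "((\<lambda>x. mem_force q K W x e) has_real_derivative F1 x e) (at x within {0..})"
proof -
  have "((\<lambda>x. integral (cbox 0 e) (\<lambda>s. K (e - s) * W x s)) has_real_derivative
      integral (cbox 0 e) (\<lambda>s. K (e - s) * W1 x s)) (at x within {0..})"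
  proof (rule leibniz_rule_field_derivative)
    fix y s :: real assume "y \<in> {0..}" "s \<in> cbox 0 e"
    then show "((\<lambda>x. K (e - s) * W x s) has_real_derivative K (e - s) * W1 y s) (at y within {0..})"
      by (intro DERIV_cmult W_deriv) auto
  next
    fix y :: real assume "y \<in> {0..}"
    then show "(\<lambda>s. K (e - s) * W y s) integrable_on cbox 0 e"
      using conv_integrable[OF K continuous_on_slice(1)[OF W]] by simp
  next
    show "continuous_on ({0..} \<times> cbox 0 e) (\<lambda>(y, s). K (e - s) * W1 y s)"
      unfolding split_beta
      by (intro continuous_intros continuous_on_compose2[OF K] continuous_on_subset[OF W1_cont[unfolded split_beta]])
         auto
  qed (use assms in auto)
  then show ?thesis
    unfolding mem_force_def F1_def using assms
    by (auto intro!: derivative_eq_intros W_deriv q)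
qed

lemma force_cont: "continuous_on quadrant (\<lambda>(x, e). mem_force q K W x e)"
  by (rule continuous_on_mem_force[OF W q_cont K])

lemma W1_deriv:
  assumes "0 \<le> x" "0 \<le> e"
  shows "((\<lambda>x. W1 x e) has_real_derivative W2 x e) (at x within {0..})"
proof -
  have "((\<lambda>x. integral (cbox 0 e) (\<lambda>r. mem_force q K W (x + (e - r) / 2) r)) has_real_derivative
      integral (cbox 0 e) (\<lambda>r. F1 (x + (e - r) / 2) r)) (at x within {0..})"
  proof (rule leibniz_rule_field_derivative)
    fix y r :: real assume "y \<in> {0..}" "r \<in> cbox 0 e"
    then show "((\<lambda>x. mem_force q K W (x + (e - r) / 2) r) has_real_derivative F1 (y + (e - r) / 2) r) (at y within {0..})"
      by (intro deriv_shift_atLeast[where f = "\<lambda>x. mem_force q K W x r"] force_deriv) auto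
  next
    fix y :: real assume "y \<in> {0..}"
    then show "(\<lambda>r. mem_force q K W (y + (e - r) / 2) r) integrable_on cbox 0 e"
      using char_integrable[OF force_cont] assms by simp
  next
    show "continuous_on ({0..} \<times> cbox 0 e) (\<lambda>(y, r). F1 (y + (e - r) / 2) r)"
      unfolding split_beta
      by (rule continuous_on_compose2[OF F1_cont, of _ "\<lambda>z. (fst z + (e - snd z) / 2, snd z)",
            unfolded split_beta fst_conv snd_conv])
         (auto intro!: continuous_intros)
  qed (use assms in auto)
  then show ?thesis
    unfolding W1_def W2_def char_slope_def using assms
    by (auto intro!: derivative_eq_intros deriv_shift_atLeast[OF q])
qed

text \<open>In the variables \<open>x\<close> and \<open>e\<close> this is the wave equation for the
  remainder: the operator d/dt - d/dx becomes 2 d/de - d/dx, and it is applied to \<open>W1\<close>,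
  the sum of the \<open>t\<close>- and \<open>x\<close>-derivatives.\<close>

lemma W1_deriv_delay:
  assumes "0 \<le> x" "0 \<le> e"
  shows "((\<lambda>e. W1 x e) has_real_derivative (W2 x e - mem_force q K W x e) / 2) (at e within {0..})"
proof -
  have "(q has_real_derivative q1 (x + e / 2)) (at (x + e / 2) within (\<lambda>e. x + e / 2) ` {0..})"
    using assms by (intro DERIV_subset[OF q]) auto
  moreover have "((\<lambda>e. x + e / 2) has_real_derivative 1 / 2) (at e within {0..})"
    by (auto intro!: derivative_eq_intros)
  ultimately have "((\<lambda>e. q (x + e / 2)) has_real_derivative q1 (x + e / 2) * (1 / 2)) (at e within {0..})"
    using DERIV_image_chain[of q _ "\<lambda>e. x + e / 2" e "{0..}" "1 / 2"] by (simp add: o_def)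
  moreover note deriv_char_integral[OF force_cont F1_cont force_deriv assms]
  ultimately have "((\<lambda>e. q (x + e / 2) + integral {0..e} (\<lambda>r. mem_force q K W (x + (e - r) / 2) r)) has_real_derivative
      q1 (x + e / 2) * (1 / 2) + (mem_force q K W x e + 1 / 2 * integral {0..e} (\<lambda>r. F1 (x + (e - r) / 2) r))) (at e within {0..})"
    by (rule DERIV_add)
  from DERIV_cmult[OF this, of "- 1 / 2"] show ?thesis
    unfolding W1_def char_slope_def W2_def
    by (rule DERIV_cong) (simp add: algebra_simps)
qed

lemma W_0 [simp]: "0 \<le> e \<Longrightarrow> W 0 e = 0"
  using W_eq[of 0 e] by simp

lemma W1_diag [simp]: "W1 x 0 = - q x / 2"
  by (simp add: W1_def char_slope_def)

lemma W_diag: "0 \<le> x \<Longrightarrow> W x 0 = (- 1 / 2) * integral {0..x} q"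
  by (subst W_eq) (auto simp: char_slope_def)

end

subsection \<open>Explicit classical solutions\<close>

lemma integral_flip: "integral {0..t} (\<lambda>s. f (t - s)) = integral {0..t::real} f"
  for f :: "real \<Rightarrow> real"
  using integral_shift_real_ivl[of "- t" "- t" 0 "\<lambda>x. f (- x)"] Henstock_Kurzweil_Integration.integral_reflect_real[of t 0 f]
  by (simp add: algebra_simps)

lemma integral_zero_tail:
  fixes f :: "real \<Rightarrow> real"
  assumes "continuous_on {a..b} f" "a \<le> c" "c \<le> b" "\<And>s. s \<in> {c..b} \<Longrightarrow> f s = 0"
  shows "integral {a..c} f = integral {a..b} f"
proof -
  have "integral {a..c} f + integral {c..b} f = integral {a..b} f"
    using assms by (intro Henstock_Kurzweil_Integration.integral_combine integrable_continuous_interval) auto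
  moreover have "integral {c..b} f = integral {c..b} (\<lambda>_. 0)"
    using assms(4) by (rule Henstock_Kurzweil_Integration.integral_cong)
  ultimately show ?thesis by simp
qed

text \<open>The fixed upper limit avoids a case split at \<open>t = x\<close>: for \<open>f\<close> vanishing on the negative
  half-line and \<open>t - x \<le> H\<close> this is the convolution over \<open>0 \<le> s \<le> t - x\<close>.\<close>

definition delay_conv :: "real \<Rightarrow> (real \<Rightarrow> real \<Rightarrow> real) \<Rightarrow> (real \<Rightarrow> real) \<Rightarrow> real \<Rightarrow> real \<Rightarrow> real" where
  "delay_conv H a f x t = integral {0..H} (\<lambda>s. a x s * f (t - x - s))"

lemma delay_conv_integrand_cont:
  fixes a :: "real \<Rightarrow> real \<Rightarrow> real" and f :: "real \<Rightarrow> real"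
  assumes a: "continuous_on quadrant (\<lambda>(x, e). a x e)" and f: "continuous_on UNIV f"
  shows "continuous_on (({0..} \<times> UNIV) \<times> {0..H}) (\<lambda>(p, s). a (fst p) s * f (snd p - fst p - s))"
  unfolding split_beta
  by (intro continuous_intros continuous_on_compose2[OF f]
      continuous_on_compose2[OF a, of _ "\<lambda>z. (fst (fst z), snd z)", unfolded split_beta fst_conv snd_conv])
     (auto intro!: continuous_intros)

lemma delay_conv_integrable:
  fixes a :: "real \<Rightarrow> real \<Rightarrow> real" and f :: "real \<Rightarrow> real"
  assumes a: "continuous_on quadrant (\<lambda>(x, e). a x e)" and f: "continuous_on UNIV f" and x: "0 \<le> x"
  shows "continuous_on {0..H} (\<lambda>s. a x s * f (c - s))" "(\<lambda>s. a x s * f (c - s)) integrable_on {0..H}"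
proof -
  show "continuous_on {0..H} (\<lambda>s. a x s * f (c - s))"
    using x by (intro continuous_intros continuous_on_compose2[OF f] continuous_on_subset[OF continuous_on_slice(1)[OF a]])
       auto
  then show "(\<lambda>s. a x s * f (c - s)) integrable_on {0..H}"
    by (rule integrable_continuous_interval)
qed

lemma delay_conv_cont:
  fixes a :: "real \<Rightarrow> real \<Rightarrow> real" and f :: "real \<Rightarrow> real"
  assumes "continuous_on quadrant (\<lambda>(x, e). a x e)" "continuous_on UNIV f"
  shows "continuous_on ({0..} \<times> UNIV) (\<lambda>(x, t). delay_conv H a f x t)"
  using integral_continuous_on_param[of "{0..} \<times> UNIV" 0 H "\<lambda>p s. a (fst p) s * f (snd p - fst p - s)"]
    delay_conv_integrand_cont[OF assms, of H]
  by (simp add: delay_conv_def split_beta')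

lemma delay_conv_deriv_time:
  fixes a :: "real \<Rightarrow> real \<Rightarrow> real" and f :: "real \<Rightarrow> real"
  assumes a: "continuous_on quadrant (\<lambda>(x, e). a x e)"
    and f: "\<And>t. (f has_real_derivative f1 t) (at t)" and f1: "continuous_on UNIV f1" and x: "0 \<le> x"
  shows "((\<lambda>t. delay_conv H a f x t) has_real_derivative delay_conv H a f1 x t) (at t)"
proof -
  have fc: "continuous_on UNIV f" using f by (intro DERIV_continuous_on) (auto intro: has_field_derivative_at_within)
  have "((\<lambda>t. integral (cbox 0 H) (\<lambda>s. a x s * f (t - x - s))) has_real_derivative
      integral (cbox 0 H) (\<lambda>s. a x s * f1 (t - x - s))) (at t within UNIV)"
  proof (rule leibniz_rule_field_derivative)
    fix t s
    show "((\<lambda>t. a x s * f (t - x - s)) has_real_derivative a x s * f1 (t - x - s)) (at t within UNIV)"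
      by (intro DERIV_cmult DERIV_chain'[where f = "\<lambda>t. t - x - s" and g = f, THEN DERIV_cong])
        (auto intro!: derivative_eq_intros f)
  next
    fix t show "(\<lambda>s. a x s * f (t - x - s)) integrable_on cbox 0 H"
      using delay_conv_integrable(2)[OF a fc x] by simp
  next
    show "continuous_on (UNIV \<times> cbox 0 H) (\<lambda>(t, s). a x s * f1 (t - x - s))"
      unfolding split_beta using x
      by (intro continuous_intros continuous_on_compose2[OF f1]
          continuous_on_compose2[OF a, of _ "\<lambda>z. (x, snd z)", unfolded split_beta fst_conv snd_conv])
         (auto intro!: continuous_intros)
  qed auto
  then show ?thesis by (simp add: delay_conv_def)
qed

lemma delay_conv_deriv_space:
  fixes a a1 :: "real \<Rightarrow> real \<Rightarrow> real" and f :: "real \<Rightarrow> real"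
  assumes a: "continuous_on quadrant (\<lambda>(x, e). a x e)" and a1: "continuous_on quadrant (\<lambda>(x, e). a1 x e)"
    and d: "\<And>x e. 0 \<le> x \<Longrightarrow> 0 \<le> e \<Longrightarrow> ((\<lambda>x. a x e) has_real_derivative a1 x e) (at x within {0..})"
    and f: "\<And>t. (f has_real_derivative f1 t) (at t)" and f1: "continuous_on UNIV f1" and x: "0 \<le> x"
  shows "((\<lambda>x. delay_conv H a f x t) has_real_derivative delay_conv H a1 f x t - delay_conv H a f1 x t) (at x within {0..})"
proof -
  have fc: "continuous_on UNIV f" using f by (intro DERIV_continuous_on) (auto intro: has_field_derivative_at_within)
  have "((\<lambda>x. integral (cbox 0 H) (\<lambda>s. a x s * f (t - x - s))) has_real_derivative
      integral (cbox 0 H) (\<lambda>s. a1 x s * f (t - x - s) - a x s * f1 (t - x - s))) (at x within {0..})"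
  proof (rule leibniz_rule_field_derivative)
    fix x s :: real assume "x \<in> {0..}" "s \<in> cbox 0 H"
    moreover have "((\<lambda>x. t - x - s) has_real_derivative - 1) (at x within {0..})"
      by (auto intro!: derivative_eq_intros)
    from DERIV_chain'[OF this f] have "((\<lambda>x. f (t - x - s)) has_real_derivative - f1 (t - x - s)) (at x within {0..})"
      by simp
    ultimately show "((\<lambda>x. a x s * f (t - x - s)) has_real_derivative a1 x s * f (t - x - s) - a x s * f1 (t - x - s)) (at x within {0..})"
      using DERIV_mult[OF d[of x s], of "\<lambda>x. f (t - x - s)" "- f1 (t - x - s)"] by (simp add: algebra_simps)
  next
    fix x :: real assume "x \<in> {0..}" then show "(\<lambda>s. a x s * f (t - x - s)) integrable_on cbox 0 H"
      using delay_conv_integrable(2)[OF a fc] by simp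
  next
    show "continuous_on ({0..} \<times> cbox 0 H) (\<lambda>(x, s). a1 x s * f (t - x - s) - a x s * f1 (t - x - s))"
      unfolding split_beta 
      by (intro continuous_intros continuous_on_compose2[OF f1] continuous_on_compose2[OF fc]
          continuous_on_compose2[OF a, of _ "\<lambda>z. (fst z, snd z)", unfolded split_beta fst_conv snd_conv]
          continuous_on_compose2[OF a1, of _ "\<lambda>z. (fst z, snd z)", unfolded split_beta fst_conv snd_conv])
         (auto intro!: continuous_intros)
  qed (use x in auto)
  moreover have "integral {0..H} (\<lambda>s. a1 x s * f (t - x - s) - a x s * f1 (t - x - s))
    = delay_conv H a1 f x t - delay_conv H a f1 x t"
    unfolding delay_conv_def
    by (intro Henstock_Kurzweil_Integration.integral_diff delay_conv_integrable a a1 fc f1 x)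
  ultimately show ?thesis by (simp add: delay_conv_def)
qed

text \<open>A control extended by zero to negative times. Continuity of \<open>f2\<close> across
  \<open>0\<close> encodes the compatibility conditions f(0) = f'(0) = f''(0) = 0 of classical
  solutions.\<close>

locale delayed_control = goursat_kernel +
  fixes f f1 f2 :: "real \<Rightarrow> real" and H :: real
  assumes f: "\<And>t. (f has_real_derivative f1 t) (at t)" and f1: "\<And>t. (f1 has_real_derivative f2 t) (at t)"
    and f2: "continuous_on UNIV f2" and f_neg: "\<And>t. t \<le> 0 \<Longrightarrow> f t = 0" and f1_neg: "\<And>t. t \<le> 0 \<Longrightarrow> f1 t = 0"
    and H: "0 < H"
begin

lemma f_cont: "continuous_on UNIV f" and f1_cont: "continuous_on UNIV f1"
  using f f1 by (auto intro!: DERIV_continuous_on intro: has_field_derivative_at_within)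

definition "sol x t = f (t - x) + delay_conv H W f x t"
definition "sol_t x t = f1 (t - x) + delay_conv H W f1 x t"
definition "sol_x x t = - f1 (t - x) + (delay_conv H W1 f x t - delay_conv H W f1 x t)"
definition "sol_xt x t = - f2 (t - x) + (delay_conv H W1 f1 x t - delay_conv H W f2 x t)"
definition "sol_tt x t = f2 (t - x) + delay_conv H W f2 x t"
definition "sol_xx x t = f2 (t - x) + ((delay_conv H W2 f x t - delay_conv H W1 f1 x t) - (delay_conv H W1 f1 x t - delay_conv H W f2 x t))"

lemma shift_deriv:
  assumes "\<And>t. (g has_real_derivative g1 t) (at t)"
  shows "((\<lambda>t. g (t - x)) has_real_derivative g1 (t - x)) (at t)"
    "((\<lambda>x. g (t - x)) has_real_derivative - g1 (t - x)) (at x within S)"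
proof -
  have "((\<lambda>t. t - x) has_real_derivative 1) (at t)" "((\<lambda>x. t - x) has_real_derivative - 1) (at x within S)"
    by (auto intro!: derivative_eq_intros)
  from this[THEN DERIV_chain'[OF _ assms]]
  show "((\<lambda>t. g (t - x)) has_real_derivative g1 (t - x)) (at t)"
    "((\<lambda>x. g (t - x)) has_real_derivative - g1 (t - x)) (at x within S)" by simp_all
qed

lemma shift_cont:
  assumes "continuous_on UNIV g" shows "continuous_on S (\<lambda>(x, t). g (t - x :: real) :: real)"
  unfolding split_beta by (intro continuous_on_compose2[OF assms] continuous_intros) auto

lemma sol_grad:
  "C1_grad ({0..} \<times> {0..H}) sol sol_x sol_t"
  "C1_grad ({0..} \<times> {0..H}) sol_x sol_xx sol_xt"
  "C1_grad ({0..} \<times> {0..H}) sol_t sol_xt sol_tt"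
proof -
  have c: "continuous_on ({0..} \<times> {0..H}) (\<lambda>(x, t). delay_conv H a g x t)"
    if "continuous_on quadrant (\<lambda>(x, e). a x e)" "continuous_on UNIV g" for a g
    by (rule continuous_on_subset[OF delay_conv_cont[OF that]]) auto
  note conts = c[OF W f_cont] c[OF W f1_cont] c[OF W f2] c[OF W1_cont f_cont] c[OF W1_cont f1_cont] c[OF W2_cont f_cont]
    shift_cont[OF f_cont] shift_cont[OF f1_cont] shift_cont[OF f2]
  have cont: "continuous_on ({0..} \<times> {0..H}) (\<lambda>(x, t). sol_x x t)" "continuous_on ({0..} \<times> {0..H}) (\<lambda>(x, t). sol_t x t)"
    "continuous_on ({0..} \<times> {0..H}) (\<lambda>(x, t). sol_xx x t)" "continuous_on ({0..} \<times> {0..H}) (\<lambda>(x, t). sol_xt x t)"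
    "continuous_on ({0..} \<times> {0..H}) (\<lambda>(x, t). sol_tt x t)"
    unfolding sol_x_def sol_t_def sol_xx_def sol_xt_def sol_tt_def
    using conts unfolding split_beta by (auto intro!: continuous_on_add continuous_on_diff continuous_on_minus continuous_on_mult)
  note dx = delay_conv_deriv_space[OF W W1_cont W_deriv f f1_cont] delay_conv_deriv_space[OF W W1_cont W_deriv f1 f2]
    delay_conv_deriv_space[OF W1_cont W2_cont W1_deriv f f1_cont]
  note dt = delay_conv_deriv_time[OF W f f1_cont] delay_conv_deriv_time[OF W f1 f2] delay_conv_deriv_time[OF W1_cont f f1_cont]
  show "C1_grad ({0..} \<times> {0..H}) sol sol_x sol_t"
  proof (rule C1_gradI)
    fix x t :: real assume "x \<in> {0..}"
    then show "((\<lambda>x. sol x t) has_real_derivative sol_x x t) (at x within {0..})"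
      unfolding sol_def sol_x_def by (intro DERIV_add[OF shift_deriv(2)[OF f] dx(1)]) simp_all
    show "((\<lambda>t. sol x t) has_real_derivative sol_t x t) (at t within {0..H})"
      unfolding sol_def sol_t_def using \<open>x \<in> {0..}\<close>
      by (intro has_field_derivative_at_within[OF DERIV_add[OF shift_deriv(1)[OF f] dt(1)]]) simp_all
  qed (use cont in auto)
  show "C1_grad ({0..} \<times> {0..H}) sol_x sol_xx sol_xt"
  proof (rule C1_gradI)
    fix x t :: real assume x: "x \<in> {0..}"
    have "((\<lambda>x. sol_x x t) has_real_derivative - (- f2 (t - x)) + ((delay_conv H W2 f x t - delay_conv H W1 f1 x t) - (delay_conv H W1 f1 x t - delay_conv H W f2 x t))) (at x within {0..})"
      unfolding sol_x_def using x by (intro DERIV_add[OF DERIV_minus[OF shift_deriv(2)[OF f1]] DERIV_diff[OF dx(3) dx(2)]]) simp_all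
    then show "((\<lambda>x. sol_x x t) has_real_derivative sol_xx x t) (at x within {0..})"
      by (simp add: sol_xx_def)
    show "((\<lambda>t. sol_x x t) has_real_derivative sol_xt x t) (at t within {0..H})"
      unfolding sol_x_def sol_xt_def using x
      by (intro has_field_derivative_at_within[OF DERIV_add[OF DERIV_minus[OF shift_deriv(1)[OF f1]] DERIV_diff[OF dt(3) dt(2)]]]) simp_all
  qed (use cont in auto)
  show "C1_grad ({0..} \<times> {0..H}) sol_t sol_xt sol_tt"
  proof (rule C1_gradI)
    fix x t :: real assume x: "x \<in> {0..}"
    show "((\<lambda>x. sol_t x t) has_real_derivative sol_xt x t) (at x within {0..})"
      unfolding sol_t_def sol_xt_def using x by (intro DERIV_add[OF shift_deriv(2)[OF f1] dx(2)]) simp_all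
    show "((\<lambda>t. sol_t x t) has_real_derivative sol_tt x t) (at t within {0..H})"
      unfolding sol_t_def sol_tt_def using x
      by (intro has_field_derivative_at_within[OF DERIV_add[OF shift_deriv(1)[OF f1] dt(2)]]) simp_all
  qed (use cont in auto)
qed

text \<open>Integration by parts in the delay moves the derivative from the control to
  \<open>W1\<close>, whose delay derivative is known from the wave equation. This mixed term is the
  one that \<open>sol_tt - sol_xx\<close> leaves over.\<close>

lemma parts:
  assumes "0 \<le> x" "t - x \<le> H"
  shows "delay_conv H W1 f1 x t = - q x / 2 * f (t - x)
    + 1 / 2 * (delay_conv H W2 f x t - delay_conv H (mem_force q K W) f x t)"
proof -
  have "((\<lambda>s. (W2 x s - mem_force q K W x s) / 2 * f (t - x - s) - W1 x s * f1 (t - x - s)) has_integral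
      (W1 x H * f (t - x - H) - W1 x 0 * f (t - x - 0))) {0..H}"
  proof (rule fundamental_theorem_of_calculus)
    fix s assume s: "s \<in> {0..H}"
    have "((\<lambda>s. W1 x s) has_real_derivative (W2 x s - mem_force q K W x s) / 2) (at s within {0..H})"
      using s assms by (intro DERIV_subset[OF W1_deriv_delay]) auto
    moreover have "((\<lambda>s. f (t - x - s)) has_real_derivative - f1 (t - x - s)) (at s within {0..H})"
      by (rule shift_deriv(2)[OF f])
    ultimately show "((\<lambda>s. W1 x s * f (t - x - s)) has_vector_derivative
        (W2 x s - mem_force q K W x s) / 2 * f (t - x - s) - W1 x s * f1 (t - x - s)) (at s within {0..H})"
      unfolding has_real_derivative_iff_has_vector_derivative[symmetric]
      by (rule DERIV_mult[THEN DERIV_cong]) simp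
  qed (use H in auto)
  \<comment> \<open>The boundary term at \<open>H\<close> vanishes because
    \<open>t - x - H \<le> 0\<close>; the one at \<open>0\<close> carries
    \<open>W1 x 0 = - q x / 2\<close>.\<close>
  then have "integral {0..H} (\<lambda>s. (W2 x s - mem_force q K W x s) / 2 * f (t - x - s) - W1 x s * f1 (t - x - s)) = q x / 2 * f (t - x)"
    using assms f_neg[of "t - x - H"] by (simp add: integral_unique)
  also have "(\<lambda>s. (W2 x s - mem_force q K W x s) / 2 * f (t - x - s) - W1 x s * f1 (t - x - s))
    = (\<lambda>s. 1 / 2 * (W2 x s * f (t - x - s) - mem_force q K W x s * f (t - x - s)) - W1 x s * f1 (t - x - s))"
    by (auto simp: algebra_simps diff_divide_distrib)
  finally show ?thesis
    using assms delay_conv_integrable(2)[OF W1_cont f1_cont, of x "t - x" H]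
      delay_conv_integrable(2)[OF W2_cont f_cont, of x "t - x" H] delay_conv_integrable(2)[OF force_cont f_cont, of x "t - x" H]
    by (simp add: delay_conv_def Henstock_Kurzweil_Integration.integral_diff integrable_diff integrable_on_cmult_left
        flip: times_divide_eq_left)
qed

text \<open>This is associativity of convolution. The fixed limit \<open>H\<close> makes the ranges
  rectangular, and vanishing of the control at nonpositive times pays for every change of
  range.\<close>

lemma memory_term:
  assumes x: "0 \<le> x" and t: "0 \<le> t" "t \<le> H"
  shows "integral {0..t} (\<lambda>s. K (t - s) * sol x s) =
    integral {0..H} (\<lambda>s. (K s + integral {0..s} (\<lambda>r. K (s - r) * W x r)) * f (t - x - s))"
proof -
  have K': "continuous_on {0..b} K" for b by (rule continuous_on_subset[OF K]) auto
  have Wx: "continuous_on {0..b} (W x)" for b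
    using x by (intro continuous_on_subset[OF continuous_on_slice(1)[OF W]]) auto
  have solc: "continuous_on UNIV (sol x)"
    unfolding sol_def using continuous_on_slice(1)[OF delay_conv_cont[OF W f_cont]] x
    by (intro continuous_intros continuous_on_compose2[OF f_cont]) auto
  have sol0: "sol x s = 0" if "s \<le> 0" for s
  proof -
    have "integral {0..H} (\<lambda>r. W x r * f (s - x - r)) = integral {0..H} (\<lambda>_. 0)"
      using f_neg that x by (intro Henstock_Kurzweil_Integration.integral_cong) auto
    then show ?thesis using f_neg that x by (simp add: sol_def delay_conv_def)
  qed
  have fK: "continuous_on {0..H} (\<lambda>s. K s * f (t - x - s))"
    by (intro continuous_intros K' continuous_on_compose2[OF f_cont]) auto
  have "integral {0..t} (\<lambda>s. K (t - s) * sol x s) = integral {0..t} (\<lambda>s. K s * sol x (t - s))"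
    using integral_flip[of t "\<lambda>s. K s * sol x (t - s)"] by simp
  also have "\<dots> = integral {0..H} (\<lambda>s. K s * sol x (t - s))"
    using t sol0 by (intro integral_zero_tail continuous_intros K' continuous_on_compose2[OF solc]) auto
  also have "\<dots> = integral {0..H} (\<lambda>s. K s * f (t - x - s) + integral {0..H} (\<lambda>r. K s * W x r * f (t - x - s - r)))"
  proof (rule Henstock_Kurzweil_Integration.integral_cong)
    fix s
    have "K s * integral {0..H} (\<lambda>r. W x r * f (t - s - x - r)) = integral {0..H} (\<lambda>r. K s * (W x r * f (t - s - x - r)))"
      by simp
    moreover have "t - s - x = t - x - s" by simp
    ultimately show "K s * sol x (t - s) = K s * f (t - x - s) + integral {0..H} (\<lambda>r. K s * W x r * f (t - x - s - r))"
      by (simp only: sol_def delay_conv_def distrib_left mult.assoc)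
  qed
  also have "\<dots> = integral {0..H} (\<lambda>s. K s * f (t - x - s)) + integral {0..H} (\<lambda>s. integral {0..H} (\<lambda>r. K s * W x r * f (t - x - s - r)))"
  proof (intro Henstock_Kurzweil_Integration.integral_add integrable_continuous_interval fK)
    have "continuous_on {0..H} (\<lambda>s. integral (cbox 0 H) (\<lambda>r. K s * W x r * f (t - x - s - r)))"
      unfolding split_beta
      by (intro integral_continuous_on_param, unfold split_beta,
          intro continuous_intros continuous_on_compose2[OF K'[of H]] continuous_on_compose2[OF Wx[of H]] continuous_on_compose2[OF f_cont]) auto
    then show "continuous_on {0..H} (\<lambda>s. integral {0..H} (\<lambda>r. K s * W x r * f (t - x - s - r)))" by simp
  qed
  also have "integral {0..H} (\<lambda>s. integral {0..H} (\<lambda>r. K s * W x r * f (t - x - s - r)))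
     = integral {0..H} (\<lambda>r. integral {0..H} (\<lambda>s. K s * W x r * f (t - x - s - r)))"
  proof -
    have "continuous_on (cbox (0, 0) (H, H)) (\<lambda>(s, r). K s * W x r * f (t - x - s - r))"
      unfolding split_beta
      by (intro continuous_intros continuous_on_compose2[OF K'[of H]] continuous_on_compose2[OF Wx[of H]] continuous_on_compose2[OF f_cont])
         (auto simp: cbox_Pair_eq)
    from integral_swap_continuous[OF this] show ?thesis by simp
  qed
  also have "\<dots> = integral {0..H} (\<lambda>r. integral {r..H} (\<lambda>s. K (s - r) * W x r * f (t - x - s)))"
  proof (rule Henstock_Kurzweil_Integration.integral_cong)
    fix r assume r: "r \<in> {0..H}"
    have "integral {r..H} (\<lambda>s. K (s - r) * W x r * f (t - x - s)) = integral {0..H - r} (\<lambda>s. K s * W x r * f (t - x - s - r))"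
      using integral_shift_real_ivl[of r r H "\<lambda>s. K (s - r) * W x r * f (t - x - s)"] by (simp add: algebra_simps)
    \<comment> \<open>For \<open>s \<ge> H - r\<close> the argument \<open>t - x - s - r\<close> is
      at most \<open>t - H \<le> 0\<close>, where the control vanishes.\<close>
    also have "\<dots> = integral {0..H} (\<lambda>s. K s * W x r * f (t - x - s - r))"
      using r x t f_neg by (intro integral_zero_tail continuous_intros K' continuous_on_compose2[OF f_cont]) auto
    finally show "integral {0..H} (\<lambda>s. K s * W x r * f (t - x - s - r)) = integral {r..H} (\<lambda>s. K (s - r) * W x r * f (t - x - s))" by simp
  qed
  also have "\<dots> = integral {0..H} (\<lambda>s. integral {0..s} (\<lambda>r. K (s - r) * W x r * f (t - x - s)))"
  proof -
    have "continuous_on {(s, r). 0 \<le> r \<and> r \<le> s \<and> s \<le> H} (\<lambda>(s, r). K (s - r) * W x r * f (t - x - s))"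
      unfolding split_beta
      by (intro continuous_intros continuous_on_compose2[OF K'[of H]] continuous_on_compose2[OF Wx[of H]] continuous_on_compose2[OF f_cont]) auto
    from integral_triangle_swap[OF this] show ?thesis by simp
  qed
  also have "integral {0..H} (\<lambda>s. K s * f (t - x - s)) + \<dots>
    = integral {0..H} (\<lambda>s. K s * f (t - x - s) + integral {0..s} (\<lambda>r. K (s - r) * W x r) * f (t - x - s))"
  proof (subst Henstock_Kurzweil_Integration.integral_add)
    have "continuous_on {0..H} (\<lambda>s. integral {0..s} (\<lambda>r. K (s - r) * W x r))"
      using x by (intro continuous_on_subset[OF continuous_on_slice(1)[OF continuous_on_mem_conv[OF W K]]]) auto
    then show "(\<lambda>s. integral {0..s} (\<lambda>r. K (s - r) * W x r) * f (t - x - s)) integrable_on {0..H}"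
      by (intro integrable_continuous_interval continuous_intros continuous_on_compose2[OF f_cont]) auto
  qed (use fK in \<open>auto intro: integrable_continuous_interval\<close>)
  finally show ?thesis by (simp add: distrib_right)
qed

text \<open>\<open>sol_tt - sol_xx\<close> reduces to twice \<open>delay_conv H W1 f1\<close> minus
  \<open>delay_conv H W2 f\<close>. By \<open>parts\<close> this is \<open>- q x * f (t - x)\<close>
  minus the convolution of \<open>f\<close> with \<open>mem_force\<close>, and the potential and
  memory terms of the equation add up to the opposite.\<close>

lemma sol_wave:
  assumes "0 \<le> x" "0 \<le> t" "t \<le> H"
  shows "sol_tt x t - sol_xx x t + q x * sol x t + integral {0..t} (\<lambda>s. K (t - s) * sol x s) = 0"
proof -
  have "delay_conv H (mem_force q K W) f x t
    = integral {0..H} (\<lambda>s. q x * (W x s * f (t - x - s)) + (K s + integral {0..s} (\<lambda>r. K (s - r) * W x r)) * f (t - x - s))"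
    by (simp add: delay_conv_def mem_force_def algebra_simps)
  also have "\<dots> = q x * delay_conv H W f x t + integral {0..H} (\<lambda>s. (K s + integral {0..s} (\<lambda>r. K (s - r) * W x r)) * f (t - x - s))"
  proof (subst Henstock_Kurzweil_Integration.integral_add)
    have "continuous_on {0..H} (\<lambda>s. integral {0..s} (\<lambda>r. K (s - r) * W x r))"
      using assms by (intro continuous_on_subset[OF continuous_on_slice(1)[OF continuous_on_mem_conv[OF W K]]]) auto
    then show "(\<lambda>s. (K s + integral {0..s} (\<lambda>r. K (s - r) * W x r)) * f (t - x - s)) integrable_on {0..H}"
      by (intro integrable_continuous_interval continuous_intros continuous_on_compose2[OF f_cont] continuous_on_subset[OF K]) auto
  qed (use integrable_on_cmult_left[OF delay_conv_integrable(2)[OF W f_cont assms(1)], of "q x" "t - x" H] in \<open>auto simp: delay_conv_def\<close>)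
  finally show ?thesis
    using parts[of x t] memory_term[of x t] assms
    by (simp add: sol_tt_def sol_xx_def sol_def algebra_simps)
qed

lemma classical_sol:
  assumes "\<And>t. t \<in> {0..H} \<Longrightarrow> g t = f t"
  shows "classical_solution q K H g sol sol_x"
  unfolding classical_solution_def
proof (rule exI[of _ sol_t], rule exI[of _ sol_xx], rule exI[of _ sol_xt], rule exI[of _ sol_tt],
    intro conjI ballI allI impI sol_grad)
  have i: "integral {0..H} (\<lambda>s. W x s * h (0 - x - s)) = 0" if "x \<ge> 0" "\<And>t. t \<le> 0 \<Longrightarrow> h t = 0" for x h
  proof -
    have "integral {0..H} (\<lambda>s. W x s * h (0 - x - s)) = integral {0..H} (\<lambda>_. 0)"
      using that by (intro Henstock_Kurzweil_Integration.integral_cong) auto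
    then show ?thesis by simp
  qed
  fix x :: real assume "x \<ge> 0"
  then show "sol x 0 = 0" "sol_t x 0 = 0"
    using i[of x f] i[of x f1] f_neg f1_neg by (auto simp: sol_def sol_t_def delay_conv_def)
next
  fix t assume "t \<in> {0..H}"
  moreover have "integral {0..H} (\<lambda>s. W 0 s * f (t - 0 - s)) = integral {0..H} (\<lambda>_. 0)"
    by (intro Henstock_Kurzweil_Integration.integral_cong) auto
  ultimately show "sol 0 t = g t"
    using assms by (simp add: sol_def delay_conv_def)
next
  fix x t :: real assume "0 < x" "0 < t \<and> t < H"
  then show "sol_tt x t - sol_xx x t + q x * sol x t + integral {0..t} (\<lambda>s. K (t - s) * sol x s) = 0"
    by (intro sol_wave) auto
qed

end

subsection \<open>Uniqueness of classical solutions\<close>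

lemma compact_continuous_bound:
  fixes f :: "'a::topological_space \<Rightarrow> real"
  assumes "continuous_on S f" "compact S"
  obtains B where "B \<ge> 0" "\<And>z. z \<in> S \<Longrightarrow> \<bar>f z\<bar> \<le> B"
proof -
  obtain B where "B > 0" "\<And>z. z \<in> S \<Longrightarrow> \<bar>f z\<bar> \<le> B"
    using compact_imp_bounded[OF compact_continuous_image[OF assms]] unfolding bounded_pos by auto
  then show ?thesis using that[of B] by simp
qed

lemma C1_grad_continuous:
  assumes "C1_grad S u ux ut" shows "continuous_on S (\<lambda>(x, t). u x t)"
  unfolding continuous_on_eq_continuous_within
  using assms unfolding C1_grad_def by (auto intro: has_derivative_continuous)

lemma C1_grad_partials:
  assumes g: "C1_grad (X \<times> Y) u ux ut" and xt: "x \<in> X" "t \<in> Y"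
  shows "((\<lambda>x. u x t) has_real_derivative ux x t) (at x within X)"
    "((\<lambda>t. u x t) has_real_derivative ut x t) (at t within Y)"
proof -
  have d: "((\<lambda>(x, t). u x t) has_derivative (\<lambda>(h, k). ux x t * h + ut x t * k)) (at (x, t) within X \<times> Y)"
    using g xt unfolding C1_grad_def by auto
  have "((\<lambda>x. (x, t)) has_derivative (\<lambda>h. (h, 0))) (at x within X)"
    by (auto intro!: derivative_eq_intros)
  from has_derivative_in_compose[OF this, of "\<lambda>(x, t). u x t"] has_derivative_subset[OF d, of "(\<lambda>x. (x, t)) ` X"] xt
  show "((\<lambda>x. u x t) has_real_derivative ux x t) (at x within X)"
    by (force simp: has_field_derivative_def)
  have "((\<lambda>t. (x, t)) has_derivative (\<lambda>h. (0, h))) (at t within Y)"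
    by (auto intro!: derivative_eq_intros)
  from has_derivative_in_compose[OF this, of "\<lambda>(x, t). u x t"] has_derivative_subset[OF d, of "(\<lambda>t. (x, t)) ` Y"] xt
  show "((\<lambda>t. u x t) has_real_derivative ut x t) (at t within Y)"
    by (force simp: has_field_derivative_def)
qed

lemma C1_grad_along_line:
  assumes g: "C1_grad ({0..} \<times> {0..\<tau>}) u ux ut" and s: "0 < a + b * s" "0 < s" "s < \<tau>"
  shows "((\<lambda>s. u (a + b * s) s) has_real_derivative ux (a + b * s) s * b + ut (a + b * s) s) (at s)"
proof -
  have "(a + b * s, s) \<in> interior ({0..} \<times> {0..\<tau>})"
    using s by (simp add: interior_Times)
  then have "at (a + b * s, s) within {0..} \<times> {0..\<tau>} = at (a + b * s, s)"
    by (rule at_within_interior)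
  then have d: "((\<lambda>(x, t). u x t) has_derivative (\<lambda>(h, k). ux (a + b * s) s * h + ut (a + b * s) s * k)) (at (a + b * s, s))"
    using g[unfolded C1_grad_def, THEN conjunct1, rule_format, of "a + b * s" s] s by simp
  have "((\<lambda>s. (a + b * s, s)) has_derivative (\<lambda>h. (b * h, h))) (at s)"
    by (auto intro!: derivative_eq_intros)
  from has_derivative_compose[OF this d]
  have "((\<lambda>s. u (a + b * s) s) has_derivative (\<lambda>h. ux (a + b * s) s * (b * h) + ut (a + b * s) s * h)) (at s)"
    by simp
  then show ?thesis
    by (rule has_derivative_imp_has_field_derivative) (simp add: algebra_simps)
qed

lemma C1_grad_diff:
  assumes "C1_grad S u ux ut" "C1_grad S v vx vt"
  shows "C1_grad S (\<lambda>x t. u x t - v x t) (\<lambda>x t. ux x t - vx x t) (\<lambda>x t. ut x t - vt x t)"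
  unfolding C1_grad_def
proof (intro conjI allI impI)
  fix x t assume xt: "(x, t) \<in> S"
  have "((\<lambda>z. (\<lambda>(x, t). u x t) z - (\<lambda>(x, t). v x t) z) has_derivative
      (\<lambda>w. (\<lambda>(h, k). ux x t * h + ut x t * k) w - (\<lambda>(h, k). vx x t * h + vt x t * k) w)) (at (x, t) within S)"
    using assms xt unfolding C1_grad_def by (intro has_derivative_diff) auto
  then show "((\<lambda>(x, t). u x t - v x t) has_derivative (\<lambda>(h, k). (ux x t - vx x t) * h + (ut x t - vt x t) * k)) (at (x, t) within S)"
    by (simp add: split_beta' algebra_simps)
next
  show "continuous_on S (\<lambda>(x, t). ux x t - vx x t)" "continuous_on S (\<lambda>(x, t). ut x t - vt x t)"
    using assms unfolding C1_grad_def split_beta by (auto intro!: continuous_intros)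
qed

text \<open>The interval inside \<open>S\<close> keeps the derivative determined at boundary points,
  where only one-sided limits are available.\<close>

lemma real_derivative_unique_within:
  fixes a b :: real
  assumes "a < b" "x \<in> {a..b}" "{a..b} \<subseteq> S"
    and "(f has_real_derivative D) (at x within S)" "(g has_real_derivative E) (at x within S)"
    and "\<And>y. y \<in> S \<Longrightarrow> f y = g y"
  shows "D = E"
proof -
  have "(f has_real_derivative D) (at x within {a..b})" "(g has_real_derivative E) (at x within {a..b})"
    using assms DERIV_subset by blast+
  moreover have "(f has_real_derivative E) (at x within {a..b})"
    using calculation(2) by (rule has_field_derivative_transform_within[of _ _ _ _ 1]) (use assms in auto)
  ultimately show ?thesis
    using assms(1,2) vector_derivative_unique_within_closed_interval[of a b x f D E]
    by (simp add: has_real_derivative_iff_has_vector_derivative)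
qed

text \<open>The term at the lower endpoint is kept, so that bounds on consecutive arcs of a
  reflected characteristic add up without loss.\<close>

lemma exp_growth_bound:
  fixes f :: "real \<Rightarrow> real"
  assumes "a \<le> b" "l > 0" "continuous_on {a..b} f"
    and "\<And>s. a < s \<Longrightarrow> s < b \<Longrightarrow> (f has_real_derivative f' s) (at s)"
    and "\<And>s. a < s \<Longrightarrow> s < b \<Longrightarrow> \<bar>f' s\<bar> \<le> A * exp (l * s)"
  shows "\<bar>f b - f a\<bar> \<le> A / l * (exp (l * b) - exp (l * a))"
proof (cases "a = b")
  case False
  have "norm (f b - f a) \<le> A / l * exp (l * b) - A / l * exp (l * a)"
  proof (rule differentiable_bound_general)
    fix s assume s: "a < s" "s < b"
    show "((\<lambda>s. A / l * exp (l * s)) has_vector_derivative A * exp (l * s)) (at s)"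
      unfolding has_real_derivative_iff_has_vector_derivative[symmetric]
      using \<open>l > 0\<close> by (auto intro!: derivative_eq_intros)
  qed (use assms False in \<open>auto intro!: continuous_intros simp: has_real_derivative_iff_has_vector_derivative\<close>)
  then show ?thesis by (simp add: algebra_simps)
qed auto

lemma memory_cont:
  fixes u :: "real \<Rightarrow> real \<Rightarrow> real"
  assumes u: "continuous_on ({0..} \<times> {0..\<tau>}) (\<lambda>(x, t). u x t)" and K: "continuous_on {0..} K"
  shows "continuous_on ({0..} \<times> {0..\<tau>}) (\<lambda>(x, t). integral {0..t} (\<lambda>s. K (t - s) * u x s))"
proof -
  have "continuous_on ({0..} \<times> {0..\<tau>}) (\<lambda>p. integral {0..snd p} (\<lambda>s. K (snd p - s) * u (fst p) s))"
  proof (rule continuous_on_integral_upto[where G = "\<lambda>p s. K (snd p - s) * u (fst p) s" and m = snd])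
    show "continuous_on {(p, r). p \<in> {0..} \<times> {0..\<tau>} \<and> 0 \<le> r \<and> r \<le> snd p} (\<lambda>(p, r). K (snd p - r) * u (fst p) r)"
      unfolding split_beta
      by (intro continuous_intros continuous_on_compose2[OF K]
          continuous_on_compose2[OF u, where f = "\<lambda>z. (fst (fst z), snd z)", unfolded split_beta fst_conv snd_conv])
         (auto intro!: continuous_intros)
  qed (auto intro!: continuous_intros)
  then show ?thesis by (simp add: split_beta')
qed

text \<open>Along the characteristics the two Riemann invariants \<open>u\<^sub>t \<plusminus> u\<^sub>x\<close> have derivative
  \<open>u\<^sub>t\<^sub>t - u\<^sub>x\<^sub>x\<close>; an exponential weight in time makes the resulting bound contract.\<close>

lemma classical_solution_zero:
  assumes q: "continuous_on {0..} q" and K: "continuous_on {0..} K"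
    and cs: "classical_solution q K \<tau> (\<lambda>_. 0) u ux" and x0: "0 \<le> x0" and t0: "0 \<le> t0" "t0 \<le> \<tau>"
  shows "u x0 t0 = 0"
proof -
  obtain ut uxx uxt utt where gu: "C1_grad ({0..} \<times> {0..\<tau>}) u ux ut"
    and gx: "C1_grad ({0..} \<times> {0..\<tau>}) ux uxx uxt" and gt: "C1_grad ({0..} \<times> {0..\<tau>}) ut uxt utt"
    and wave: "\<And>x t. 0 < x \<Longrightarrow> 0 < t \<Longrightarrow> t < \<tau> \<Longrightarrow>
        utt x t - uxx x t + q x * u x t + integral {0..t} (\<lambda>s. K (t - s) * u x s) = 0"
    and ic: "\<And>x. 0 \<le> x \<Longrightarrow> u x 0 = 0 \<and> ut x 0 = 0" and bc: "\<And>t. t \<in> {0..\<tau>} \<Longrightarrow> u 0 t = 0"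
    using cs unfolding classical_solution_def by blast
  show ?thesis
  proof (cases "\<tau> = 0")
    case True
    then show ?thesis using ic x0 t0 by auto
  next
    case False
    with t0 have tau: "\<tau> > 0" by simp
    \<comment> \<open>Followed backwards in time, characteristics keep or decrease
      \<open>x + t\<close>, and the memory term looks back at the same \<open>x\<close>. So
      \<open>x + t \<le> N\<close> contains everything that can influence the point, and it is
      bounded.\<close>
    define N where "N = x0 + t0"
    have ux0: "ux x 0 = 0" if "0 \<le> x" for x
      by (rule real_derivative_unique_within[OF _ _ _ C1_grad_partials(1)[OF gu, of x 0] DERIV_const[of 0], of x "x + 1"])
         (use that ic tau in auto)
    have ut0: "ut 0 t = 0" if "t \<in> {0..\<tau>}" for t
      by (rule real_derivative_unique_within[OF _ _ _ C1_grad_partials(2)[OF gu, of 0 t] DERIV_const[of 0], of 0 \<tau>])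
         (use that bc tau in auto)
    obtain Cq where Cq: "Cq \<ge> 0" "\<And>x. 0 \<le> x \<Longrightarrow> x \<le> N \<Longrightarrow> \<bar>q x\<bar> \<le> Cq"
      using continuous_bounded_Icc[OF q] by metis
    obtain CK where CK: "CK \<ge> 0" "\<And>x. 0 \<le> x \<Longrightarrow> x \<le> \<tau> \<Longrightarrow> \<bar>K x\<bar> \<le> CK"
      using continuous_bounded_Icc[OF K] by metis
    define C where "C = Cq + CK"
    \<comment> \<open>The forcing is bounded by \<open>A = C * B\<close> times the weight, and
      \<open>A / l \<le> B / 2\<close> is what the halving needs.\<close>
    define l where "l = 1 + 2 * C"
    have C: "C \<ge> 0" and l: "l \<ge> 1" "2 * C \<le> l" "l > 0" using Cq(1) CK(1) by (auto simp: C_def l_def)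
    define P where "P = (\<lambda>B. \<forall>x t. 0 \<le> x \<and> 0 \<le> t \<and> t \<le> \<tau> \<and> x + t \<le> N \<longrightarrow> \<bar>u x t\<bar> \<le> B * exp (l * t))"
    have "\<exists>B\<ge>0. P B"
    proof -
      have "continuous_on ({0..N} \<times> {0..\<tau>}) (\<lambda>(x, t). u x t)"
        by (rule continuous_on_subset[OF C1_grad_continuous[OF gu]]) auto
      moreover have "compact ({0..N} \<times> {0..\<tau>})" by (intro compact_Times) auto
      ultimately obtain B where B: "B \<ge> 0" "\<And>z. z \<in> {0..N} \<times> {0..\<tau>} \<Longrightarrow> \<bar>(\<lambda>(x, t). u x t) z\<bar> \<le> B"
        using compact_continuous_bound by blast
      have "\<bar>u x t\<bar> \<le> B * exp (l * t)" if "0 \<le> x" "0 \<le> t" "t \<le> \<tau>" "x + t \<le> N" for x t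
      proof -
        have "B * 1 \<le> B * exp (l * t)" using B(1) l that by (intro mult_left_mono) auto
        then show ?thesis using B(2)[of "(x, t)"] that by auto
      qed
      then show ?thesis using B(1) by (intro exI[of _ B]) (auto simp: P_def)
    qed
    then obtain B0 where B0: "B0 \<ge> 0" "P B0" by blast
    have "\<bar>u x0 t0\<bar> \<le> 0"
    proof (rule nonpos_of_halving[where P = P and B = B0 and c = "exp (l * t0)"])
      fix B assume B: "B \<ge> 0" "P B"
      define A where "A = C * B"
      have A: "A \<ge> 0" using B C by (simp add: A_def)
      have F: "\<bar>utt x t - uxx x t\<bar> \<le> A * exp (l * t)"
        if xt: "0 < x" "0 < t" "t < \<tau>" "x + t \<le> N" for x t
      proof -
        have "\<bar>integral {0..t} (\<lambda>s. K (t - s) * u x s)\<bar> \<le> CK * B / l * exp (l * t)"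
        proof (rule abs_integral_exp_le)
          fix s assume s: "s \<in> {0..t}"
          have "\<bar>K (t - s)\<bar> * \<bar>u x s\<bar> \<le> CK * (B * exp (l * s))"
            using s xt CK B by (intro mult_mono) (auto simp: P_def)
          then show "\<bar>K (t - s) * u x s\<bar> \<le> CK * B * exp (l * s)"
            by (simp add: abs_mult)
        qed (use l B CK in auto)
        also have "\<dots> \<le> CK * B * exp (l * t)"
          using l B CK frac_le[of "CK * B" "CK * B" 1 l] by (intro mult_right_mono) auto
        finally have "\<bar>integral {0..t} (\<lambda>s. K (t - s) * u x s)\<bar> \<le> CK * B * exp (l * t)" .
        moreover have "\<bar>q x * u x t\<bar> \<le> Cq * (B * exp (l * t))"
          unfolding abs_mult using xt Cq B by (intro mult_mono) (auto simp: P_def)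
        moreover have "A * exp (l * t) = CK * B * exp (l * t) + Cq * (B * exp (l * t))"
          by (simp add: A_def C_def algebra_simps)
        ultimately show ?thesis using wave[OF xt(1,2,3)] by linarith
      qed
      have path: "continuous_on {c..t} (\<lambda>s. f (a + b * s) s)"
        if "continuous_on ({0..} \<times> {0..\<tau>}) (\<lambda>(x, t). f x t)" "\<And>s. s \<in> {c..t} \<Longrightarrow> 0 \<le> a + b * s" "0 \<le> c" "t \<le> \<tau>"
        for f :: "real \<Rightarrow> real \<Rightarrow> real" and a b c t
        by (rule continuous_on_compose2[OF that(1), of _ "\<lambda>s. (a + b * s, s)", unfolded split_beta fst_conv snd_conv])
           (use that in \<open>auto intro!: continuous_intros\<close>)
      note cx = C1_grad_continuous[OF gx] and ct = C1_grad_continuous[OF gt]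
      have p: "\<bar>ut x t + ux x t\<bar> \<le> A / l * (exp (l * t) - 1)"
        if xt: "0 \<le> x" "0 \<le> t" "t \<le> \<tau>" "x + t \<le> N" for x t
      proof -
        have "\<bar>(ut ((x + t) + (- 1) * t) t + ux ((x + t) + (- 1) * t) t) - (ut ((x + t) + (- 1) * 0) 0 + ux ((x + t) + (- 1) * 0) 0)\<bar>
          \<le> A / l * (exp (l * t) - exp (l * 0))"
        proof (rule exp_growth_bound[OF xt(2) l(3), where f = "\<lambda>s. ut ((x + t) + (- 1) * s) s + ux ((x + t) + (- 1) * s) s"
              and f' = "\<lambda>s. utt ((x + t) + (- 1) * s) s - uxx ((x + t) + (- 1) * s) s"])
          show "continuous_on {0..t} (\<lambda>s. ut ((x + t) + (- 1) * s) s + ux ((x + t) + (- 1) * s) s)"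
            using xt by (intro continuous_on_add path cx ct) auto
          fix s assume s: "0 < s" "s < t"
          have "0 < (x + t) + (- 1) * s" "s < \<tau>" using s xt by auto
          from DERIV_add[OF C1_grad_along_line[OF gt this(1) s(1) this(2)] C1_grad_along_line[OF gx this(1) s(1) this(2)]]
          show "((\<lambda>s. ut ((x + t) + (- 1) * s) s + ux ((x + t) + (- 1) * s) s) has_real_derivative
              utt ((x + t) + (- 1) * s) s - uxx ((x + t) + (- 1) * s) s) (at s)"
            by (rule DERIV_cong) simp
          show "\<bar>utt ((x + t) + (- 1) * s) s - uxx ((x + t) + (- 1) * s) s\<bar> \<le> A * exp (l * s)"
            using s xt by (intro F) auto
        qed
        then show ?thesis using ic[of "x + t"] ux0[of "x + t"] xt by simp
      qed
      have m: "\<bar>ut x t - ux x t\<bar> \<le> A / l * (exp (l * t) - 1)"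
        if xt: "0 \<le> x" "0 \<le> t" "t \<le> \<tau>" "x + t \<le> N" for x t
      proof -
        \<comment> \<open>The time at which the characteristic \<open>x - t = const\<close> enters
          the quarter plane: through the initial line if \<open>x \<ge> t\<close>, otherwise through
          the boundary \<open>x = 0\<close>.\<close>
        define c where "c = max 0 (t - x)"
        have c: "0 \<le> c" "c \<le> t" "t - x \<le> c" using xt by (auto simp: c_def)
        have "\<bar>(ut ((x - t) + 1 * t) t - ux ((x - t) + 1 * t) t) - (ut ((x - t) + 1 * c) c - ux ((x - t) + 1 * c) c)\<bar>
          \<le> A / l * (exp (l * t) - exp (l * c))"
        proof (rule exp_growth_bound[OF c(2) l(3), where f = "\<lambda>s. ut ((x - t) + 1 * s) s - ux ((x - t) + 1 * s) s"
              and f' = "\<lambda>s. utt ((x - t) + 1 * s) s - uxx ((x - t) + 1 * s) s"])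
          show "continuous_on {c..t} (\<lambda>s. ut ((x - t) + 1 * s) s - ux ((x - t) + 1 * s) s)"
            using xt c by (intro continuous_on_diff path cx ct) auto
          fix s assume s: "c < s" "s < t"
          have s': "0 < (x - t) + 1 * s" "0 < s" "s < \<tau>" using s xt c by auto
          from DERIV_diff[OF C1_grad_along_line[OF gt s'] C1_grad_along_line[OF gx s']]
          show "((\<lambda>s. ut ((x - t) + 1 * s) s - ux ((x - t) + 1 * s) s) has_real_derivative
              utt ((x - t) + 1 * s) s - uxx ((x - t) + 1 * s) s) (at s)"
            by (rule DERIV_cong) simp
          show "\<bar>utt ((x - t) + 1 * s) s - uxx ((x - t) + 1 * s) s\<bar> \<le> A * exp (l * s)"
            using s s' xt by (intro F) auto
        qed
        moreover have "\<bar>ut ((x - t) + 1 * c) c - ux ((x - t) + 1 * c) c\<bar> \<le> A / l * (exp (l * c) - 1)"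
        proof (cases "x < t")
          case True
          \<comment> \<open>Reflection at the boundary: \<open>ut 0 c = 0\<close>, so the two
            invariants differ there only in sign and \<open>p\<close> bounds the outgoing
            one.\<close>
          then have "x - t + 1 * c = 0" "c \<in> {0..\<tau>}" using xt by (auto simp: c_def)
          then show ?thesis using p[of 0 c] ut0[of c] xt c by simp
        next
          case False
          then have "c = 0" by (simp add: c_def)
          then show ?thesis using ic[of "x - t"] ux0[of "x - t"] False by simp
        qed
        ultimately have "\<bar>ut x t - ux x t\<bar> \<le> A / l * (exp (l * t) - exp (l * c)) + A / l * (exp (l * c) - 1)"
          by simp
        also have "\<dots> = A / l * (exp (l * t) - 1)" by (simp add: algebra_simps)
        finally show ?thesis .
      qed
      have ub: "\<bar>u x t\<bar> \<le> B / 2 * exp (l * t)"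
        if xt: "0 \<le> x" "0 \<le> t" "t \<le> \<tau>" "x + t \<le> N" for x t
      proof -
        have utb: "\<bar>ut x s\<bar> \<le> A / l * exp (l * s)" if "0 < s" "s < t" for s
        proof -
          have "\<bar>ut x s\<bar> \<le> A / l * (exp (l * s) - 1)"
            using p[of x s] m[of x s] that xt by linarith
          also have "\<dots> \<le> A / l * exp (l * s)" using A l by (intro mult_left_mono) auto
          finally show ?thesis .
        qed
        have "\<bar>u x t - u x 0\<bar> \<le> A / l / l * (exp (l * t) - exp (l * 0))"
        proof (rule exp_growth_bound[OF xt(2) l(3)])
          show "continuous_on {0..t} (u x)"
            by (rule continuous_on_subset[OF continuous_on_slice(1)[OF C1_grad_continuous[OF gu]]]) (use xt in auto)
          fix s assume s: "0 < s" "s < t"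
          have "(u x has_real_derivative ut x s) (at s within {0..\<tau>})"
            using C1_grad_partials(2)[OF gu, of x s] s xt by simp
          moreover have "at s within {0..\<tau>} = at s"
            using s xt by (intro at_within_interior) auto
          ultimately show "(u x has_real_derivative ut x s) (at s)" by simp
          show "\<bar>ut x s\<bar> \<le> A / l * exp (l * s)" by (rule utb[OF s])
        qed
        also have "\<dots> \<le> A / l / l * exp (l * t)"
          using A l by (intro mult_left_mono) auto
        also have "\<dots> \<le> B / 2 * exp (l * t)"
        proof (rule mult_right_mono)
          have "A / l / l \<le> A / l" using A l by (simp add: divide_le_eq mult_le_cancel_left1)
          also have "\<dots> \<le> B / 2" 
            using l B C mult_right_mono[of "2 * C" l B] by (simp add: A_def divide_le_eq field_simps)
          finally show "A / l / l \<le> B / 2" .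
        qed simp
        finally show ?thesis using ic[OF xt(1)] by simp
      qed
      then show "P (B / 2)" by (auto simp: P_def)
    qed (use B0 x0 t0 in \<open>auto simp: P_def N_def\<close>)
    then show ?thesis by simp
  qed
qed

lemma classical_solution_unique:
  assumes q: "continuous_on {0..} q" and K: "continuous_on {0..} K"
    and u: "classical_solution q K \<tau> f u ux" and v: "classical_solution q K \<tau> f v vx"
    and x: "0 \<le> x" and t: "0 \<le> t" "t \<le> \<tau>"
  shows "u x t = v x t" "ux x t = vx x t"
proof -
  obtain ut uxx uxt utt where u': "C1_grad ({0..} \<times> {0..\<tau>}) u ux ut"
    "C1_grad ({0..} \<times> {0..\<tau>}) ux uxx uxt" "C1_grad ({0..} \<times> {0..\<tau>}) ut uxt utt"
    "\<forall>x>0. \<forall>t. 0 < t \<and> t < \<tau> \<longrightarrow>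
        utt x t - uxx x t + q x * u x t + integral {0..t} (\<lambda>s. K (t - s) * u x s) = 0"
    "\<forall>x\<ge>0. u x 0 = 0 \<and> ut x 0 = 0" "\<forall>t\<in>{0..\<tau>}. u 0 t = f t"
    using u unfolding classical_solution_def by blast
  obtain vt vxx vxt vtt where v': "C1_grad ({0..} \<times> {0..\<tau>}) v vx vt"
    "C1_grad ({0..} \<times> {0..\<tau>}) vx vxx vxt" "C1_grad ({0..} \<times> {0..\<tau>}) vt vxt vtt"
    "\<forall>x>0. \<forall>t. 0 < t \<and> t < \<tau> \<longrightarrow>
        vtt x t - vxx x t + q x * v x t + integral {0..t} (\<lambda>s. K (t - s) * v x s) = 0"
    "\<forall>x\<ge>0. v x 0 = 0 \<and> vt x 0 = 0" "\<forall>t\<in>{0..\<tau>}. v 0 t = f t"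
    using v unfolding classical_solution_def by blast
  have i: "integral {0..t} (\<lambda>s. K (t - s) * (u x s - v x s)) =
      integral {0..t} (\<lambda>s. K (t - s) * u x s) - integral {0..t} (\<lambda>s. K (t - s) * v x s)"
    if "0 < x" "0 < t" "t < \<tau>" for x t
  proof -
    have "(\<lambda>s. K (t - s) * w x s) integrable_on {0..t}" 
      if "continuous_on ({0..} \<times> {0..\<tau>}) (\<lambda>(x, t). w x t)" for w
      using continuous_on_slice(1)[OF that, of x] \<open>0 < x\<close> \<open>t < \<tau>\<close>
      by (intro integrable_continuous_interval continuous_intros continuous_on_compose2[OF K])
         (auto intro: continuous_on_subset)
    from this[OF C1_grad_continuous[OF u'(1)]] this[OF C1_grad_continuous[OF v'(1)]] show ?thesis
      by (simp add: right_diff_distrib Henstock_Kurzweil_Integration.integral_diff)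
  qed
  have "classical_solution q K \<tau> (\<lambda>_. 0) (\<lambda>x t. u x t - v x t) (\<lambda>x t. ux x t - vx x t)"
    unfolding classical_solution_def
  proof (intro exI conjI)
    show "C1_grad ({0..} \<times> {0..\<tau>}) (\<lambda>x t. u x t - v x t) (\<lambda>x t. ux x t - vx x t) (\<lambda>x t. ut x t - vt x t)"
      by (intro C1_grad_diff u' v')
    show "C1_grad ({0..} \<times> {0..\<tau>}) (\<lambda>x t. ux x t - vx x t) (\<lambda>x t. uxx x t - vxx x t) (\<lambda>x t. uxt x t - vxt x t)"
      by (intro C1_grad_diff u' v')
    show "C1_grad ({0..} \<times> {0..\<tau>}) (\<lambda>x t. ut x t - vt x t) (\<lambda>x t. uxt x t - vxt x t) (\<lambda>x t. utt x t - vtt x t)"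
      by (intro C1_grad_diff u' v')
    show "\<forall>x>0. \<forall>t. 0 < t \<and> t < \<tau> \<longrightarrow> utt x t - vtt x t - (uxx x t - vxx x t) + q x * (u x t - v x t) 
        + integral {0..t} (\<lambda>s. K (t - s) * (u x s - v x s)) = 0"
    proof (intro allI impI)
      fix x t :: real assume xt: "0 < x" "0 < t \<and> t < \<tau>"
      then have "utt x t - uxx x t + q x * u x t + integral {0..t} (\<lambda>s. K (t - s) * u x s) = 0"
        "vtt x t - vxx x t + q x * v x t + integral {0..t} (\<lambda>s. K (t - s) * v x s) = 0"
        using u'(4) v'(4) by auto
      then show "utt x t - vtt x t - (uxx x t - vxx x t) + q x * (u x t - v x t) 
        + integral {0..t} (\<lambda>s. K (t - s) * (u x s - v x s)) = 0"
        using xt i[of x t] by (simp add: algebra_simps)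
    qed
  qed (use u' v' in auto)
  from classical_solution_zero[OF q K this] have eq: "u x t = v x t" if "0 \<le> x" "0 \<le> t" "t \<le> \<tau>" for x t
    using that by fastforce
  from eq[OF x t] show "u x t = v x t" .
  show "ux x t = vx x t"
    by (rule real_derivative_unique_within[OF _ _ _ C1_grad_partials(1)[OF u'(1), of x t] C1_grad_partials(1)[OF v'(1), of x t], of x "x + 1"])
       (use x t eq in auto)
qed

subsection \<open>Representation of classical solutions\<close>

lemma continuous_antiderivative:
  fixes f :: "real \<Rightarrow> real"
  assumes "continuous_on UNIV f"
  obtains F where "\<And>x. (F has_real_derivative f x) (at x)" "F 0 = 0"
proof -
  have "isCont f x" for x using assms by (simp add: continuous_on_eq_continuous_at)
  then obtain F where F: "\<And>x::real. (F has_vector_derivative f x) (at x)"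
    using einterval_antiderivative[of "-\<infinity>" "\<infinity>" f] by auto
  have "((\<lambda>x. F x - F 0) has_real_derivative f x) (at x)" for x
    using F[of x] by (auto intro!: derivative_eq_intros simp: has_real_derivative_iff_has_vector_derivative)
  then show ?thesis using that[of "\<lambda>x. F x - F 0"] by simp
qed

lemma eq_of_same_derivative:
  fixes f g :: "real \<Rightarrow> real"
  assumes "convex S" "\<And>x. x \<in> S \<Longrightarrow> (f has_real_derivative d x) (at x within S)"
    "\<And>x. x \<in> S \<Longrightarrow> (g has_real_derivative d x) (at x within S)" "a \<in> S" "f a = g a" "x \<in> S"
  shows "f x = g x"
proof -
  have "((\<lambda>x. f x - g x) has_real_derivative 0) (at x within S)" if "x \<in> S" for x
    using DERIV_diff[OF assms(2)[OF that] assms(3)[OF that]] by simp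
  from has_field_derivative_zero_constant[OF assms(1) this] show ?thesis
    using assms(4-6) by (metis eq_iff_diff_eq_0)
qed

text \<open>The initial data give f(0) = f'(0) = 0, and the equation at the corner gives f''(0) = 0;
  these are exactly the conditions under which extension by zero stays twice continuously
  differentiable.\<close>

lemma classical_control_extension:
  assumes q: "continuous_on {0..} q" and K: "continuous_on {0..} K"
    and cs: "classical_solution q K \<tau> f u ux" and tau: "0 < \<tau>"
  obtains g g1 g2 where "\<And>t. (g has_real_derivative g1 t) (at t)" "\<And>t. (g1 has_real_derivative g2 t) (at t)"
    "continuous_on UNIV g2" "\<And>t. t \<le> 0 \<Longrightarrow> g t = 0" "\<And>t. t \<le> 0 \<Longrightarrow> g1 t = 0" "\<And>t. t \<in> {0..\<tau>} \<Longrightarrow> f t = g t"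
proof -
  obtain ut uxx uxt utt where gu: "C1_grad ({0..} \<times> {0..\<tau>}) u ux ut"
    and gx: "C1_grad ({0..} \<times> {0..\<tau>}) ux uxx uxt" and gt: "C1_grad ({0..} \<times> {0..\<tau>}) ut uxt utt"
    and wave: "\<And>x t. 0 < x \<Longrightarrow> 0 < t \<Longrightarrow> t < \<tau> \<Longrightarrow>
        utt x t - uxx x t + q x * u x t + integral {0..t} (\<lambda>s. K (t - s) * u x s) = 0"
    and ic: "\<And>x. 0 \<le> x \<Longrightarrow> u x 0 = 0 \<and> ut x 0 = 0" and bc: "\<And>t. t \<in> {0..\<tau>} \<Longrightarrow> u 0 t = f t"
    using cs unfolding classical_solution_def by blast
  have ux0: "ux x 0 = 0" if "0 \<le> x" for x
    by (rule real_derivative_unique_within[OF _ _ _ C1_grad_partials(1)[OF gu, of x 0] DERIV_const[of 0], of x "x + 1"])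
       (use that ic tau in auto)
  have uxx0: "uxx 0 0 = 0"
    by (rule real_derivative_unique_within[OF _ _ _ C1_grad_partials(1)[OF gx, of 0 0] DERIV_const[of 0], of 0 1])
       (use ux0 tau in auto)
  have utt0: "utt 0 0 = 0"
  proof -
    \<comment> \<open>The wave equation holds only in the open strip; along the diagonal
      \<open>(s, s)\<close> it passes to the limit at the corner.\<close>
    define G where "G = (\<lambda>s. utt s s - uxx s s + q s * u s s + integral {0..s} (\<lambda>r. K (s - r) * u s r))"
    have diag: "continuous_on {0..\<tau>} (\<lambda>s. h s s)" if "continuous_on ({0..} \<times> {0..\<tau>}) (\<lambda>(x, t). h x t)"
      for h :: "real \<Rightarrow> real \<Rightarrow> real"
      by (rule continuous_on_compose2[OF that, of _ "\<lambda>s. (s, s)", unfolded split_beta fst_conv snd_conv])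
         (auto intro!: continuous_intros)
    have c2: "continuous_on {0..\<tau>} (\<lambda>s. utt s s)" "continuous_on {0..\<tau>} (\<lambda>s. uxx s s)"
      by (rule diag; use gt gx in \<open>simp add: C1_grad_def\<close>)+
    have "continuous_on {0..\<tau>} G"
      unfolding G_def
      by (intro continuous_intros continuous_on_subset[OF q] c2 diag[OF C1_grad_continuous[OF gu]]
          diag[OF memory_cont[OF C1_grad_continuous[OF gu] K]]) auto
    then have "G 0 = 0"
      using tau by (intro continuous_constant_on_closure[of "{0<..<\<tau>}" G 0 0]) (auto simp: G_def wave)
    then show ?thesis using uxx0 ic[of 0] by (simp add: G_def)
  qed
  \<comment> \<open>Clamping the argument continues the second derivative: constant beyond
    \<open>\<tau>\<close>, and zero at negative times because \<open>utt 0 0 = 0\<close>. Two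
    integrations from \<open>0\<close> then recover \<open>f\<close> on the interval.\<close>
  define g2 where "g2 = (\<lambda>t. utt 0 (max 0 (min t \<tau>)))"
  have "continuous_on {0..\<tau>} (utt 0)"
    using continuous_on_slice(1)[of "{0..}" "{0..\<tau>}" utt 0] gt by (simp add: C1_grad_def)
  then have g2: "continuous_on UNIV g2"
    unfolding g2_def by (rule continuous_on_compose2) (use tau in \<open>auto intro!: continuous_intros\<close>)
  obtain g1 where g1: "\<And>x. (g1 has_real_derivative g2 x) (at x)" "g1 0 = 0"
    using continuous_antiderivative[OF g2] by blast
  have "continuous_on UNIV g1"
    using g1(1) by (auto intro!: DERIV_continuous_on intro: has_field_derivative_at_within)
  then obtain g where g: "\<And>x. (g has_real_derivative g1 x) (at x)" "g 0 = 0"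
    using continuous_antiderivative by blast
  have zero: "F t = 0" if F: "\<And>x. (F has_real_derivative F' x) (at x)" "F 0 = 0" and F': "\<And>x. x \<le> 0 \<Longrightarrow> F' x = 0"
    and t: "t \<le> 0" for F F' :: "real \<Rightarrow> real" and t
  proof (rule eq_of_same_derivative[of "{..0}" F "\<lambda>_. 0" "\<lambda>_. 0" 0])
    fix x :: real assume "x \<in> {..0}"
    then show "(F has_real_derivative 0) (at x within {..0})"
      using F(1)[of x] F'[of x] by (simp add: has_field_derivative_at_within)
  qed (use F t in auto)
  have n1: "g1 t = 0" if "t \<le> 0" for t
    using zero[OF g1 _ that] utt0 tau by (simp add: g2_def)
  have n: "g t = 0" if "t \<le> 0" for t
    using zero[OF g n1 that] .
  have e1: "g1 t = ut 0 t" if "t \<in> {0..\<tau>}" for t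
  proof (rule eq_of_same_derivative[of "{0..\<tau>}" g1 "utt 0" "ut 0" 0])
    fix t assume t: "t \<in> {0..\<tau>}"
    then show "(g1 has_real_derivative utt 0 t) (at t within {0..\<tau>})"
      using g1(1)[of t] by (simp add: g2_def has_field_derivative_at_within)
    show "(ut 0 has_real_derivative utt 0 t) (at t within {0..\<tau>})"
      using C1_grad_partials(2)[OF gt, of 0 t] t by simp
  qed (use that g1(2) ic tau in auto)
  have "g t = u 0 t" if "t \<in> {0..\<tau>}" for t
  proof (rule eq_of_same_derivative[of "{0..\<tau>}" g "ut 0" "u 0" 0])
    fix t assume t: "t \<in> {0..\<tau>}"
    then show "(g has_real_derivative ut 0 t) (at t within {0..\<tau>})"
      using g(1)[of t] e1 by (simp add: has_field_derivative_at_within)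
    show "(u 0 has_real_derivative ut 0 t) (at t within {0..\<tau>})"
      using C1_grad_partials(2)[OF gu, of 0 t] t by simp
  qed (use that g(2) ic tau in auto)
  with bc show ?thesis using that[OF g(1) g1(1) g2 n n1] by metis
qed

section \<open>A dense class of smooth controls\<close>

lemma deriv_positive_part:
  fixes h h' :: "real \<Rightarrow> real"
  assumes h: "\<And>t. (h has_real_derivative h' t) (at t)" and z: "h 0 = 0" "h' 0 = 0"
  shows "((\<lambda>t. if t \<le> 0 then 0 else h t) has_real_derivative (if t \<le> 0 then 0 else h' t)) (at t)"
proof -
  consider "t < 0" | "t > 0" | "t = 0" by linarith
  then show ?thesis
  proof cases
    case 1
    have "((\<lambda>t. if t \<le> 0 then 0 else h t) has_real_derivative 0) (at t)"
      by (rule has_field_derivative_transform_within_open[OF DERIV_const[of 0], where S = "{..<0}"]) (use 1 in auto)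
    then show ?thesis using 1 by simp
  next
    case 2
    have "((\<lambda>t. if t \<le> 0 then 0 else h t) has_real_derivative h' t) (at t)"
      by (rule has_field_derivative_transform_within_open[OF h[of t], where S = "{0<..}"]) (use 2 in auto)
    then show ?thesis using 2 by simp
  next
    case 3
    have "(h has_real_derivative 0) (at 0)" using h[of 0] z by simp
    then have lim: "((\<lambda>y. h y / y) \<longlongrightarrow> 0) (at 0)"
      by (simp add: has_field_derivative_iff z)
    \<comment> \<open>At \<open>0\<close> the truncated difference quotient is dominated by that of
      \<open>h\<close>, which tends to \<open>h' 0 = 0\<close>.\<close>
    have "((\<lambda>y. (if y \<le> 0 then 0 else h y) / y) \<longlongrightarrow> 0) (at 0)"
    proof (rule tendsto_rabs_zero_cancel, rule tendsto_sandwich[OF _ _ tendsto_const[of 0] tendsto_rabs_zero[OF lim]])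
      show "\<forall>\<^sub>F y in at 0. 0 \<le> \<bar>(if y \<le> 0 then 0 else h y) / y\<bar>"
        "\<forall>\<^sub>F y in at 0. \<bar>(if y \<le> 0 then 0 else h y) / y\<bar> \<le> \<bar>h y / y\<bar>"
        by (auto intro!: always_eventually simp del: abs_divide)
    qed
    then show ?thesis using 3 by (simp add: has_field_derivative_iff)
  qed
qed

text \<open>The factor \<open>t ^ 3\<close> makes the extension by zero twice continuously
  differentiable, while \<open>p\<close> stays free for Stone--Weierstrass approximation.\<close>

lemma polynomial_control:
  assumes p: "real_polynomial_function p"
  obtains f f1 f2 where "\<And>t. (f has_real_derivative f1 t) (at t)" "\<And>t. (f1 has_real_derivative f2 t) (at t)"
    "continuous_on UNIV f2" "\<And>t. t \<le> 0 \<Longrightarrow> f t = 0" "\<And>t. t \<le> 0 \<Longrightarrow> f1 t = 0" "\<And>t. 0 \<le> t \<Longrightarrow> f t = t ^ 3 * p t"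
proof -
  obtain p1 where p1: "real_polynomial_function p1" "\<And>x. (p has_real_derivative p1 x) (at x)"
    using has_real_derivative_polynomial_function[OF p] by blast
  obtain p2 where p2: "real_polynomial_function p2" "\<And>x. (p1 has_real_derivative p2 x) (at x)"
    using has_real_derivative_polynomial_function[OF p1(1)] by blast
  have c: "continuous_on UNIV p" "continuous_on UNIV p1" "continuous_on UNIV p2"
    using p p1 p2 by (auto intro!: continuous_on_polymonial_function simp: real_polynomial_function_eq)
  let ?pos = "\<lambda>h t. if t \<le> 0 then 0 else h t"
  define h where "h = (\<lambda>t. t ^ 3 * p t)"
  define h1 where "h1 = (\<lambda>t. 3 * t ^ 2 * p t + t ^ 3 * p1 t)"
  define h2 where "h2 = (\<lambda>t. 6 * t * p t + 6 * t ^ 2 * p1 t + t ^ 3 * p2 t)"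
  have pow: "((\<lambda>t. t ^ 3) has_real_derivative 3 * t ^ 2) (at t)"
    "((\<lambda>t. 3 * t ^ 2) has_real_derivative 6 * t) (at t)" for t :: real
    by (auto intro!: derivative_eq_intros)
  have "(h has_real_derivative h1 t) (at t)" "(h1 has_real_derivative h2 t) (at t)" for t
    using DERIV_mult[OF pow(1) p1(2), of t]
      DERIV_add[OF DERIV_mult[OF pow(2) p1(2)] DERIV_mult[OF pow(1) p2(2)], of t]
    unfolding h_def h1_def h2_def by (simp_all add: algebra_simps)
  moreover have "h 0 = 0" "h1 0 = 0" "h2 0 = 0" by (auto simp: h_def h1_def h2_def)
  moreover have "continuous_on UNIV (?pos h2)"
  proof -
    have "continuous_on UNIV (\<lambda>t. h2 (max 0 t))"
      unfolding h2_def by (intro continuous_intros continuous_on_compose2[OF c(1)]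
          continuous_on_compose2[OF c(2)] continuous_on_compose2[OF c(3)]) auto
    moreover have "(\<lambda>t. h2 (max 0 t)) = ?pos h2" by (auto simp: h2_def max_def)
    ultimately show ?thesis by metis
  qed
  ultimately show ?thesis
    using that[of "?pos h" "?pos h1" "?pos h2"] deriv_positive_part[of h h1] deriv_positive_part[of h1 h2]
    by (auto simp: h_def)
qed

context goursat_kernel
begin

text \<open>The control of any classical solution extends to a \<open>delayed_control\<close>, and
  uniqueness identifies the given solution with the explicit one.\<close>

lemma classical_representation:
  assumes cs: "classical_solution q K \<tau> f u ux" and tau: "0 < \<tau>"
  obtains g where "continuous_on UNIV g" "\<And>t. t \<le> 0 \<Longrightarrow> g t = 0" "\<And>t. t \<in> {0..\<tau>} \<Longrightarrow> g t = f t"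
    "\<And>x t. 0 \<le> x \<Longrightarrow> t \<in> {0..\<tau>} \<Longrightarrow> u x t = g (t - x) + delay_conv \<tau> W g x t"
proof -
  obtain g g1 g2 where g: "\<And>t. (g has_real_derivative g1 t) (at t)" "\<And>t. (g1 has_real_derivative g2 t) (at t)"
    "continuous_on UNIV g2" "\<And>t. t \<le> 0 \<Longrightarrow> g t = 0" "\<And>t. t \<le> 0 \<Longrightarrow> g1 t = 0" "\<And>t. t \<in> {0..\<tau>} \<Longrightarrow> f t = g t"
    using classical_control_extension[OF q_cont K cs tau] by metis
  interpret delayed_control q q1 K W g g1 g2 \<tau>
    by unfold_locales (use g tau in auto)
  have "u x t = g (t - x) + delay_conv \<tau> W g x t" if "0 \<le> x" "t \<in> {0..\<tau>}" for x t
    using classical_solution_unique(1)[OF q_cont K cs classical_sol[of f]] g(6) that by (simp add: sol_def)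
  then show ?thesis using that[of g] g f_cont by auto
qed

end

section \<open>The kernel attached to a potential, and its determination by Cauchy data at
  \<open>x = 0\<close>\<close>

lemma goursat_kernel_of_C2:
  assumes "C2_loc q" "C2_loc K"
  obtains q1 W where "goursat_kernel q q1 K W"
proof -
  obtain q1 q2 where q: "\<And>x. x \<ge> 0 \<Longrightarrow> (q has_real_derivative q1 x) (at x within {0..})"
    "\<And>x. x \<ge> 0 \<Longrightarrow> (q1 has_real_derivative q2 x) (at x within {0..})"
    using assms(1) unfolding C2_loc_def by blast
  obtain K1 where K: "\<And>x. x \<ge> 0 \<Longrightarrow> (K has_real_derivative K1 x) (at x within {0..})"
    using assms(2) unfolding C2_loc_def by blast
  have c: "continuous_on {0..} q" "continuous_on {0..} q1" "continuous_on {0..} K"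
    using q K by (auto intro: DERIV_continuous_on)
  obtain W where "continuous_on quadrant (\<lambda>(x, e). W x e)"
    "\<forall>x\<ge>0. \<forall>e\<ge>0. W x e = goursat_op q K W x e"
    using goursat_kernel_exists[OF c(1,3)] by blast
  then have "goursat_kernel q q1 K W"
    using c q by unfold_locales auto
  then show ?thesis by (rule that)
qed

text \<open>Reading the wave equation as an evolution in \<open>x\<close> with Cauchy data on \<open>x = 0\<close>; the
  condition on the characteristic \<open>t = x\<close> then returns the potential.\<close>

lemma goursat_kernel_unique:
  assumes g: "goursat_kernel q q1 K W" and g': "goursat_kernel q' q1' K W'"
    and eq: "\<And>t. 0 \<le> t \<Longrightarrow> t \<le> N \<Longrightarrow> char_slope q K W 0 t = char_slope q' K W' 0 t"
    and xe: "0 \<le> x0" "0 \<le> e0" "2 * x0 + e0 \<le> N"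
  shows "W x0 e0 = W' x0 e0"
proof -
  interpret A: goursat_kernel q q1 K W by fact
  interpret B: goursat_kernel q' q1' K W' by fact
  define D where "D = (\<lambda>x e. mem_force q K W x e - mem_force q' K W' x e)"
  have N: "N \<ge> 0" using xe by simp
  have Dc: "continuous_on quadrant (\<lambda>(x, e). D x e)"
    using A.force_cont B.force_cont unfolding D_def split_beta by (intro continuous_intros)
  obtain Cq where Cq: "Cq \<ge> 0" "\<And>x. 0 \<le> x \<Longrightarrow> x \<le> N \<Longrightarrow> \<bar>q x\<bar> \<le> Cq"
    using continuous_bounded_Icc[OF A.q_cont] by metis
  obtain CK where CK: "CK \<ge> 0" "\<And>x. 0 \<le> x \<Longrightarrow> x \<le> N \<Longrightarrow> \<bar>K x\<bar> \<le> CK"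
    using continuous_bounded_Icc[OF A.K] by metis
  have sq: "continuous_on ({0..N} \<times> {0..N}) (\<lambda>(x, e). W x e)" "continuous_on ({0..N} \<times> {0..N}) (\<lambda>(x, e). W' x e)"
    by (rule continuous_on_subset[OF A.W], auto, rule continuous_on_subset[OF B.W], auto)
  have cp: "compact ({0..N} \<times> {0..N})" by (intro compact_Times) auto
  obtain CW where CW: "CW \<ge> 0" "\<And>z. z \<in> {0..N} \<times> {0..N} \<Longrightarrow> \<bar>(\<lambda>(x, e). W x e) z\<bar> \<le> CW"
    using compact_continuous_bound[OF sq(1) cp] by blast
  obtain CW' where CW': "CW' \<ge> 0" "\<And>z. z \<in> {0..N} \<times> {0..N} \<Longrightarrow> \<bar>(\<lambda>(x, e). W' x e) z\<bar> \<le> CW'"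
    using compact_continuous_bound[OF sq(2) cp] by blast
  obtain Cq' where Cq': "Cq' \<ge> 0" "\<And>x. 0 \<le> x \<Longrightarrow> x \<le> N \<Longrightarrow> \<bar>q' x\<bar> \<le> Cq'"
    using continuous_bounded_Icc[OF B.q_cont] by metis
  \<comment> \<open>The three summands match the three terms of \<open>mem_force_diff\<close>:
    potential, difference of potentials, memory.\<close>
  define C where "C = Cq + CW' + CK * N"
  \<comment> \<open>The characteristic integral will gain only \<open>2 / l\<close>, because
    \<open>x\<close> changes at half the rate of the delay; hence 4 where 2 sufficed before.\<close>
  define l where "l = 1 + 4 * C"
  have C: "C \<ge> 0" using Cq(1) CW'(1) CK(1) N by (simp add: C_def)
  then have l: "l \<ge> 1" "l > 0" "4 * C \<le> l" by (auto simp: l_def)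
  \<comment> \<open>The weight is now in \<open>x\<close>, the variable of evolution, and the
    unknown is the pair of kernel and potential. The potential at \<open>x\<close> is read off at
    \<open>e = 0\<close>, where the region reduces to \<open>2 * x \<le> N\<close>.\<close>
  define P where "P = (\<lambda>B. (\<forall>x e. 0 \<le> x \<and> 0 \<le> e \<and> 2 * x + e \<le> N \<longrightarrow> \<bar>W x e - W' x e\<bar> \<le> B * exp (l * x))
     \<and> (\<forall>x. 0 \<le> x \<and> 2 * x \<le> N \<longrightarrow> \<bar>q x - q' x\<bar> \<le> B * exp (l * x)))"
  define B0 where "B0 = CW + CW' + Cq + Cq'"
  have B0: "B0 \<ge> 0" using CW(1) CW'(1) Cq(1) Cq'(1) by (simp add: B0_def)
  have ge: "B0 \<le> B0 * exp (l * x)" if "0 \<le> x" for x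
    using mult_left_mono[of 1 "exp (l * x)" B0] B0 l that by simp
  have P0: "P B0"
    unfolding P_def
  proof (intro conjI allI impI)
    fix x e assume xe: "0 \<le> x \<and> 0 \<le> e \<and> 2 * x + e \<le> N"
    then have "\<bar>W x e - W' x e\<bar> \<le> B0"
      using CW(2)[of "(x, e)"] CW'(2)[of "(x, e)"] Cq(1) Cq'(1) by (auto simp: B0_def)
    then show "\<bar>W x e - W' x e\<bar> \<le> B0 * exp (l * x)" using ge[of x] xe by linarith
  next
    fix x assume x: "0 \<le> x \<and> 2 * x \<le> N"
    then have "\<bar>q x - q' x\<bar> \<le> B0"
      using Cq(2)[of x] Cq'(2)[of x] CW(1) CW'(1) by (auto simp: B0_def)
    then show "\<bar>q x - q' x\<bar> \<le> B0 * exp (l * x)" using ge[of x] x by linarith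
  qed
  \<comment> \<open>The characteristic through \<open>(x, e)\<close> meets \<open>x = 0\<close> at
    delay \<open>2 * x + e\<close>, where the slopes agree by assumption. Subtracting removes the
    potentials at \<open>x + e / 2\<close> and leaves the stretch between the two points; starting
    from the diagonal instead gives the difference of the potentials.\<close>
  have S: "char_slope q K W x e - char_slope q' K W' x e
      = - integral {e..2 * x + e} (\<lambda>r. D (x + (e - r) / 2) r)"
    and Q: "q x - q' x = - integral {0..2 * x} (\<lambda>r. D (x - r / 2) r)"
    if "0 \<le> x" "0 \<le> e" "2 * x + e \<le> N" for x e
  proof -
    have base: "q (t / 2) - q' (t / 2) = - integral {0..t} (\<lambda>r. D ((t - r) / 2) r)"
      if "0 \<le> t" "t \<le> N" for t
      using char_slope_diff[OF A.W B.W A.K A.q_cont B.q_cont, of 0 t] eq[OF that] that by (simp add: D_def)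
    have "(\<lambda>r. D ((2 * x + e - r) / 2) r) integrable_on {0..2 * x + e}"
      using char_integrable[OF Dc, of 0 "2 * x + e"] that by simp
    then have "integral {0..e} (\<lambda>r. D ((2 * x + e - r) / 2) r) + integral {e..2 * x + e} (\<lambda>r. D ((2 * x + e - r) / 2) r)
      = integral {0..2 * x + e} (\<lambda>r. D ((2 * x + e - r) / 2) r)"
      using that by (intro Henstock_Kurzweil_Integration.integral_combine) auto
    moreover have r: "(2 * x + e - r) / 2 = x + (e - r) / 2" "(2 * x + e) / 2 = x + e / 2" for r
      by (simp_all add: field_simps)
    moreover note base[of "2 * x + e"]
      char_slope_diff[OF A.W B.W A.K A.q_cont B.q_cont that(1,2)]
    ultimately show "char_slope q K W x e - char_slope q' K W' x e
      = - integral {e..2 * x + e} (\<lambda>r. D (x + (e - r) / 2) r)"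
      unfolding r using that by (simp add: D_def)
    show "q x - q' x = - integral {0..2 * x} (\<lambda>r. D (x - r / 2) r)"
      using base[of "2 * x"] that by (simp add: diff_divide_distrib)
  qed
  have "\<bar>W x0 e0 - W' x0 e0\<bar> \<le> 0"
  proof (rule nonpos_of_halving[where P = P and B = B0 and c = "exp (l * x0)"])
    fix B assume B: "B \<ge> 0" "P B"
    have Db: "\<bar>D x e\<bar> \<le> C * B * exp (l * x)" if xe: "0 \<le> x" "0 \<le> e" "2 * x + e \<le> N" for x e
    proof -
      have "\<bar>integral {0..e} (\<lambda>s. K (e - s) * (W x s - W' x s))\<bar> \<le> CK * (B * exp (l * x)) * (e - 0)"
      proof (rule abs_integral_le_const)
        fix s assume s: "s \<in> {0..e}"
        show "\<bar>K (e - s) * (W x s - W' x s)\<bar> \<le> CK * (B * exp (l * x))"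
          unfolding abs_mult using s xe CK B by (intro mult_mono) (auto simp: P_def)
      qed (use xe in auto)
      also have "\<dots> \<le> CK * (B * exp (l * x)) * N"
        using xe CK B by (intro mult_left_mono) auto
      finally have "\<bar>integral {0..e} (\<lambda>s. K (e - s) * (W x s - W' x s))\<bar> \<le> CK * (B * exp (l * x)) * N" .
      moreover have "\<bar>q x * (W x e - W' x e)\<bar> \<le> Cq * (B * exp (l * x))"
        unfolding abs_mult using xe Cq B by (intro mult_mono) (auto simp: P_def)
      moreover have "\<bar>(q x - q' x) * W' x e\<bar> \<le> (B * exp (l * x)) * CW'"
        unfolding abs_mult using xe CW'(1) CW'(2)[of "(x, e)"] B by (intro mult_mono) (auto simp: P_def)
      moreover have "C * B * exp (l * x) = CK * (B * exp (l * x)) * N + Cq * (B * exp (l * x)) + (B * exp (l * x)) * CW'"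
        by (simp add: C_def algebra_simps)
      ultimately show ?thesis
        unfolding D_def mem_force_diff[OF A.W B.W A.K xe(1,2)] by linarith
    qed
    have I: "\<bar>integral {e..2 * x + e} (\<lambda>r. D (x + (e - r) / 2) r)\<bar> \<le> 2 * C * B / l * exp (l * x)"
      if xe: "0 \<le> x" "0 \<le> e" "2 * x + e \<le> N" for x e
    proof -
      \<comment> \<open>Chosen so that \<open>a * exp (- l / 2 * r)\<close> is the bound for
        \<open>D\<close> along the characteristic, whose first coordinate is
        \<open>x + (e - r) / 2\<close>.\<close>
      define a where "a = C * B * exp (l * (x + e / 2))"
      have hi: "((\<lambda>r. a * exp (- l / 2 * r)) has_integral
          a / (- l / 2) * exp (- l / 2 * (2 * x + e)) - a / (- l / 2) * exp (- l / 2 * e)) {e..2 * x + e}"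
        using xe l by (intro has_integral_exp) auto
      have "\<bar>integral {e..2 * x + e} (\<lambda>r. D (x + (e - r) / 2) r)\<bar> \<le> integral {e..2 * x + e} (\<lambda>r. a * exp (- l / 2 * r))"
      proof (rule abs_integral_le)
        fix r assume r: "r \<in> {e..2 * x + e}"
        have "\<bar>D (x + (e - r) / 2) r\<bar> \<le> C * B * exp (l * (x + (e - r) / 2))"
          using r xe by (intro Db) (auto simp: field_simps)
        also have "\<dots> = a * exp (- l / 2 * r)"
          by (simp add: a_def mult.assoc flip: exp_add) (simp add: algebra_simps diff_divide_distrib add_divide_distrib)
        finally show "\<bar>D (x + (e - r) / 2) r\<bar> \<le> a * exp (- l / 2 * r)" .
      qed (use hi in auto)
      also have "\<dots> = a / (- l / 2) * exp (- l / 2 * (2 * x + e)) - a / (- l / 2) * exp (- l / 2 * e)"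
        using hi by (rule integral_unique)
      also have "\<dots> \<le> - (a / (- l / 2) * exp (- l / 2 * e))"
        using l C B by (simp add: a_def)
      also have "\<dots> = 2 / l * (a * exp (- l / 2 * e))" by simp
      also have "a * exp (- l / 2 * e) = C * B * exp (l * x)"
        by (simp add: a_def mult.assoc flip: exp_add) (simp add: algebra_simps)
      finally show ?thesis by simp
    qed
    have half: "2 * C * B / l \<le> B / 2"
      using l mult_right_mono[OF l(3) B(1)] by (simp add: field_simps)
    have "\<bar>q x - q' x\<bar> \<le> B / 2 * exp (l * x)" if "0 \<le> x" "2 * x \<le> N" for x
    proof -
      have "\<bar>q x - q' x\<bar> \<le> 2 * C * B / l * exp (l * x)"
        using I[of x 0] Q[of x 0] that by simp
      also have "\<dots> \<le> B / 2 * exp (l * x)" using half by (intro mult_right_mono) auto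
      finally show ?thesis .
    qed
    moreover have "\<bar>W x e - W' x e\<bar> \<le> B / 2 * exp (l * x)" if xe: "0 \<le> x" "0 \<le> e" "2 * x + e \<le> N" for x e
    proof -
      have i: "(\<lambda>y. char_slope q K W y e) integrable_on {0..x}" "(\<lambda>y. char_slope q' K W' y e) integrable_on {0..x}"
        using continuous_on_slice(2)[OF continuous_on_char_slope[OF A.W A.q_cont A.K], of e]
          continuous_on_slice(2)[OF continuous_on_char_slope[OF B.W B.q_cont B.K], of e] xe
        by (auto intro!: integrable_continuous_interval intro: continuous_on_subset)
      have "\<bar>integral {0..x} (\<lambda>y. char_slope q K W y e - char_slope q' K W' y e)\<bar> \<le> 2 * C * B / l / l * exp (l * x)"
      proof (rule abs_integral_exp_le)
        fix y assume y: "y \<in> {0..x}"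
        show "\<bar>char_slope q K W y e - char_slope q' K W' y e\<bar> \<le> 2 * C * B / l * exp (l * y)"
          using I[of y e] S[of y e] y xe by auto
      qed (use l C B in auto)
      also have "\<dots> \<le> B / 2 * exp (l * x)"
      proof (intro mult_right_mono)
        have "2 * C * B / l / l \<le> 2 * C * B / l" using l C B frac_le[of "2 * C * B / l" "2 * C * B / l" 1 l] by simp
        then show "2 * C * B / l / l \<le> B / 2" using half by linarith
      qed simp
      finally have "\<bar>integral {0..x} (\<lambda>y. char_slope q K W y e - char_slope q' K W' y e)\<bar> \<le> B / 2 * exp (l * x)" .
      moreover have "W x e - W' x e = (- 1 / 2) * integral {0..x} (\<lambda>y. char_slope q K W y e - char_slope q' K W' y e)"
        using A.W_eq[OF xe(1,2)] B.W_eq[OF xe(1,2)] i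
        by (simp add: Henstock_Kurzweil_Integration.integral_diff diff_divide_distrib)
      ultimately show ?thesis by (simp add: abs_mult)
    qed
    ultimately show "P (B / 2)" by (auto simp: P_def)
  qed (use B0 P0 xe in \<open>auto simp: P_def\<close>)
  then show ?thesis by simp
qed

subsection \<open>The response operator determines the kernel\<close>

text \<open>Uniform approximation of \<open>g\<close> by polynomials makes the integral of
  \<open>g s * g s\<close> arbitrarily small. The moments are taken in \<open>H - s\<close> because
  they come from convolutions evaluated at time \<open>H\<close>.\<close>

lemma zero_of_polynomial_moments:
  fixes g :: "real \<Rightarrow> real"
  assumes g: "continuous_on {0..H} g"
    and mom: "\<And>p. real_polynomial_function p \<Longrightarrow> integral {0..H} (\<lambda>s. g s * p (H - s)) = 0"
    and H: "0 < H" and s: "s \<in> {0..H}"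
  shows "g s = 0"
proof -
  have gr: "continuous_on {0..H} (\<lambda>y. g (H - y))"
    by (intro continuous_on_compose2[OF g] continuous_intros) auto
  obtain B where B: "B \<ge> 0" "\<And>s. s \<in> {0..H} \<Longrightarrow> \<bar>g s\<bar> \<le> B"
    using compact_continuous_bound[OF g] by auto
  have g2: "continuous_on {0..H} (\<lambda>s. g s * g s)" by (intro continuous_intros g)
  have "integral {0..H} (\<lambda>s. g s * g s) \<le> 0"
  proof (rule field_le_epsilon)
    fix e :: real assume e: "0 < e"
    \<comment> \<open>The approximation error is \<open>B * d * H\<close>; the added 1 keeps the
      denominator positive when \<open>B = 0\<close>.\<close>
    define d where "d = e / (1 + B * H)"
    have BH: "0 < 1 + B * H" using B(1) H by (simp add: add_pos_nonneg)
    then have d: "d > 0" using e by (simp add: d_def)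
    obtain p where p: "real_polynomial_function p" "\<And>y. y \<in> {0..H} \<Longrightarrow> \<bar>g (H - y) - p y\<bar> < d"
      using Stone_Weierstrass_real_polynomial_function[OF compact_Icc gr d] by blast
    have "continuous_on UNIV p"
      using p(1) by (intro continuous_on_polymonial_function) (simp add: real_polynomial_function_eq)
    then have pc: "continuous_on {0..H} (\<lambda>s. p (H - s))"
      by (rule continuous_on_compose2) (auto intro!: continuous_intros)
    have "\<bar>integral {0..H} (\<lambda>s. g s * (g s - p (H - s)))\<bar> \<le> B * d * (H - 0)"
    proof (rule abs_integral_le_const)
      fix s assume s: "s \<in> {0..H}"
      have "\<bar>g (H - (H - s)) - p (H - s)\<bar> < d" by (rule p(2)) (use s in auto)
      then show "\<bar>g s * (g s - p (H - s))\<bar> \<le> B * d"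
        unfolding abs_mult using B s by (intro mult_mono) auto
    qed (use H in simp)
    moreover have "integral {0..H} (\<lambda>s. g s * (g s - p (H - s))) = integral {0..H} (\<lambda>s. g s * g s) - integral {0..H} (\<lambda>s. g s * p (H - s))"
      unfolding right_diff_distrib
      by (intro Henstock_Kurzweil_Integration.integral_diff integrable_continuous_interval continuous_intros g pc)
    moreover have "B * d * (H - 0) \<le> e"
    proof -
      have "B * d * (H - 0) = (B * H) * (e / (1 + B * H))" by (simp add: d_def)
      also have "\<dots> \<le> e" using BH e by (simp add: divide_le_eq)
      finally show ?thesis .
    qed
    ultimately show "integral {0..H} (\<lambda>s. g s * g s) \<le> 0 + e"
      using mom[OF p(1)] by linarith
  qed
  moreover have "integral {0..H} (\<lambda>s. g s * g s) \<ge> 0"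
    by (intro integral_nonneg integrable_continuous_interval g2) auto
  ultimately show ?thesis
    using integral_eq_0_iff[OF g2 H] s by simp
qed

text \<open>Testing with the controls \<open>t ^ 3 * p t\<close> and reading the responses at the
  single time \<open>H\<close> already gives all moments of the difference of the response kernels
  against \<open>(H - s) ^ 3 * p (H - s)\<close>.\<close>

lemma response_determines_slope:
  assumes g: "goursat_kernel q q1 K W" and g': "goursat_kernel q' q1' K W'" and H: "0 < H"
    and R: "response_operator q' K H = response_operator q K H"
    and t: "0 \<le> t" "t \<le> H"
  shows "char_slope q K W 0 t = char_slope q' K W' 0 t"
proof -
  interpret A: goursat_kernel q q1 K W by fact
  interpret B: goursat_kernel q' q1' K W' by fact
  define r where "r = (\<lambda>s. A.W1 0 s - B.W1 0 s)"
  have W1: "continuous_on {0..H} (A.W1 0)" "continuous_on {0..H} (B.W1 0)"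
    using continuous_on_slice(1)[OF A.W1_cont, of 0] continuous_on_slice(1)[OF B.W1_cont, of 0]
    by (auto elim: continuous_on_subset)
  then have r: "continuous_on {0..H} r"
    unfolding r_def by (intro continuous_intros)
  have "r s * (H - s) ^ 3 = 0" if s: "s \<in> {0..H}" for s
  proof (rule zero_of_polynomial_moments[OF _ _ H s])
    show "continuous_on {0..H} (\<lambda>s. r s * (H - s) ^ 3)"
      by (intro continuous_intros r)
    fix p :: "real \<Rightarrow> real" assume p: "real_polynomial_function p"
    obtain f f1 f2 where f: "\<And>t. (f has_real_derivative f1 t) (at t)" "\<And>t. (f1 has_real_derivative f2 t) (at t)"
      "continuous_on UNIV f2" "\<And>t. t \<le> 0 \<Longrightarrow> f t = 0" "\<And>t. t \<le> 0 \<Longrightarrow> f1 t = 0" "\<And>t. 0 \<le> t \<Longrightarrow> f t = t ^ 3 * p t"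
      using that by (rule polynomial_control[OF p])
    interpret A: delayed_control q q1 K W f f1 f2 H by unfold_locales (use f H in auto)
    interpret B: delayed_control q' q1' K W' f f1 f2 H by unfold_locales (use f H in auto)
    have "(f, A.sol_x 0) \<in> response_operator q K H"
      unfolding response_operator_def using A.classical_sol[of f] by auto
    then have "(f, A.sol_x 0) \<in> response_operator q' K H"
      using R by simp
    then obtain u ux where u: "classical_solution q' K H f u ux" "\<And>t. t \<in> {0..H} \<Longrightarrow> A.sol_x 0 t = ux 0 t"
      unfolding response_operator_def by auto
    have "ux 0 H = B.sol_x 0 H"
      using classical_solution_unique(2)[OF B.q_cont B.K u(1) B.classical_sol[of f]] H by simp
    then have "A.sol_x 0 H = B.sol_x 0 H" using u(2)[of H] H by simp
    \<comment> \<open>\<open>W\<close> vanishes at \<open>x = 0\<close>, so only the convolution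
      with \<open>W1\<close> distinguishes the two responses.\<close>
    moreover have "delay_conv H W f1 0 H = 0" "delay_conv H W' f1 0 H = 0"
    proof -
      have "integral {0..H} (\<lambda>s. W 0 s * f1 (H - 0 - s)) = integral {0..H} (\<lambda>_. 0)"
        "integral {0..H} (\<lambda>s. W' 0 s * f1 (H - 0 - s)) = integral {0..H} (\<lambda>_. 0)"
        by (rule Henstock_Kurzweil_Integration.integral_cong; simp)+
      then show "delay_conv H W f1 0 H = 0" "delay_conv H W' f1 0 H = 0"
        unfolding delay_conv_def by simp_all
    qed
    ultimately have "delay_conv H A.W1 f 0 H = delay_conv H B.W1 f 0 H"
      by (simp add: A.sol_x_def B.sol_x_def)
    moreover have fc: "continuous_on {0..H} (\<lambda>s. f (H - s))"
      by (intro continuous_on_compose2[OF A.f_cont] continuous_intros) auto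
    moreover have "integral {0..H} (\<lambda>s. A.W1 0 s * f (H - s) - B.W1 0 s * f (H - s))
      = integral {0..H} (\<lambda>s. A.W1 0 s * f (H - s)) - integral {0..H} (\<lambda>s. B.W1 0 s * f (H - s))"
      by (intro Henstock_Kurzweil_Integration.integral_diff integrable_continuous_interval continuous_intros fc W1)
    ultimately have "integral {0..H} (\<lambda>s. A.W1 0 s * f (H - s) - B.W1 0 s * f (H - s)) = 0"
      by (simp add: delay_conv_def)
    moreover have "integral {0..H} (\<lambda>s. A.W1 0 s * f (H - s) - B.W1 0 s * f (H - s)) = integral {0..H} (\<lambda>s. r s * (H - s) ^ 3 * p (H - s))"
      by (intro Henstock_Kurzweil_Integration.integral_cong) (auto simp: r_def f(6) algebra_simps)
    ultimately show "integral {0..H} (\<lambda>s. r s * (H - s) ^ 3 * p (H - s)) = 0" by simp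
  qed
  \<comment> \<open>The weight \<open>(H - s) ^ 3\<close> vanishes at \<open>s = H\<close>, so that
    endpoint is recovered by continuity.\<close>
  then have "r s = 0" if "s \<in> {0..<H}" for s
    using that by force
  then have "r t = 0"
    using r H t by (intro continuous_constant_on_closure[of "{0..<H}" r 0 t]) auto
  then show ?thesis by (simp add: r_def A.W1_def B.W1_def)
qed

subsection \<open>Square-integrable controls\<close>

lemma lebesgue_on_borel:
  fixes h :: "real \<Rightarrow> real"
  assumes h: "h \<in> borel_measurable borel" and S: "S \<in> sets borel" and z: "\<And>x. x \<notin> S \<Longrightarrow> h x = 0"
  shows "integral\<^sup>L (lebesgue_on S) h = integral\<^sup>L lborel h" "integrable (lebesgue_on S) h \<longleftrightarrow> integrable lborel h"
proof -
  have S': "S \<inter> space lebesgue \<in> sets lebesgue" using S by simp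
  have eq: "(\<lambda>x. indicator S x *\<^sub>R h x) = h" by (rule ext) (auto simp: indicator_def z)
  show "integral\<^sup>L (lebesgue_on S) h = integral\<^sup>L lborel h"
    unfolding integral_restrict_space[OF S'] eq using h by (simp add: integral_completion)
  show "integrable (lebesgue_on S) h \<longleftrightarrow> integrable lborel h"
    unfolding integrable_restrict_space[OF S'] eq using h by (simp add: integrable_completion)
qed

lemma AE_lebesgue_on:
  assumes "S \<in> sets borel"
  shows "(AE x in lebesgue_on S. P x) \<longleftrightarrow> (AE x in lborel. x \<in> S \<longrightarrow> P (x :: real))"
  using assms by (simp add: AE_restrict_space_iff AE_completion_iff)

text \<open>\<open>P\<close> is arbitrary, so it is first replaced by the complement of a measurable
  null set; the affine change of variables then applies.\<close>

lemma AE_lborel_reflect: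
  assumes "AE x in lborel. P (x :: real)"
  shows "AE x in lborel. P (T - x)"
proof -
  obtain N where N: "{x \<in> space lborel. \<not> P x} \<subseteq> N" "N \<in> null_sets lborel"
    using assms by (auto simp: eventually_ae_filter)
  have "AE x in lborel. x \<notin> N" using N(2) by (rule AE_not_in)
  moreover have "Measurable.pred borel (\<lambda>x. x \<notin> N)" using N(2) by (auto simp: null_sets_def)
  ultimately have "AE x in lborel. T + (- 1) * x \<notin> N"
    by (intro AE_borel_affine) auto
  then show ?thesis by (rule eventually_mono) (use N(1) in auto)
qed

lemma borel_measurable_lebesgue_on:
  "h \<in> borel_measurable borel \<Longrightarrow> h \<in> borel_measurable (lebesgue_on S)" for h :: "real \<Rightarrow> real"
  by (intro measurable_restrict_space1 measurable_completion) simp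

lemma sq_add_le: "(a + b)\<^sup>2 \<le> 2 * a\<^sup>2 + 2 * b\<^sup>2" for a b :: real
  using zero_le_power2[of "a - b"] unfolding power2_diff power2_sum by linarith

lemma L2_diff:
  assumes "f \<in> L2 M" "g \<in> L2 M" shows "(\<lambda>x. f x - g x) \<in> L2 M"
proof -
  have [measurable]: "f \<in> borel_measurable M" "g \<in> borel_measurable M" using assms by (auto simp: L2_def)
  have "integrable M (\<lambda>x. (f x - g x)\<^sup>2)"
  proof (rule Bochner_Integration.integrable_bound)
    show "integrable M (\<lambda>x. 2 * (f x)\<^sup>2 + 2 * (g x)\<^sup>2)" using assms by (auto simp: L2_def)
    show "AE x in M. norm ((f x - g x)\<^sup>2) \<le> norm (2 * (f x)\<^sup>2 + 2 * (g x)\<^sup>2)"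
      using sq_add_le[of "f x" "- g x" for x] by (intro AE_I2) simp
  qed measurable
  then show ?thesis by (simp add: L2_def)
qed

lemma L2_null:
  assumes "f \<in> L2 M" "(\<integral>x. (f x)\<^sup>2 \<partial>M) \<le> 0"
  shows "AE x in M. f x = 0"
proof -
  have i: "integrable M (\<lambda>x. (f x)\<^sup>2)" using assms(1) by (simp add: L2_def)
  moreover have "(\<integral>x. (f x)\<^sup>2 \<partial>M) = 0"
    using assms(2) by (intro antisym) simp_all
  ultimately have "AE x in M. (f x)\<^sup>2 = 0"
    by (subst integral_nonneg_eq_0_iff_AE[symmetric]) auto
  then show ?thesis by simp
qed

lemma L2_tendsto_unique:
  assumes f: "L2_tendsto M F f" and g: "L2_tendsto M F g"
  shows "AE x in M. f x = g x"
proof -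
  have L2: "f \<in> L2 M" "g \<in> L2 M" "\<And>n. F n \<in> L2 M" using f g by (auto simp: L2_tendsto_def)
  have i: "integrable M (\<lambda>x. (F n x - f x)\<^sup>2)" "integrable M (\<lambda>x. (F n x - g x)\<^sup>2)" "integrable M (\<lambda>x. (f x - g x)\<^sup>2)" for n
    using L2_diff L2 by (auto simp: L2_def)
  have le: "(\<integral>x. (f x - g x)\<^sup>2 \<partial>M) \<le> 2 * (\<integral>x. (F n x - f x)\<^sup>2 \<partial>M) + 2 * (\<integral>x. (F n x - g x)\<^sup>2 \<partial>M)" for n
  proof -
    have "(\<integral>x. (f x - g x)\<^sup>2 \<partial>M) \<le> (\<integral>x. 2 * (F n x - f x)\<^sup>2 + 2 * (F n x - g x)\<^sup>2 \<partial>M)"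
    proof (rule integral_mono)
      show "(f x - g x)\<^sup>2 \<le> 2 * (F n x - f x)\<^sup>2 + 2 * (F n x - g x)\<^sup>2" for x
        using sq_add_le[of "f x - F n x" "F n x - g x"] by (simp add: power2_commute)
    qed (use i in auto)
    also have "\<dots> = 2 * (\<integral>x. (F n x - f x)\<^sup>2 \<partial>M) + 2 * (\<integral>x. (F n x - g x)\<^sup>2 \<partial>M)"
      using i by simp
    finally show ?thesis .
  qed
  have "(\<lambda>n. 2 * (\<integral>x. (F n x - f x)\<^sup>2 \<partial>M) + 2 * (\<integral>x. (F n x - g x)\<^sup>2 \<partial>M)) \<longlonglongrightarrow> 2 * 0 + 2 * 0"
    using f g by (intro tendsto_intros) (auto simp: L2_tendsto_def)
  then have "(\<integral>x. (f x - g x)\<^sup>2 \<partial>M) \<le> 0"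
    using le by (intro LIMSEQ_le_const) auto
  from L2_null[OF L2_diff[OF L2(1,2)] this] show ?thesis by simp
qed

text \<open>Controls are only Lebesgue measurable; Fubini's theorem for \<open>lborel\<close> needs a Borel
  representative.\<close>

definition L2_borel :: "real \<Rightarrow> (real \<Rightarrow> real) set" where
  "L2_borel T = {g \<in> borel_measurable borel. (\<forall>x. x \<notin> {0<..<T} \<longrightarrow> g x = 0) \<and> integrable lborel (\<lambda>x. (g x)\<^sup>2)}"

lemma L2_borelD:
  assumes "g \<in> L2_borel T"
  shows "g \<in> borel_measurable borel" "x \<notin> {0<..<T} \<Longrightarrow> g x = 0" "integrable lborel (\<lambda>x. (g x)\<^sup>2)"
  using assms by (auto simp: L2_borel_def)

text \<open>On a bounded interval the pointwise inequality
  \<open>\<bar>g x\<bar> \<le> 1 + (g x)\<^sup>2\<close> gives integrability.\<close>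

lemma L2_borel_integrable:
  assumes g: "g \<in> L2_borel T" shows "integrable lborel g"
proof (rule Bochner_Integration.integrable_bound)
  show "integrable lborel (\<lambda>x. indicator {0..T} x + (g x)\<^sup>2)"
    using L2_borelD(3)[OF g] by (intro Bochner_Integration.integrable_add) (auto simp: integrable_indicator_iff emeasure_lborel_Icc_eq)
  show "g \<in> borel_measurable lborel" using L2_borelD(1)[OF g] by simp
  have "\<bar>g x\<bar> \<le> indicator {0..T} x + (g x)\<^sup>2" for x
  proof (cases "x \<in> {0..T}")
    case True
    have "\<bar>g x\<bar> \<le> 1 + \<bar>g x\<bar>\<^sup>2" using zero_le_power2[of "\<bar>g x\<bar> - 1"] by (simp add: power2_eq_square algebra_simps)
    then show ?thesis using True by simp
  qed (use L2_borelD(2)[OF g, of x] in auto)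
  then show "AE x in lborel. norm (g x) \<le> norm (indicator {0..T} x + (g x)\<^sup>2)"
    by (intro AE_I2) (simp add: order_trans[OF _ abs_ge_self])
qed

lemma L2_borel_imp_L2:
  assumes "g \<in> L2_borel T" shows "g \<in> L2 (L2_measure T)"
proof -
  have [measurable]: "g \<in> borel_measurable borel" using assms by (rule L2_borelD)
  have "(\<lambda>x. (g x)\<^sup>2) \<in> borel_measurable borel" by measurable
  then have "integrable (L2_measure T) (\<lambda>x. (g x)\<^sup>2)"
    using assms by (subst lebesgue_on_borel(2)) (auto simp: L2_borel_def)
  then show ?thesis
    using borel_measurable_lebesgue_on[of g] by (simp add: L2_def)
qed

lemma L2_borel_integral:
  assumes "g \<in> L2_borel T"
  shows "(\<integral>x. (g x)\<^sup>2 \<partial>L2_measure T) = (\<integral>x. (g x)\<^sup>2 \<partial>lborel)" "(\<integral>x. g x \<partial>L2_measure T) = (\<integral>x. g x \<partial>lborel)"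
proof -
  have [measurable]: "g \<in> borel_measurable borel" using assms by (rule L2_borelD)
  have "(\<lambda>x. (g x)\<^sup>2) \<in> borel_measurable borel" by measurable
  then show "(\<integral>x. (g x)\<^sup>2 \<partial>L2_measure T) = (\<integral>x. (g x)\<^sup>2 \<partial>lborel)" "(\<integral>x. g x \<partial>L2_measure T) = (\<integral>x. g x \<partial>lborel)"
    using assms lebesgue_on_borel(1)[of "\<lambda>x. (g x)\<^sup>2" "{0<..<T}"] lebesgue_on_borel(1)[of g "{0<..<T}"]
    by (simp_all add: L2_borel_def)
qed

lemma L2_borel_diff:
  assumes "f \<in> L2_borel T" "g \<in> L2_borel T" shows "(\<lambda>x. f x - g x) \<in> L2_borel T"
proof -
  have "(\<lambda>x. f x - g x) \<in> L2 lborel"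
    using assms by (intro L2_diff) (auto simp: L2_def L2_borel_def)
  then show ?thesis using assms by (auto simp: L2_def L2_borel_def)
qed

lemma L2_borel_rep:
  assumes f: "f \<in> L2 (L2_measure T)"
  obtains g where "g \<in> L2_borel T" "AE x in L2_measure T. f x = g x"
proof -
  define f' where "f' = (\<lambda>x. if x \<in> {0<..<T} then f x else 0)"
  have "f' \<in> borel_measurable lebesgue"
    unfolding f'_def using f by (intro borel_measurable_if_I) (auto simp: L2_def)
  from completion_ex_borel_measurable_real[OF this]
  obtain g' where g': "g' \<in> borel_measurable lborel" "AE x in lborel. f' x = g' x" by blast
  define g where "g = (\<lambda>x. indicator {0<..<T} x * g' x)"
  have g: "g \<in> borel_measurable borel" using g'(1) by (simp add: g_def)
  have ae: "AE x in L2_measure T. f x = g x"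
    using g'(2) by (auto simp: AE_lebesgue_on f'_def g_def)
  have "integrable (L2_measure T) (\<lambda>x. (g x)\<^sup>2)"
  proof (rule integrable_cong_AE_imp)
    show "integrable (L2_measure T) (\<lambda>x. (f x)\<^sup>2)" using f by (simp add: L2_def)
    show "(\<lambda>x. (g x)\<^sup>2) \<in> borel_measurable (L2_measure T)"
      using g by (intro borel_measurable_lebesgue_on) simp
    show "AE x in L2_measure T. (f x)\<^sup>2 = (g x)\<^sup>2" using ae by eventually_elim simp
  qed
  then have "integrable lborel (\<lambda>x. (g x)\<^sup>2)"
    using g by (subst (asm) lebesgue_on_borel(2)) (auto simp: g_def)
  then have "g \<in> L2_borel T" using g by (auto simp: L2_borel_def g_def)
  then show ?thesis using ae by (rule that)
qed

lemma L2_borel_abs_integral: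
  assumes g: "g \<in> L2_borel T" and T: "0 < T"
  shows "(\<integral>x. \<bar>g x\<bar> \<partial>lborel)\<^sup>2 \<le> T * (\<integral>x. (g x)\<^sup>2 \<partial>lborel)"
proof -
  \<comment> \<open>This is Cauchy--Schwarz against the constant 1: the square of
    \<open>\<bar>g x\<bar> - m\<close> is integrated with \<open>m\<close> the mean of
    \<open>\<bar>g\<bar>\<close>, the optimal constant.\<close>
  define m where "m = (\<integral>x. \<bar>g x\<bar> \<partial>lborel) / T"
  have i: "integrable lborel (\<lambda>x. \<bar>g x\<bar>)" "integrable lborel (\<lambda>x. (g x)\<^sup>2)"
    using L2_borel_integrable[OF g] L2_borelD(3)[OF g] by auto
  have "0 \<le> (\<integral>x. (\<bar>g x\<bar> - m * indicator {0..T} x)\<^sup>2 \<partial>lborel)" by simp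
  also have "\<dots> = (\<integral>x. (g x)\<^sup>2 - 2 * m * \<bar>g x\<bar> + m\<^sup>2 * indicator {0..T} x \<partial>lborel)"
    using L2_borelD(2)[OF g]
    by (intro Bochner_Integration.integral_cong) (auto simp: indicator_def power2_eq_square algebra_simps)
  also have "\<dots> = (\<integral>x. (g x)\<^sup>2 \<partial>lborel) - 2 * m * (\<integral>x. \<bar>g x\<bar> \<partial>lborel) + m\<^sup>2 * T"
    using i T by (simp add: Bochner_Integration.integral_add Bochner_Integration.integral_diff integrable_indicator_iff)
  finally have "0 \<le> (\<integral>x. (g x)\<^sup>2 \<partial>lborel) - 2 * m * (\<integral>x. \<bar>g x\<bar> \<partial>lborel) + m\<^sup>2 * T" .
  then have "0 \<le> T * ((\<integral>x. (g x)\<^sup>2 \<partial>lborel) - 2 * m * (\<integral>x. \<bar>g x\<bar> \<partial>lborel) + m\<^sup>2 * T)"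
    using T by simp
  also have "\<dots> = T * (\<integral>x. (g x)\<^sup>2 \<partial>lborel) - (\<integral>x. \<bar>g x\<bar> \<partial>lborel)\<^sup>2"
    using T by (simp add: m_def power2_eq_square field_simps)
  finally show ?thesis by simp
qed

text \<open>Truncate to a bounded function vanishing near \<open>0\<close>, divide by \<open>t\<^sup>3\<close>, and approximate the
  quotient first by continuous functions and then by a polynomial.\<close>

lemma L2_polynomial_density_eps:
  assumes f: "f \<in> L2 (L2_measure T)" and T: "0 < T" and e: "0 < e"
  obtains p where "real_polynomial_function p" "(\<lambda>t. t ^ 3 * p t) \<in> L2 (L2_measure T)"
    "(\<integral>t. (t ^ 3 * p t - f t)\<^sup>2 \<partial>L2_measure T) < e"
proof -
  let ?M = "L2_measure T"
  have sp: "space ?M = {0<..<T}" by simp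
  have emM: "emeasure ?M (space ?M) = ennreal T"
    using T by (simp add: emeasure_restrict_space)
  interpret M: finite_measure ?M
    by (rule finite_measureI) (subst emM, simp)
  have mM: "measure ?M {0<..<T} = T" using emM T by (simp add: measure_def)
  have fm [measurable]: "f \<in> borel_measurable ?M" and fi: "integrable ?M (\<lambda>x. (f x)\<^sup>2)"
    using f by (auto simp: L2_def)
  define fk where "fk = (\<lambda>k::nat. \<lambda>t. if \<bar>f t\<bar> \<le> real k \<and> 1 / real k \<le> t then f t else 0)"
  have idm [measurable]: "(\<lambda>t::real. t) \<in> borel_measurable ?M" by (intro borel_measurable_lebesgue_on) simp
  have fkm [measurable]: "fk k \<in> borel_measurable ?M" for k unfolding fk_def by measurable
  have "(\<lambda>k. \<integral>t. (fk k t - f t)\<^sup>2 \<partial>?M) \<longlonglongrightarrow> (\<integral>t. 0 \<partial>?M)"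
  proof (rule integral_dominated_convergence)
    show "AE t in ?M. (\<lambda>k. (fk k t - f t)\<^sup>2) \<longlonglongrightarrow> 0"
    proof (rule AE_I2)
      fix t assume "t \<in> space ?M"
      then have t: "0 < t" by simp
      obtain k0 :: nat where k0: "\<bar>f t\<bar> + 1 / t \<le> real k0" using real_arch_simple by blast
      have "fk k t = f t" if "k \<ge> k0" for k
      proof -
        have "\<bar>f t\<bar> + 1 / t \<le> real k" "0 < 1 / t" using k0 that t by (auto intro: order_trans)
        then have "\<bar>f t\<bar> \<le> real k" "1 / t \<le> real k" by linarith+
        then have "1 / real k \<le> t" using t by (cases "k = 0") (auto simp: field_simps)
        then show ?thesis using \<open>\<bar>f t\<bar> \<le> real k\<close> by (simp add: fk_def)
      qed
      then have "\<forall>\<^sub>F k in sequentially. (fk k t - f t)\<^sup>2 = 0"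
        by (auto simp: eventually_sequentially)
      then show "(\<lambda>k. (fk k t - f t)\<^sup>2) \<longlonglongrightarrow> 0" by (rule tendsto_eventually)
    qed
    show "AE t in ?M. norm ((fk k t - f t)\<^sup>2) \<le> (f t)\<^sup>2" for k
      by (intro AE_I2) (auto simp: fk_def)
  qed (use fi in auto)
  then have "\<forall>\<^sub>F k in sequentially. (\<integral>t. (fk k t - f t)\<^sup>2 \<partial>?M) < e / 10"
    using e by (intro order_tendstoD(2)) auto
  \<comment> \<open>Three errors of \<open>e / 10\<close>, each entering the final estimate with
    factor 3, leave a total below \<open>e\<close>.\<close>
  then obtain k0 where k0: "\<And>k. k \<ge> k0 \<Longrightarrow> (\<integral>t. (fk k t - f t)\<^sup>2 \<partial>?M) < e / 10"
    by (auto simp: eventually_sequentially)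
  define k where "k = Suc k0"
  have k: "(\<integral>t. (fk k t - f t)\<^sup>2 \<partial>?M) < e / 10" "real k > 0" using k0[of k] by (auto simp: k_def)
  \<comment> \<open>Where \<open>fk k\<close> is nonzero, \<open>\<bar>f t\<bar> \<le> k\<close> and
    \<open>1 / t \<le> k\<close>, so the quotient by \<open>t ^ 3\<close> is at most
    \<open>k ^ 4\<close>.\<close>
  define B where "B = real k ^ 4"
  define h where "h = (\<lambda>t. fk k t / t ^ 3)"
  have hm [measurable]: "h \<in> borel_measurable ?M" unfolding h_def by measurable
  have hB: "\<bar>h t\<bar> \<le> B" if "0 < t" for t
  proof (cases "1 / real k \<le> t \<and> \<bar>f t\<bar> \<le> real k")
    case True
    have "1 / t \<le> real k" using True that k(2) by (simp add: field_simps)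
    then have "(1 / t) ^ 3 \<le> real k ^ 3" using that by (intro power_mono) auto
    then have "\<bar>f t\<bar> * (1 / t) ^ 3 \<le> real k * real k ^ 3" using True that k(2) by (intro mult_mono) auto
    then show ?thesis using True that by (simp add: h_def fk_def B_def abs_mult power_divide eval_nat_numeral)
  qed (auto simp: h_def fk_def B_def)
  have B: "B \<ge> 0" by (simp add: B_def)
  have "h measurable_on {0<..<T}" using hm by (subst measurable_on_iff_borel_measurable) auto
  then obtain N G where N: "negligible N" and G: "\<And>n. continuous_on UNIV (G n)"
    and lim: "\<And>x. x \<notin> N \<Longrightarrow> (\<lambda>n. G n x) \<longlonglongrightarrow> (if x \<in> {0<..<T} then h x else 0)"
    unfolding measurable_on_def by blast
  \<comment> \<open>Clamping at the bound of \<open>h\<close> leaves the almost everywhere limit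
    unchanged and supplies a dominating constant.\<close>
  define G' where "G' = (\<lambda>n::nat. \<lambda>x. max (- B) (min B (G n x)))"
  have G'c: "continuous_on UNIV (G' n)" for n
    unfolding G'_def by (intro continuous_intros G)
  have G'm [measurable]: "G' n \<in> borel_measurable ?M" for n
    by (intro borel_measurable_lebesgue_on borel_measurable_continuous_onI G'c)
  have G'h: "\<bar>G' n t - h t\<bar> \<le> 2 * B" if "0 < t" for n t
    using hB[OF that] B by (auto simp: G'_def)
  have G'h2: "(G' n t - h t)\<^sup>2 \<le> (2 * B)\<^sup>2" if "0 < t" for n t
    using power_mono[OF G'h[OF that, of n], of 2] by simp
  have "(\<lambda>n. \<integral>t. (G' n t - h t)\<^sup>2 \<partial>?M) \<longlonglongrightarrow> (\<integral>t. 0 \<partial>?M)"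
  proof (rule integral_dominated_convergence[where w = "\<lambda>_. (2 * B)\<^sup>2"])
    have "AE t in lebesgue. t \<notin> N" using N by (auto simp: negligible_iff_null_sets intro: AE_not_in)
    then have "AE t in ?M. t \<notin> N" by (auto simp: AE_restrict_space_iff elim!: eventually_mono)
    moreover have "AE t in ?M. t \<in> {0<..<T}" by (intro AE_I2) simp
    ultimately show "AE t in ?M. (\<lambda>n. (G' n t - h t)\<^sup>2) \<longlonglongrightarrow> 0"
    proof eventually_elim
      case (elim t)
      then have "(\<lambda>n. G n t) \<longlonglongrightarrow> h t" using lim[of t] by simp
      then have "(\<lambda>n. G' n t) \<longlonglongrightarrow> max (- B) (min B (h t))"
        unfolding G'_def by (intro tendsto_intros)
      moreover have "max (- B) (min B (h t)) = h t" using hB[of t] elim by auto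
      ultimately have "(\<lambda>n. (G' n t - h t)\<^sup>2) \<longlonglongrightarrow> (h t - h t)\<^sup>2" by (intro tendsto_intros) simp_all
      then show ?case by simp
    qed
    show "AE t in ?M. norm ((G' n t - h t)\<^sup>2) \<le> (2 * B)\<^sup>2" for n
      using G'h2 by (intro AE_I2) auto
  qed auto
  then have "\<forall>\<^sub>F n in sequentially. (\<integral>t. (G' n t - h t)\<^sup>2 \<partial>?M) < e / 10 / T ^ 6"
    using e T by (intro order_tendstoD(2)) auto
  then obtain n where n: "(\<integral>t. (G' n t - h t)\<^sup>2 \<partial>?M) < e / 10 / T ^ 6"
    by (auto simp: eventually_sequentially)
  \<comment> \<open>Multiplying back by \<open>t ^ 3\<close> costs \<open>T ^ 6\<close> in the
    square, and integrating a constant over the interval costs another \<open>T\<close>.\<close>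
  define d where "d = sqrt (e / 10 / T ^ 7)"
  have d: "d > 0" "d\<^sup>2 = e / 10 / T ^ 7" using e T by (auto simp: d_def)
  obtain p where p: "real_polynomial_function p" "\<And>t. t \<in> {0..T} \<Longrightarrow> \<bar>G' n t - p t\<bar> < d"
    using Stone_Weierstrass_real_polynomial_function[OF compact_Icc continuous_on_subset[OF G'c] d(1), of 0 T n] by auto
  have pc: "continuous_on UNIV (\<lambda>t. t ^ 3 * p t)"
    using p(1) by (intro continuous_intros continuous_on_polymonial_function) (simp add: real_polynomial_function_eq)
  have pm [measurable]: "(\<lambda>t. t ^ 3 * p t) \<in> borel_measurable ?M"
    by (intro borel_measurable_lebesgue_on borel_measurable_continuous_onI pc)
  have pL2: "(\<lambda>t. t ^ 3 * p t) \<in> L2 ?M"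
  proof -
    obtain C where C: "\<And>t. t \<in> {0..T} \<Longrightarrow> \<bar>t ^ 3 * p t\<bar> \<le> C"
      using compact_continuous_bound[OF continuous_on_subset[OF pc], of "{0..T}"] by auto
    have "integrable ?M (\<lambda>t. (t ^ 3 * p t)\<^sup>2)"
    proof (rule M.integrable_const_bound[where B = "C\<^sup>2"])
      show "AE t in ?M. norm ((t ^ 3 * p t)\<^sup>2) \<le> C\<^sup>2"
      proof (rule AE_I2)
        fix t assume "t \<in> space ?M"
        then have "\<bar>t ^ 3 * p t\<bar> \<le> C" using C[of t] by auto
        from power_mono[OF this, of 2] show "norm ((t ^ 3 * p t)\<^sup>2) \<le> C\<^sup>2" by simp
      qed
    qed measurable
    then show ?thesis by (simp add: L2_def)
  qed
  have i1: "integrable ?M (\<lambda>t. (G' n t - h t)\<^sup>2)"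
    by (rule M.integrable_const_bound[where B = "(2 * B)\<^sup>2"]) (use G'h2 in auto)
  have i2: "integrable ?M (\<lambda>t. (fk k t - f t)\<^sup>2)"
    by (rule Bochner_Integration.integrable_bound[OF fi]) (auto simp: fk_def)
  have "(\<integral>t. (t ^ 3 * p t - f t)\<^sup>2 \<partial>?M) \<le> (\<integral>t. 3 * (T ^ 6 * d\<^sup>2) + 3 * (T ^ 6 * (G' n t - h t)\<^sup>2) + 3 * (fk k t - f t)\<^sup>2 \<partial>?M)"
  proof (rule integral_mono)
    show "integrable ?M (\<lambda>t. (t ^ 3 * p t - f t)\<^sup>2)" using L2_diff[OF pL2 f] by (simp add: L2_def)
    show "integrable ?M (\<lambda>t. 3 * (T ^ 6 * d\<^sup>2) + 3 * (T ^ 6 * (G' n t - h t)\<^sup>2) + 3 * (fk k t - f t)\<^sup>2)"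
      using i1 i2 by (intro Bochner_Integration.integrable_add integrable_mult_right) auto
    fix t assume "t \<in> space ?M"
    then have t: "0 < t" "t < T" by auto
    define a b c where "a = t ^ 3 * (p t - G' n t)" and "b = t ^ 3 * (G' n t - h t)" and "c = fk k t - f t"
    have split: "t ^ 3 * p t - f t = a + b + c" using t by (simp add: a_def b_def c_def h_def algebra_simps)
    have "(a + b + c)\<^sup>2 \<le> 3 * a\<^sup>2 + 3 * b\<^sup>2 + 3 * c\<^sup>2"
      using zero_le_power2[of "a - b"] zero_le_power2[of "a - c"] zero_le_power2[of "b - c"]
      by (simp add: power2_eq_square algebra_simps)
    moreover have t6: "(t ^ 3)\<^sup>2 \<le> T ^ 6"
      using t power_mono[of t T 6] by (simp flip: power_mult)
    have "(p t - G' n t)\<^sup>2 \<le> d\<^sup>2"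
      using p(2)[of t] t power_mono[of "\<bar>p t - G' n t\<bar>" d 2] by (simp add: abs_minus_commute)
    then have "a\<^sup>2 \<le> T ^ 6 * d\<^sup>2"
      unfolding a_def power_mult_distrib using t6 by (intro mult_mono) auto
    moreover have "b\<^sup>2 \<le> T ^ 6 * (G' n t - h t)\<^sup>2"
      unfolding b_def power_mult_distrib using t6 by (intro mult_right_mono) auto
    ultimately show "(t ^ 3 * p t - f t)\<^sup>2 \<le> 3 * (T ^ 6 * d\<^sup>2) + 3 * (T ^ 6 * (G' n t - h t)\<^sup>2) + 3 * (fk k t - f t)\<^sup>2"
      unfolding split unfolding c_def by linarith
  qed
  also have "\<dots> = 3 * (T ^ 6 * d\<^sup>2) * T + 3 * (T ^ 6 * (\<integral>t. (G' n t - h t)\<^sup>2 \<partial>?M)) + 3 * (\<integral>t. (fk k t - f t)\<^sup>2 \<partial>?M)"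
    using i1 i2 T mM by (simp add: Bochner_Integration.integral_add)
  also have "\<dots> < e"
  proof -
    have "T ^ 6 * d\<^sup>2 * T = T ^ 7 * d\<^sup>2" by (simp add: eval_nat_numeral)
    also have "\<dots> = e / 10" using T by (simp add: d(2))
    finally have "T ^ 6 * d\<^sup>2 * T = e / 10" .
    moreover have "T ^ 6 * (\<integral>t. (G' n t - h t)\<^sup>2 \<partial>?M) < e / 10" using n T by (simp add: field_simps)
    ultimately show ?thesis using k(1) e by linarith
  qed
  finally show ?thesis using that[OF p(1) pL2] by simp
qed

lemma L2_polynomial_density:
  assumes f: "f \<in> L2 (L2_measure T)" and T: "0 < T"
  obtains P where "\<And>n. real_polynomial_function (P n)" "L2_tendsto (L2_measure T) (\<lambda>n t. t ^ 3 * P n t) f"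
proof -
  define Q where "Q = (\<lambda>(n::nat) p. real_polynomial_function p \<and> (\<lambda>t. t ^ 3 * p t) \<in> L2 (L2_measure T) \<and>
    (\<integral>t. (t ^ 3 * p t - f t)\<^sup>2 \<partial>L2_measure T) < inverse (real (Suc n)))"
  have "\<forall>n. \<exists>p. Q n p"
  proof
    fix n
    show "\<exists>p. Q n p"
      unfolding Q_def by (rule L2_polynomial_density_eps[OF f T, of "inverse (real (Suc n))"]) auto
  qed
  from choice[OF this] obtain P where "\<forall>n. Q n (P n)" ..
  then have P: "\<And>n. real_polynomial_function (P n)" "\<And>n. (\<lambda>t. t ^ 3 * P n t) \<in> L2 (L2_measure T)"
    "\<And>n. (\<integral>t. (t ^ 3 * P n t - f t)\<^sup>2 \<partial>L2_measure T) < inverse (real (Suc n))"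
    by (simp_all only: Q_def)
  have le: "(\<integral>t. (t ^ 3 * P n t - f t)\<^sup>2 \<partial>L2_measure T) \<le> inverse (real (Suc n))" for n
    using P(3)[of n] by simp
  have "(\<lambda>n. \<integral>t. (t ^ 3 * P n t - f t)\<^sup>2 \<partial>L2_measure T) \<longlonglongrightarrow> 0"
    by (rule tendsto_sandwich[OF _ _ tendsto_const LIMSEQ_inverse_real_of_nat])
       (use le in \<open>auto intro!: always_eventually simp del: of_nat_Suc\<close>)
  then have "L2_tendsto (L2_measure T) (\<lambda>n t. t ^ 3 * P n t) f"
    using P(2) f by (simp add: L2_tendsto_def)
  then show ?thesis by (rule that[OF P(1)])
qed

subsection \<open>Solutions with square-integrable controls\<close>

lemma kernel_apply_measurable:
  fixes k :: "real \<Rightarrow> real \<Rightarrow> real"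
  assumes k: "(\<lambda>(x, s). k x s) \<in> borel_measurable (borel \<Otimes>\<^sub>M borel)" and b: "b \<in> borel_measurable borel"
  shows "(\<lambda>x. \<integral>s. k x s * b s \<partial>lborel) \<in> borel_measurable borel"
proof -
  have [measurable]: "(\<lambda>p. k (fst p) (snd p)) \<in> borel_measurable (borel \<Otimes>\<^sub>M lborel)" "b \<in> borel_measurable lborel"
    using k b by (simp_all add: split_beta' measurable_cong_sets[OF sets_pair_measure_cong[OF refl sets_lborel] refl])
  have "(\<lambda>(x, s). k x s * b s) \<in> borel_measurable (borel \<Otimes>\<^sub>M lborel)"
    by (simp add: split_beta')
  then show ?thesis
    by (rule lborel.borel_measurable_lebesgue_integral)
qed

lemma kernel_slice_measurable:
  fixes k :: "real \<Rightarrow> real \<Rightarrow> real"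
  assumes "(\<lambda>(x, s). k x s) \<in> borel_measurable (borel \<Otimes>\<^sub>M borel)"
  shows "k x \<in> borel_measurable borel" "(\<lambda>x. k x s) \<in> borel_measurable borel"
proof -
  have "(\<lambda>s. (x, s)) \<in> borel \<rightarrow>\<^sub>M borel \<Otimes>\<^sub>M borel" "(\<lambda>x. (x, s)) \<in> borel \<rightarrow>\<^sub>M borel \<Otimes>\<^sub>M borel"
    by measurable
  from this[THEN measurable_compose[OF _ assms]]
  show "k x \<in> borel_measurable borel" "(\<lambda>x. k x s) \<in> borel_measurable borel" by simp_all
qed

lemma kernel_apply_integrable:
  fixes k :: "real \<Rightarrow> real \<Rightarrow> real"
  assumes k: "(\<lambda>(x, s). k x s) \<in> borel_measurable (borel \<Otimes>\<^sub>M borel)" and C: "\<And>x s. \<bar>k x s\<bar> \<le> C"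
    and b: "integrable lborel b"
  shows "integrable lborel (\<lambda>s. k x s * b s)" "\<bar>\<integral>s. k x s * b s \<partial>lborel\<bar> \<le> C * (\<integral>s. \<bar>b s\<bar> \<partial>lborel)"
proof -
  note [measurable] = kernel_slice_measurable[OF k]
  have [measurable]: "b \<in> borel_measurable borel" using b by auto
  have le: "\<bar>k x s * b s\<bar> \<le> C * \<bar>b s\<bar>" for s
    unfolding abs_mult using C by (rule mult_right_mono) simp
  have i: "integrable lborel (\<lambda>s. C * \<bar>b s\<bar>)" using b by simp
  show *: "integrable lborel (\<lambda>s. k x s * b s)"
  proof (rule Bochner_Integration.integrable_bound[OF i])
    show "AE s in lborel. norm (k x s * b s) \<le> norm (C * \<bar>b s\<bar>)"
      by (intro AE_I2) (use le in \<open>auto intro: order_trans[OF _ abs_ge_self]\<close>)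
  qed measurable
  have "\<bar>\<integral>s. k x s * b s \<partial>lborel\<bar> \<le> (\<integral>s. \<bar>k x s * b s\<bar> \<partial>lborel)"
    by (rule integral_abs_bound)
  also have "\<dots> \<le> (\<integral>s. C * \<bar>b s\<bar> \<partial>lborel)"
    using * i le by (intro integral_mono) auto
  finally show "\<bar>\<integral>s. k x s * b s \<partial>lborel\<bar> \<le> C * (\<integral>s. \<bar>b s\<bar> \<partial>lborel)" by simp
qed

text \<open>With a bounded kernel the integrand is dominated by a multiple of the integrable product
  of \<open>a\<close> and \<open>b\<close>. This is how an integral operator is exchanged for its
  transpose.\<close>

lemma kernel_swap:
  fixes k :: "real \<Rightarrow> real \<Rightarrow> real"
  assumes k: "(\<lambda>(x, s). k x s) \<in> borel_measurable (borel \<Otimes>\<^sub>M borel)" and C: "\<And>x s. \<bar>k x s\<bar> \<le> C"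
    and a: "integrable lborel a" and b: "integrable lborel b"
  shows "(\<integral>x. a x * (\<integral>s. k x s * b s \<partial>lborel) \<partial>lborel) = (\<integral>s. b s * (\<integral>x. k x s * a x \<partial>lborel) \<partial>lborel)"
proof -
  have [measurable]: "(\<lambda>p. k (fst p) (snd p)) \<in> borel_measurable (lborel \<Otimes>\<^sub>M lborel)"
    using k by (simp add: split_beta' measurable_cong_sets[OF sets_pair_measure_cong[OF sets_lborel sets_lborel] refl])
  have [measurable]: "a \<in> borel_measurable lborel" "b \<in> borel_measurable lborel" using a b by auto
  have ab: "integrable (lborel \<Otimes>\<^sub>M lborel) (\<lambda>p. a (fst p) * b (snd p))"
  proof (rule lborel_pair.Fubini_integrable)
    show "integrable lborel (\<lambda>x. \<integral>y. norm (a (fst (x, y)) * b (snd (x, y))) \<partial>lborel)"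
      using a by (simp add: abs_mult)
    show "AE x in lborel. integrable lborel (\<lambda>y. a (fst (x, y)) * b (snd (x, y)))"
      using b by simp
  qed measurable
  have "integrable (lborel \<Otimes>\<^sub>M lborel) (\<lambda>p. a (fst p) * k (fst p) (snd p) * b (snd p))"
  proof (rule Bochner_Integration.integrable_bound)
    show "integrable (lborel \<Otimes>\<^sub>M lborel) (\<lambda>p. C * \<bar>a (fst p) * b (snd p)\<bar>)" using ab by simp
    have "\<bar>a x * k x s * b s\<bar> \<le> C * \<bar>a x * b s\<bar>" for x s
      using mult_right_mono[OF C[of x s], of "\<bar>a x * b s\<bar>"] by (simp add: abs_mult mult_ac)
    then show "AE p in lborel \<Otimes>\<^sub>M lborel. norm (a (fst p) * k (fst p) (snd p) * b (snd p)) \<le> norm (C * \<bar>a (fst p) * b (snd p)\<bar>)"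
      by (intro AE_I2) (auto intro: order_trans[OF _ abs_ge_self])
  qed measurable
  then have "integrable (lborel \<Otimes>\<^sub>M lborel) (\<lambda>(x, s). a x * k x s * b s)" by (simp add: split_beta')
  from lborel_pair.Fubini_integral[OF this]
  have F: "(\<integral>s. (\<integral>x. a x * k x s * b s \<partial>lborel) \<partial>lborel) = (\<integral>x. (\<integral>s. a x * k x s * b s \<partial>lborel) \<partial>lborel)" .
  have l: "(\<integral>x. a x * k x s * b s \<partial>lborel) = b s * (\<integral>x. k x s * a x \<partial>lborel)" for s
    by (subst integral_mult_right_zero[symmetric]) (simp add: mult_ac)
  have r: "(\<integral>s. a x * k x s * b s \<partial>lborel) = a x * (\<integral>s. k x s * b s \<partial>lborel)" for x
    by (subst integral_mult_right_zero[symmetric]) (simp add: mult_ac)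
  show ?thesis using F by (simp only: l r)
qed

section \<open>The representation formula for square-integrable controls\<close>

context goursat_kernel
begin

text \<open>The substitution \<open>y = t - x - s\<close> turns the convolution of \<open>W\<close>
  with the control into an integral against the control at time \<open>y\<close>.\<close>

definition delay_ker :: "real \<Rightarrow> real \<Rightarrow> real \<Rightarrow> real" where
  "delay_ker t x y = (if 0 \<le> x \<and> 0 \<le> y \<and> x + y \<le> t then W x (t - x - y) else 0)"

lemma delay_ker_measurable: "(\<lambda>(x, y). delay_ker t x y) \<in> borel_measurable (borel \<Otimes>\<^sub>M borel)"
proof -
  define D where "D = {p :: real \<times> real. 0 \<le> fst p \<and> 0 \<le> snd p \<and> fst p + snd p \<le> t}"
  have "closed D" unfolding D_def
    by (intro closed_Collect_conj closed_Collect_le continuous_intros)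
  moreover have "continuous_on D (\<lambda>p. W (fst p) (t - fst p - snd p))"
    by (rule continuous_on_compose2[OF W, of _ "\<lambda>p. (fst p, t - fst p - snd p)", unfolded split_beta fst_conv snd_conv])
       (auto intro!: continuous_intros simp: D_def)
  ultimately have "(\<lambda>p. indicator D p *\<^sub>R W (fst p) (t - fst p - snd p)) \<in> borel_measurable borel"
    by (intro borel_measurable_continuous_on_indicator) auto
  moreover have "indicator D p *\<^sub>R W (fst p) (t - fst p - snd p) = (\<lambda>(x, y). delay_ker t x y) p" for p
    by (cases p) (auto simp: D_def delay_ker_def indicator_def)
  ultimately show ?thesis by (simp add: borel_prod)
qed

lemma delay_ker_bound:
  obtains C where "C \<ge> 0" "\<And>t x y. t \<le> T \<Longrightarrow> \<bar>delay_ker t x y\<bar> \<le> C"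
proof -
  have "continuous_on ({0..T} \<times> {0..T}) (\<lambda>(x, e). W x e)"
    by (rule continuous_on_subset[OF W]) auto
  moreover have "compact ({0..T} \<times> {0..T})" by (intro compact_Times) auto
  ultimately obtain C where C: "C \<ge> 0" "\<And>z. z \<in> {0..T} \<times> {0..T} \<Longrightarrow> \<bar>(\<lambda>(x, e). W x e) z\<bar> \<le> C"
    using compact_continuous_bound by blast
  have "\<bar>delay_ker t x y\<bar> \<le> C" if "t \<le> T" for t x y
    using C(1) C(2)[of "(x, t - x - y)"] that by (auto simp: delay_ker_def)
  then show ?thesis using that C(1) by blast
qed

text \<open>The formula for classical solutions, read for a control that is only integrable. Since
  \<open>g\<close> vanishes off \<open>{0<..<T}\<close>, the first term is zero ahead of the wave
  front.\<close>

definition mild :: "(real \<Rightarrow> real) \<Rightarrow> real \<Rightarrow> real \<Rightarrow> real" where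
  "mild g x t = g (t - x) + (\<integral>y. delay_ker t x y * g y \<partial>lborel)"

lemma mild_diff:
  assumes "f \<in> L2_borel T" "g \<in> L2_borel T" "t \<le> T"
  shows "mild (\<lambda>y. f y - g y) x t = mild f x t - mild g x t"
proof -
  obtain C where C: "C \<ge> 0" "\<And>t x y. t \<le> T \<Longrightarrow> \<bar>delay_ker t x y\<bar> \<le> C"
    using delay_ker_bound by metis
  note i = kernel_apply_integrable(1)[OF delay_ker_measurable C(2)[OF assms(3)] L2_borel_integrable]
  show ?thesis
    using i[OF assms(1), of x] i[OF assms(2), of x] by (simp add: mild_def right_diff_distrib)
qed

lemma mild_measurable:
  assumes "g \<in> L2_borel T" shows "(\<lambda>x. mild g x t) \<in> borel_measurable borel"
proof -
  have [measurable]: "g \<in> borel_measurable borel" using assms by (rule L2_borelD)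
  have [measurable]: "(\<lambda>x. \<integral>y. delay_ker t x y * g y \<partial>lborel) \<in> borel_measurable borel"
    by (rule kernel_apply_measurable[OF delay_ker_measurable]) measurable
  show ?thesis unfolding mild_def by measurable
qed

lemma mild_L2:
  assumes T: "0 < T"
  obtains C where "C \<ge> 0" "\<And>g t. g \<in> L2_borel T \<Longrightarrow> t \<in> {0..T} \<Longrightarrow> (\<lambda>x. mild g x t) \<in> L2 (lebesgue_on {0<..})"
    "\<And>g t. g \<in> L2_borel T \<Longrightarrow> t \<in> {0..T} \<Longrightarrow>
      (\<integral>x. (mild g x t)\<^sup>2 \<partial>lebesgue_on {0<..}) \<le> C * (\<integral>x. (g x)\<^sup>2 \<partial>lborel)"
proof -
  obtain Cw where Cw: "Cw \<ge> 0" "\<And>t x y. t \<le> T \<Longrightarrow> \<bar>delay_ker t x y\<bar> \<le> Cw"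
    using delay_ker_bound by metis
  \<comment> \<open>In the integral term one factor \<open>T\<close> is the length of the support in
    \<open>x\<close>, the other comes from Cauchy--Schwarz; the 2 is that of
    \<open>sq_add_le\<close>.\<close>
  define C where "C = 2 + 2 * Cw\<^sup>2 * T\<^sup>2"
  have "(\<lambda>x. mild g x t) \<in> L2 (lebesgue_on {0<..}) \<and>
    (\<integral>x. (mild g x t)\<^sup>2 \<partial>lebesgue_on {0<..}) \<le> C * (\<integral>x. (g x)\<^sup>2 \<partial>lborel)"
    if g: "g \<in> L2_borel T" and t: "t \<in> {0..T}" for g t
  proof -
    note [measurable] = mild_measurable[OF g, of t]
    define h where "h = (\<lambda>x. indicator {0<..} x * (mild g x t)\<^sup>2)"
    have [measurable]: "h \<in> borel_measurable borel" unfolding h_def by measurable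
    define A where "A = Cw * (\<integral>y. \<bar>g y\<bar> \<partial>lborel)"
    define b where "b = (\<lambda>x. 2 * (g (t + (- 1) * x))\<^sup>2 + 2 * (A\<^sup>2 * indicator {0..T} x))"
    have le: "h x \<le> b x" for x
    proof (cases "0 < x")
      case True
      have "\<bar>\<integral>y. delay_ker t x y * g y \<partial>lborel\<bar> \<le> A * indicator {0..T} x"
      proof (cases "x \<le> T")
        case True
        then show ?thesis
          using kernel_apply_integrable(2)[OF delay_ker_measurable Cw(2) L2_borel_integrable[OF g], of t x] t \<open>0 < x\<close>
          by (simp add: A_def)
      next
        case False
        then have "delay_ker t x y = 0" for y using t by (auto simp: delay_ker_def)
        then show ?thesis using Cw(1) by (simp add: A_def)
      qed
      from power_mono[OF this, of 2]
      have "(\<integral>y. delay_ker t x y * g y \<partial>lborel)\<^sup>2 \<le> (A * indicator {0..T} x)\<^sup>2" by simp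
      moreover have "(A * indicator {0..T} x)\<^sup>2 = A\<^sup>2 * indicator {0..T} x"
        by (simp add: power_mult_distrib indicator_def)
      ultimately have "(\<integral>y. delay_ker t x y * g y \<partial>lborel)\<^sup>2 \<le> A\<^sup>2 * indicator {0..T} x" by simp
      moreover have "h x = (mild g x t)\<^sup>2" using True by (simp add: h_def)
      ultimately show ?thesis
        using sq_add_le[of "g (t - x)" "\<integral>y. delay_ker t x y * g y \<partial>lborel"]
        unfolding mild_def b_def by simp
    qed (simp add: h_def b_def)
    have gi: "integrable lborel (\<lambda>x. (g (t + (- 1) * x))\<^sup>2)"
      by (rule lborel_integrable_real_affine[OF L2_borelD(3)[OF g]]) simp
    have bi: "integrable lborel b"
      unfolding b_def using gi
      by (intro Bochner_Integration.integrable_add integrable_mult_right) (auto simp: integrable_indicator_iff emeasure_lborel_Icc_eq)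
    have h0: "0 \<le> h x" for x by (simp add: h_def)
    have hi: "integrable lborel h"
      by (rule Bochner_Integration.integrable_bound[OF bi]) (use le h0 in \<open>auto intro: order_trans[OF _ abs_ge_self]\<close>)
    have hz: "h x = 0" if "x \<notin> {0<..}" for x using that by (simp add: h_def)
    have S: "{0<..} \<in> sets (borel :: real measure)" by simp
    have hm: "h \<in> borel_measurable borel" by measurable
    have "integrable (lebesgue_on {0<..}) h"
      using hi lebesgue_on_borel(2)[OF hm S hz] by simp
    then have "integrable (lebesgue_on {0<..}) (\<lambda>x. (mild g x t)\<^sup>2)"
      by (rule Bochner_Integration.integrable_cong[THEN iffD1, rotated 2]) (auto simp: h_def)
    moreover have "(\<lambda>x. mild g x t) \<in> borel_measurable (lebesgue_on {0<..})"
      by (intro borel_measurable_lebesgue_on mild_measurable[OF g])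
    moreover have "(\<integral>x. (mild g x t)\<^sup>2 \<partial>lebesgue_on {0<..}) = (\<integral>x. h x \<partial>lebesgue_on {0<..})"
      by (rule Bochner_Integration.integral_cong) (auto simp: h_def)
    moreover have "\<dots> = (\<integral>x. h x \<partial>lborel)"
      by (rule lebesgue_on_borel(1)[OF hm S hz])
    moreover have "\<dots> \<le> (\<integral>x. b x \<partial>lborel)"
      using hi bi le by (intro integral_mono) auto
    moreover have "\<dots> = 2 * (\<integral>x. (g x)\<^sup>2 \<partial>lborel) + 2 * (A\<^sup>2 * T)"
    proof -
      have "(\<integral>x. (g (t + (- 1) * x))\<^sup>2 \<partial>lborel) = (\<integral>x. (g x)\<^sup>2 \<partial>lborel)"
        using lborel_integral_real_affine[of "- 1" "\<lambda>x. (g x)\<^sup>2" t] by simp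
      then show ?thesis unfolding b_def using gi T
        by (subst Bochner_Integration.integral_add)
           (auto simp: integrable_indicator_iff emeasure_lborel_Icc_eq intro!: integrable_mult_right)
    qed
    moreover have "A\<^sup>2 * T \<le> Cw\<^sup>2 * T\<^sup>2 * (\<integral>x. (g x)\<^sup>2 \<partial>lborel)"
    proof -
      have "A\<^sup>2 * T = Cw\<^sup>2 * T * (\<integral>y. \<bar>g y\<bar> \<partial>lborel)\<^sup>2" by (simp add: A_def power_mult_distrib)
      also have "\<dots> \<le> Cw\<^sup>2 * T * (T * (\<integral>x. (g x)\<^sup>2 \<partial>lborel))"
        using L2_borel_abs_integral[OF g T] T by (intro mult_left_mono) auto
      finally show ?thesis by (simp add: power2_eq_square mult_ac)
    qed
    ultimately show ?thesis by (simp add: L2_def C_def algebra_simps)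
  qed
  moreover have "C \<ge> 0" by (simp add: C_def)
  ultimately show ?thesis using that by blast
qed

text \<open>For \<open>0 < x\<close> and \<open>t \<le> T\<close> the delayed time
  \<open>t - x\<close> stays below \<open>T\<close>, so cutting the control off at \<open>T\<close>
  is not felt; at nonpositive times it vanishes anyway.\<close>

lemma classical_mild:
  assumes cs: "classical_solution q K T F u ux" and T: "0 < T"
  obtains g where "g \<in> L2_borel T" "\<And>y. y \<in> {0<..<T} \<Longrightarrow> g y = F y"
    "\<And>x t. 0 < x \<Longrightarrow> t \<in> {0..T} \<Longrightarrow> u x t = mild g x t"
proof -
  obtain gc where gc: "continuous_on UNIV gc" "\<And>t. t \<le> 0 \<Longrightarrow> gc t = 0" "\<And>t. t \<in> {0..T} \<Longrightarrow> gc t = F t"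
    and u: "\<And>x t. 0 \<le> x \<Longrightarrow> t \<in> {0..T} \<Longrightarrow> u x t = gc (t - x) + delay_conv T W gc x t"
    using that by (rule classical_representation[OF cs T])
  define g where "g = (\<lambda>y. indicator {0<..<T} y * gc y)"
  have gcm [measurable]: "gc \<in> borel_measurable borel" using gc(1) by (rule borel_measurable_continuous_onI)
  have gm [measurable]: "g \<in> borel_measurable borel" unfolding g_def by measurable
  obtain B where B: "\<And>y. y \<in> {0..T} \<Longrightarrow> \<bar>gc y\<bar> \<le> B"
    using compact_continuous_bound[OF continuous_on_subset[OF gc(1)], of "{0..T}"] by auto
  have "integrable lborel (\<lambda>y. (g y)\<^sup>2)"
  proof (rule Bochner_Integration.integrable_bound)
    show "integrable lborel (\<lambda>y. B\<^sup>2 * indicator {0..T} y)"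
      by (intro integrable_mult_right) (auto simp: integrable_indicator_iff emeasure_lborel_Icc_eq)
    have "(g y)\<^sup>2 \<le> B\<^sup>2 * indicator {0..T} y" for y
      using power_mono[OF B[of y], of 2] by (auto simp: g_def indicator_def)
    then show "AE y in lborel. norm ((g y)\<^sup>2) \<le> norm (B\<^sup>2 * indicator {0..T} y)"
      by (intro AE_I2) (auto intro: order_trans[OF _ abs_ge_self])
  qed measurable
  then have g: "g \<in> L2_borel T" using gm by (auto simp: L2_borel_def g_def)
  have "u x t = mild g x t" if x: "0 < x" and t: "t \<in> {0..T}" for x t
  proof -
    have 1: "gc (t - x) = g (t - x)" using x t gc(2) by (auto simp: g_def indicator_def)
    have 2: "delay_conv T W gc x t = (\<integral>y. delay_ker t x y * g y \<partial>lborel)"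
    proof (cases "t \<le> x")
      case True
      have "delay_conv T W gc x t = integral {0..T} (\<lambda>_. 0)"
        unfolding delay_conv_def using True gc(2) by (intro Henstock_Kurzweil_Integration.integral_cong) auto
      moreover have "(\<lambda>y. delay_ker t x y * g y) = (\<lambda>_. 0)"
        using True by (auto simp: delay_ker_def g_def indicator_def)
      ultimately show ?thesis by simp
    next
      case False
      define e where "e = t - x"
      have e: "0 < e" "e < T" using False x t by (auto simp: e_def)
      have Wc: "continuous_on {0..e} (\<lambda>y. W x (e - y))"
        using x by (intro continuous_on_compose2[OF continuous_on_slice(1)[OF W]] continuous_intros) auto
      have c: "continuous_on {0..e} (\<lambda>y. W x (e - y) * gc y)"
        by (intro continuous_intros Wc continuous_on_subset[OF gc(1)]) auto
      have "delay_conv T W gc x t = integral {0..T} (\<lambda>s. W x s * gc (e - s))"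
        by (simp add: delay_conv_def e_def)
      also have "\<dots> = integral {0..e} (\<lambda>s. W x s * gc (e - s))"
        using delay_conv_integrable(1)[OF W gc(1), of x T e] x e gc(2)
        by (intro integral_zero_tail[symmetric]) auto
      also have "\<dots> = integral {0..e} (\<lambda>y. W x (e - y) * gc y)"
        using integral_flip[of e "\<lambda>y. W x (e - y) * gc y"] by simp
      also have "\<dots> = (LINT y:{0..e}|lborel. W x (e - y) * gc y)"
        using set_borel_integral_eq_integral(2)[OF borel_integrable_atLeastAtMost'[OF c]] by simp
      also have "\<dots> = (\<integral>y. delay_ker t x y * g y \<partial>lborel)"
        unfolding set_lebesgue_integral_def using x e gc(2)[of 0]
        by (intro Bochner_Integration.integral_cong) (auto simp: delay_ker_def g_def e_def indicator_def)
      finally show ?thesis .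
    qed
    show ?thesis using u[of x t] x t 1 2 by (simp add: mild_def)
  qed
  moreover have "g y = F y" if "y \<in> {0<..<T}" for y using that gc(3) by (simp add: g_def)
  ultimately show ?thesis using that g by blast
qed

text \<open>The bound of \<open>mild_L2\<close>, applied to differences of controls, makes the map
  from control to state continuous, so convergence of the controls carries over.\<close>

lemma L2_tendsto_mild:
  assumes T: "0 < T" and FT: "L2_tendsto (L2_measure T) F f"
    and g: "g \<in> L2_borel T" "AE x in L2_measure T. f x = g x"
    and cs: "\<And>n. classical_solution q K T (F n) (U n) (Ux n)" and t: "t \<in> {0..T}"
  shows "L2_tendsto (lebesgue_on {0<..}) (\<lambda>n x. U n x t) (\<lambda>x. mild g x t)"
proof -
  obtain C where C: "C \<ge> 0" "\<And>g t. g \<in> L2_borel T \<Longrightarrow> t \<in> {0..T} \<Longrightarrow> (\<lambda>x. mild g x t) \<in> L2 (lebesgue_on {0<..})"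
    "\<And>g t. g \<in> L2_borel T \<Longrightarrow> t \<in> {0..T} \<Longrightarrow>
      (\<integral>x. (mild g x t)\<^sup>2 \<partial>lebesgue_on {0<..}) \<le> C * (\<integral>x. (g x)\<^sup>2 \<partial>lborel)"
    using that by (rule mild_L2[OF T])
  have "\<forall>n. \<exists>G. G \<in> L2_borel T \<and> (\<forall>y\<in>{0<..<T}. G y = F n y) \<and> (\<forall>x>0. \<forall>t\<in>{0..T}. U n x t = mild G x t)"
    by (rule allI, rule classical_mild[OF cs T]) blast
  from choice[OF this] obtain G where G: "\<And>n. G n \<in> L2_borel T" "\<And>n y. y \<in> {0<..<T} \<Longrightarrow> G n y = F n y"
    "\<And>n x t. 0 < x \<Longrightarrow> t \<in> {0..T} \<Longrightarrow> U n x t = mild (G n) x t" by blast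
  have sp: "space (lebesgue_on {0<..}) = {0::real<..}" by simp
  have eqL2: "(\<lambda>x. U n x t) \<in> L2 (lebesgue_on {0<..})" for n
  proof -
    have m: "(\<lambda>x. mild (G n) x t) \<in> L2 (lebesgue_on {0<..})" by (rule C(2)[OF G(1) t])
    have "(\<lambda>x. U n x t) \<in> borel_measurable (lebesgue_on {0<..})"
      using m G(3) t by (subst measurable_cong[of _ _ "\<lambda>x. mild (G n) x t"]) (auto simp: L2_def)
    moreover have "integrable (lebesgue_on {0<..}) (\<lambda>x. (U n x t)\<^sup>2)"
      using m G(3) t by (subst Bochner_Integration.integrable_cong[OF refl, of _ _ "\<lambda>x. (mild (G n) x t)\<^sup>2"]) (auto simp: L2_def)
    ultimately show ?thesis by (simp add: L2_def)
  qed
  have le: "(\<integral>x. (U n x t - mild g x t)\<^sup>2 \<partial>lebesgue_on {0<..}) \<le> C * (\<integral>x. (F n x - f x)\<^sup>2 \<partial>L2_measure T)" for n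
  proof -
    have d: "(\<lambda>y. G n y - g y) \<in> L2_borel T" by (rule L2_borel_diff[OF G(1) g(1)])
    have "(\<integral>x. (U n x t - mild g x t)\<^sup>2 \<partial>lebesgue_on {0<..}) = (\<integral>x. (mild (\<lambda>y. G n y - g y) x t)\<^sup>2 \<partial>lebesgue_on {0<..})"
      using G(3) t by (intro Bochner_Integration.integral_cong) (auto simp: mild_diff[OF G(1) g(1)])
    also have "\<dots> \<le> C * (\<integral>x. (G n x - g x)\<^sup>2 \<partial>lborel)" by (rule C(3)[OF d t])
    also have "(\<integral>x. (G n x - g x)\<^sup>2 \<partial>lborel) = (\<integral>x. (G n x - g x)\<^sup>2 \<partial>L2_measure T)"
      using L2_borel_integral(1)[OF d] by simp
    also have "\<dots> = (\<integral>x. (F n x - f x)\<^sup>2 \<partial>L2_measure T)"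
    proof (rule integral_cong_AE)
      show "(\<lambda>x. (G n x - g x)\<^sup>2) \<in> borel_measurable (L2_measure T)"
        using L2_borel_imp_L2[OF d] by (intro borel_measurable_power) (simp add: L2_def)
      have "(\<lambda>x. F n x - f x) \<in> L2 (L2_measure T)"
        using FT by (intro L2_diff) (auto simp: L2_tendsto_def)
      then show "(\<lambda>x. (F n x - f x)\<^sup>2) \<in> borel_measurable (L2_measure T)"
        by (intro borel_measurable_power) (simp add: L2_def)
      have "AE x in L2_measure T. x \<in> {0<..<T}" by (intro AE_I2) simp
      with g(2) show "AE x in L2_measure T. (G n x - g x)\<^sup>2 = (F n x - f x)\<^sup>2"
        by eventually_elim (simp add: G(2))
    qed
    finally show ?thesis .
  qed
  have "(\<lambda>n. C * (\<integral>x. (F n x - f x)\<^sup>2 \<partial>L2_measure T)) \<longlonglongrightarrow> C * 0"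
    using FT by (intro tendsto_intros) (simp add: L2_tendsto_def)
  then have lim: "(\<lambda>n. C * (\<integral>x. (F n x - f x)\<^sup>2 \<partial>L2_measure T)) \<longlonglongrightarrow> 0" by simp
  have "(\<lambda>n. \<integral>x. (U n x t - mild g x t)\<^sup>2 \<partial>lebesgue_on {0<..}) \<longlonglongrightarrow> 0"
    by (rule tendsto_sandwich[OF _ _ tendsto_const[of 0] lim]) (use le in \<open>auto intro!: always_eventually\<close>)
  then show ?thesis using eqL2 C(2)[OF g(1) t] by (simp add: L2_tendsto_def)
qed

text \<open>Density of the controls \<open>t ^ 3 * P n t\<close> supplies an approximating sequence,
  each member of which has an explicit classical solution.\<close>

lemma L2_solution_exists:
  assumes T: "0 < T" and f: "f \<in> L2 (L2_measure T)" and g: "g \<in> L2_borel T" "AE x in L2_measure T. f x = g x"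
  shows "L2_solution q K T f (mild g)"
proof -
  obtain P where P: "\<And>n. real_polynomial_function (P n)" "L2_tendsto (L2_measure T) (\<lambda>n t. t ^ 3 * P n t) f"
    using that by (rule L2_polynomial_density[OF f T])
  have "\<forall>n. \<exists>V. classical_solution q K T (\<lambda>t. t ^ 3 * P n t) (fst V) (snd V)"
  proof
    fix n
    obtain h h1 h2 where h: "\<And>t. (h has_real_derivative h1 t) (at t)" "\<And>t. (h1 has_real_derivative h2 t) (at t)"
      "continuous_on UNIV h2" "\<And>t. t \<le> 0 \<Longrightarrow> h t = 0" "\<And>t. t \<le> 0 \<Longrightarrow> h1 t = 0" "\<And>t. 0 \<le> t \<Longrightarrow> h t = t ^ 3 * P n t"
      using that by (rule polynomial_control[OF P(1)])
    interpret delayed_control q q1 K W h h1 h2 T by unfold_locales (use h T in auto)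
    show "\<exists>V. classical_solution q K T (\<lambda>t. t ^ 3 * P n t) (fst V) (snd V)"
      using classical_sol[of "\<lambda>t. t ^ 3 * P n t"] h(6) by (intro exI[of _ "(sol, sol_x)"]) simp
  qed
  from choice[OF this] obtain V where V: "\<And>n. classical_solution q K T (\<lambda>t. t ^ 3 * P n t) (fst (V n)) (snd (V n))" by blast
  show ?thesis
    unfolding L2_solution_def
  proof (intro exI conjI allI ballI)
    show "classical_solution q K T (\<lambda>t. t ^ 3 * P n t) (fst (V n)) (snd (V n))" for n by (rule V)
    show "L2_tendsto (L2_measure T) (\<lambda>n t. t ^ 3 * P n t) f" by (rule P(2))
    show "L2_tendsto (lebesgue_on {0<..}) (\<lambda>n x. fst (V n) x t) (\<lambda>x. mild g x t)" if "t \<in> {0..T}" for t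
      by (rule L2_tendsto_mild[OF T P(2) g V that])
  qed
qed

text \<open>Whatever approximating sequence defines \<open>u\<close>, its solutions also converge to
  \<open>mild g\<close>, and L_2 limits are unique.\<close>

lemma L2_solution_mild:
  assumes T: "0 < T" and u: "L2_solution q K T f u" and g: "g \<in> L2_borel T" "AE x in L2_measure T. f x = g x"
    and t: "t \<in> {0..T}"
  shows "AE x in lebesgue_on {0<..}. u x t = mild g x t"
proof -
  obtain F U Ux where F: "\<And>n. classical_solution q K T (F n) (U n) (Ux n)" "L2_tendsto (L2_measure T) F f"
    "\<And>t. t \<in> {0..T} \<Longrightarrow> L2_tendsto (lebesgue_on {0<..}) (\<lambda>n x. U n x t) (\<lambda>x. u x t)"
    using u unfolding L2_solution_def by blast
  show ?thesis
    by (rule L2_tendsto_unique[OF F(3)[OF t] L2_tendsto_mild[OF T F(2) g F(1) t]])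
qed

end

subsection \<open>The control operator and the connecting kernel\<close>

lemma L2_mult_integrable:
  assumes "f \<in> L2 M" "g \<in> L2 M" shows "integrable M (\<lambda>x. f x * g x)"
proof (rule Bochner_Integration.integrable_bound)
  show "integrable M (\<lambda>x. (f x)\<^sup>2 + (g x)\<^sup>2)" using assms by (auto simp: L2_def)
  show "(\<lambda>x. f x * g x) \<in> borel_measurable M" using assms by (intro borel_measurable_times) (auto simp: L2_def)
  have "\<bar>f x * g x\<bar> \<le> (f x)\<^sup>2 + (g x)\<^sup>2" for x
    using zero_le_power2[of "\<bar>f x\<bar> - \<bar>g x\<bar>"] mult_nonneg_nonneg[OF abs_ge_zero abs_ge_zero, of "f x" "g x"]
    unfolding power2_diff abs_mult power2_abs by linarith
  then show "AE x in M. norm (f x * g x) \<le> norm ((f x)\<^sup>2 + (g x)\<^sup>2)"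
    by (intro AE_I2) (auto intro: order_trans[OF _ abs_ge_self])
qed

lemma integrable_mult_bounded:
  fixes f b :: "real \<Rightarrow> real"
  assumes "integrable lborel f" "b \<in> borel_measurable borel" "\<And>x. \<bar>b x\<bar> \<le> B"
  shows "integrable lborel (\<lambda>x. b x * f x)"
proof (rule Bochner_Integration.integrable_bound)
  show "integrable lborel (\<lambda>x. B * \<bar>f x\<bar>)" using assms(1) by simp
  show "(\<lambda>x. b x * f x) \<in> borel_measurable lborel" using assms by (intro borel_measurable_times) auto
  have "\<bar>b x * f x\<bar> \<le> B * \<bar>f x\<bar>" for x
    unfolding abs_mult using assms(3) by (rule mult_right_mono) simp
  then show "AE x in lborel. norm (b x * f x) \<le> norm (B * \<bar>f x\<bar>)"
    by (intro AE_I2) (auto intro: order_trans[OF _ abs_ge_self])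
qed

lemma L2_borel_bounded:
  assumes g: "g \<in> borel_measurable borel" and z: "\<And>x. x \<notin> {0<..<T} \<Longrightarrow> g x = 0" and B: "\<And>x. \<bar>g x\<bar> \<le> B"
  shows "g \<in> L2_borel T"
proof -
  have "integrable lborel (\<lambda>x. indicator {0..T} x :: real)"
    by (auto simp: integrable_indicator_iff emeasure_lborel_Icc_eq)
  then have "integrable lborel (\<lambda>x. (g x)\<^sup>2 * indicator {0..T} x)"
  proof (rule integrable_mult_bounded)
    show "(\<lambda>x. (g x)\<^sup>2) \<in> borel_measurable borel" using g by (rule borel_measurable_power)
    show "\<bar>(g x)\<^sup>2\<bar> \<le> B\<^sup>2" for x using power_mono[OF B, of x 2] by simp
  qed
  moreover have "(\<lambda>x. (g x)\<^sup>2 * indicator {0..T} x) = (\<lambda>x. (g x)\<^sup>2)"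
  proof
    fix x show "(g x)\<^sup>2 * indicator {0..T} x = (g x)\<^sup>2"
      using z[of x] by (cases "x \<in> {0..T}") auto
  qed
  ultimately show ?thesis using g z by (auto simp: L2_borel_def)
qed

lemma continuous_L2_borel:
  fixes f :: "real \<Rightarrow> real"
  assumes f: "continuous_on {0..T} f"
  shows "(\<lambda>x. indicator {0<..<T} x * f x) \<in> L2_borel T"
proof -
  obtain B where B: "B \<ge> 0" "\<And>x. x \<in> {0..T} \<Longrightarrow> \<bar>f x\<bar> \<le> B"
    using compact_continuous_bound[OF f] by auto
  have "(\<lambda>x. indicator {0<..<T} x *\<^sub>R f x) \<in> borel_measurable borel"
    by (rule borel_measurable_continuous_on_indicator[OF _ continuous_on_subset[OF f]]) auto
  then show ?thesis
    using B by (intro L2_borel_bounded[of _ _ B]) (auto simp: indicator_def)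
qed

lemma integral_L2_measure_continuous:
  fixes f :: "real \<Rightarrow> real"
  assumes f: "continuous_on {0..T} f"
  shows "(\<integral>x. f x \<partial>L2_measure T) = integral {0..T} f"
proof -
  note L = continuous_L2_borel[OF f]
  have "(\<integral>x. f x \<partial>L2_measure T) = (\<integral>x. indicator {0<..<T} x * f x \<partial>L2_measure T)"
    by (intro Bochner_Integration.integral_cong) auto
  also have "\<dots> = (\<integral>x. indicator {0<..<T} x * f x \<partial>lborel)"
    by (rule L2_borel_integral(2)[OF L])
  also have "\<dots> = (LINT x:{0..T}|lborel. f x)"
    unfolding set_lebesgue_integral_def
  proof (rule integral_cong_AE)
    have "AE x in lborel. x \<noteq> (0::real)" "AE x in lborel. x \<noteq> T" by (rule AE_lborel_singleton)+
    then show "AE x in lborel. indicator {0<..<T} x * f x = indicator {0..T} x *\<^sub>R f x"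
      by eventually_elim (auto simp: indicator_def)
    show "(\<lambda>x. indicator {0<..<T} x * f x) \<in> borel_measurable lborel" using L2_borelD(1)[OF L] by simp
    show "(\<lambda>x. indicator {0..T} x *\<^sub>R f x) \<in> borel_measurable lborel"
      using borel_integrable_atLeastAtMost'[OF f] by (simp add: set_integrable_def borel_measurable_integrable)
  qed
  also have "\<dots> = integral {0..T} f"
    by (rule set_borel_integral_eq_integral(2)[OF borel_integrable_atLeastAtMost'[OF f]])
  finally show ?thesis .
qed

lemma L2_borel_J:
  assumes g: "g \<in> L2_borel T" shows "J T g \<in> L2_borel T"
proof -
  have [measurable]: "g \<in> borel_measurable borel" using g by (rule L2_borelD)
  have "(\<lambda>t. g (T - t)) \<in> borel_measurable borel" by measurable
  moreover have "integrable lborel (\<lambda>t. (g (T + (- 1) * t))\<^sup>2)"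
    by (rule lborel_integrable_real_affine[OF L2_borelD(3)[OF g]]) simp
  ultimately show ?thesis using L2_borelD(2)[OF g] by (auto simp: L2_borel_def J_def)
qed

lemma AE_L2_measure_reflect:
  assumes "AE x in L2_measure T. P x" shows "AE x in L2_measure T. P (T - x)"
  using AE_lborel_reflect[of "\<lambda>x. x \<in> {0<..<T} \<longrightarrow> P x" T] assms
  by (auto simp: AE_lebesgue_on elim!: eventually_mono)

lemma L2_cong_AE:
  assumes g: "g \<in> L2 M" and ae: "AE x in M. f x = g x" and f: "f \<in> borel_measurable M"
  shows "f \<in> L2 M"
proof -
  have "integrable M (\<lambda>x. (f x)\<^sup>2)"
  proof (rule integrable_cong_AE_imp)
    show "integrable M (\<lambda>x. (g x)\<^sup>2)" using g by (simp add: L2_def)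
    show "AE x in M. (g x)\<^sup>2 = (f x)\<^sup>2" using ae by eventually_elim simp
    show "(\<lambda>x. (f x)\<^sup>2) \<in> borel_measurable M" using f by (rule borel_measurable_power)
  qed
  then show ?thesis using f by (simp add: L2_def)
qed

text \<open>Measurability of \<open>f\<close> comes from completeness of Lebesgue measure: changing
  a measurable function on a negligible set keeps it measurable.\<close>

lemma L2_measure_cong_AE:
  assumes g: "g \<in> L2 (L2_measure T)" and ae: "AE x in L2_measure T. f x = g x"
  shows "f \<in> L2 (L2_measure T)"
proof -
  have gm: "g \<in> borel_measurable (lebesgue_on {0<..<T})" using g by (simp add: L2_def)
  have S: "{0<..<T} \<in> sets lebesgue" by simp
  have "AE x in lebesgue. x \<in> {0<..<T} \<longrightarrow> g x = f x"
    using ae by (auto simp: AE_restrict_space_iff elim!: eventually_mono)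
  then obtain N where N: "negligible N" "\<And>x. x \<notin> N \<Longrightarrow> x \<in> {0<..<T} \<Longrightarrow> g x = f x"
    unfolding eventually_ae_filter_negligible by blast
  have "f \<in> borel_measurable (lebesgue_on {0<..<T})"
    by (rule measurable_on_imp_borel_measurable_lebesgue[OF measurable_on_spike[OF _ N(1), of g] S])
       (use N(2) gm in \<open>auto simp: measurable_on_iff_borel_measurable[OF S]\<close>)
  then show ?thesis by (rule L2_cong_AE[OF g ae])
qed

lemma L2_J:
  assumes f: "f \<in> L2 (L2_measure T)" shows "J T f \<in> L2 (L2_measure T)"
proof -
  obtain g where g: "g \<in> L2_borel T" "AE x in L2_measure T. f x = g x"
    using that by (rule L2_borel_rep[OF f])
  show ?thesis
    by (rule L2_measure_cong_AE[OF L2_borel_imp_L2[OF L2_borel_J[OF g(1)]]])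
       (use AE_L2_measure_reflect[OF g(2)] in \<open>simp add: J_def\<close>)
qed

section \<open>The operator \<open>I + M\<close> on \<open>(0, T)\<close> and the kernel of its Gram
  operator\<close>

locale control_horizon = goursat_kernel +
  fixes T :: real
  assumes T: "0 < T"
begin

text \<open>With these, \<open>W\<^sup>T = (I + M) J\<^sub>T\<close> and \<open>C\<^sub>T = M + M' + M' M\<close> has the kernel \<open>conn_ker\<close>.\<close>

definition k :: "real \<Rightarrow> real \<Rightarrow> real" where
  "k x s = delay_ker T x (T - s)"

lemma k_eq: "k x s = (if 0 \<le> x \<and> x \<le> s \<and> s \<le> T then W x (s - x) else 0)"
  by (auto simp: k_def delay_ker_def)

lemma k_measurable: "(\<lambda>(x, s). k x s) \<in> borel_measurable (borel \<Otimes>\<^sub>M borel)"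
proof -
  have "(\<lambda>p. (fst p, T - snd p)) \<in> (borel \<Otimes>\<^sub>M borel) \<rightarrow>\<^sub>M (borel \<Otimes>\<^sub>M borel :: (real \<times> real) measure)"
    by measurable
  from measurable_compose[OF this delay_ker_measurable[of T]] show ?thesis
    by (simp add: k_def split_beta')
qed

lemma k_transpose_measurable: "(\<lambda>(s, x). k x s) \<in> borel_measurable (borel \<Otimes>\<^sub>M borel)"
proof -
  have "(\<lambda>p. (snd p, fst p)) \<in> (borel \<Otimes>\<^sub>M borel) \<rightarrow>\<^sub>M (borel \<Otimes>\<^sub>M borel :: (real \<times> real) measure)"
    by measurable
  from measurable_compose[OF this k_measurable] show ?thesis
    by (simp add: split_beta')
qed

text \<open>Fixing one bound by choice allows the collections \<open>k_apply\<close>,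
  \<open>k_transpose_apply\<close> and \<open>k_swap\<close> to be instantiated once for the whole
  locale.\<close>

definition k_sup :: real where "k_sup = (SOME C. C \<ge> 0 \<and> (\<forall>x s. \<bar>k x s\<bar> \<le> C))"

lemma k_sup: "k_sup \<ge> 0" "\<bar>k x s\<bar> \<le> k_sup"
proof -
  have "\<exists>C. C \<ge> 0 \<and> (\<forall>x s. \<bar>k x s\<bar> \<le> C)"
    by (rule delay_ker_bound[of T]) (auto simp: k_def)
  then have "k_sup \<ge> 0 \<and> (\<forall>x s. \<bar>k x s\<bar> \<le> k_sup)"
    unfolding k_sup_def by (rule someI_ex)
  then show "k_sup \<ge> 0" "\<bar>k x s\<bar> \<le> k_sup" by auto
qed

lemmas k_apply = kernel_apply_measurable[OF k_measurable] kernel_apply_integrable[OF k_measurable k_sup(2)]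
lemmas k_transpose_apply =
  kernel_apply_measurable[OF k_transpose_measurable] kernel_apply_integrable[OF k_transpose_measurable k_sup(2)]
lemmas k_swap = kernel_swap[OF k_measurable k_sup(2)]

lemma k_column_integrable: "integrable lborel (\<lambda>x. k x s)"
proof -
  have "integrable lborel (\<lambda>x. indicator {0..T} x :: real)"
    by (auto simp: integrable_indicator_iff emeasure_lborel_Icc_eq)
  then have "integrable lborel (\<lambda>x. k x s * indicator {0..T} x)"
    by (rule integrable_mult_bounded) (use kernel_slice_measurable(2)[OF k_measurable] k_sup in auto)
  moreover have "(\<lambda>x. k x s * indicator {0..T} x) = (\<lambda>x. k x s)"
    by (auto simp: k_eq indicator_def)
  ultimately show ?thesis by simp
qed

definition M :: "(real \<Rightarrow> real) \<Rightarrow> real \<Rightarrow> real" where "M f x = (\<integral>s. k x s * f s \<partial>lborel)"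

definition M' :: "(real \<Rightarrow> real) \<Rightarrow> real \<Rightarrow> real" where "M' f s = (\<integral>x. k x s * f x \<partial>lborel)"

definition V :: "(real \<Rightarrow> real) \<Rightarrow> real \<Rightarrow> real" where "V f x = f x + M f x"

lemma M_L2: assumes f: "f \<in> L2_borel T" shows "M f \<in> L2_borel T"
proof (rule L2_borel_bounded)
  show "M f \<in> borel_measurable borel"
    unfolding M_def using L2_borelD(1)[OF f] by (rule k_apply(1))
  show "\<bar>M f x\<bar> \<le> k_sup * (\<integral>s. \<bar>f s\<bar> \<partial>lborel)" for x
    unfolding M_def by (rule k_apply(3)[OF L2_borel_integrable[OF f]])
  fix x assume x: "x \<notin> {0<..<T}"
  have "(\<lambda>s. k x s * f s) = (\<lambda>_. 0)"
  proof
    fix s show "k x s * f s = 0"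
      using x L2_borelD(2)[OF f, of s] W_0[of s] by (cases "x = 0") (auto simp: k_eq)
  qed
  then show "M f x = 0" by (simp add: M_def)
qed

lemma V_L2: assumes f: "f \<in> L2_borel T" shows "V f \<in> L2_borel T"
proof -
  have "(\<lambda>x. 0 - M f x) \<in> L2_borel T"
    using L2_borel_diff[OF L2_borel_bounded[of "\<lambda>_. 0" T 0] M_L2[OF f]] by simp
  from L2_borel_diff[OF f this] show ?thesis by (simp add: V_def[abs_def])
qed

lemma M_diff:
  assumes "integrable lborel f" "integrable lborel g"
  shows "M (\<lambda>x. f x - g x) x = M f x - M g x"
  using k_apply(2)[OF assms(1), of x] k_apply(2)[OF assms(2), of x] by (simp add: M_def right_diff_distrib)

lemma mild_eq_V: "mild g x T = V (J T g) x"
proof -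
  have "(\<integral>y. delay_ker T x y * g y \<partial>lborel) = (\<integral>s. k x s * g (T - s) \<partial>lborel)"
    using lborel_integral_real_affine[of "- 1" "\<lambda>y. delay_ker T x y * g y" T] by (simp add: k_def)
  then show ?thesis by (simp add: mild_def V_def M_def J_def)
qed

text \<open>The kernels of \<open>M\<close> and \<open>M'\<close> live on opposite sides of the
  diagonal. Gluing them by \<open>min\<close> and \<open>max\<close> instead of adding them avoids
  doubling on the diagonal and keeps the kernel continuous.\<close>

definition conn_ker :: "real \<Rightarrow> real \<Rightarrow> real" where
  "conn_ker s y = k (min s y) (max s y) + (\<integral>x. k x s * k x y \<partial>lborel)"

text \<open>This is the factorisation \<open>I + C_T = (I + M') (I + M)\<close>. It is stated for
  integrable \<open>f\<close> because it is also applied to columns of Gelfand--Levitan solutions,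
  cut off to a closed interval.\<close>

lemma conn_ker_apply:
  assumes f: "integrable lborel f"
  shows "f s + (\<integral>y. conn_ker s y * f y \<partial>lborel) = V f s + M' (V f) s"
    "integrable lborel (\<lambda>y. conn_ker s y * f y)"
proof -
  define G where "G = (\<lambda>y. \<integral>x. k x y * k x s \<partial>lborel)"
  have Gm: "G \<in> borel_measurable borel"
    unfolding G_def by (rule k_transpose_apply(1)) (rule kernel_slice_measurable(2)[OF k_measurable])
  have Gb: "\<bar>G y\<bar> \<le> k_sup * (\<integral>x. \<bar>k x s\<bar> \<partial>lborel)" for y
    unfolding G_def by (rule k_transpose_apply(3)[OF k_column_integrable])
  have fm: "f \<in> borel_measurable borel" using f by auto
  have i: "integrable lborel (\<lambda>y. k s y * f y)" "integrable lborel (\<lambda>y. k y s * f y)" "integrable lborel (\<lambda>y. G y * f y)"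
    by (rule k_apply(2)[OF f], rule k_transpose_apply(2)[OF f], rule integrable_mult_bounded[OF f Gm Gb])
  have i3: "integrable lborel (\<lambda>y. k s y * f y + k y s * f y + G y * f y)"
    using i by (intro Bochner_Integration.integrable_add)
  \<comment> \<open>Only at the single point \<open>y = s\<close> does the glued kernel differ from
    the sum of the two.\<close>
  have ae: "AE y in lborel. k s y * f y + k y s * f y + G y * f y = conn_ker s y * f y"
    using AE_lborel_singleton[of s]
  proof eventually_elim
    case (elim y)
    then have "k (min s y) (max s y) = k s y + k y s" by (auto simp: k_eq min_def max_def)
    then show ?case by (simp add: conn_ker_def G_def algebra_simps)
  qed
  have cm: "(\<lambda>y. conn_ker s y * f y) \<in> borel_measurable lborel"
  proof -
    have [measurable]: "(\<lambda>y. k s y) \<in> borel_measurable borel" "(\<lambda>y. k y s) \<in> borel_measurable borel"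
      using kernel_slice_measurable[OF k_measurable] by auto
    have "(\<lambda>y. k (min s y) (max s y)) = (\<lambda>y. if y \<le> s then k y s else k s y)" by (auto simp: min_def max_def)
    then have [measurable]: "(\<lambda>y. k (min s y) (max s y)) \<in> borel_measurable borel" by simp
    note [measurable] = Gm fm
    have "(\<lambda>y. (k (min s y) (max s y) + G y) * f y) \<in> borel_measurable borel" by measurable
    then show ?thesis by (simp add: conn_ker_def G_def mult.commute)
  qed
  show "integrable lborel (\<lambda>y. conn_ker s y * f y)"
    by (rule integrable_cong_AE_imp[OF i3 cm ae])
  have "(\<integral>y. conn_ker s y * f y \<partial>lborel) = (\<integral>y. k s y * f y + k y s * f y + G y * f y \<partial>lborel)"
    by (rule integral_cong_AE[OF cm borel_measurable_integrable[OF i3]]) (use ae in \<open>eventually_elim, simp\<close>)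
  also have "\<dots> = M f s + M' f s + (\<integral>y. f y * G y \<partial>lborel)"
    using i by (simp add: M_def M'_def mult.commute)
  also have "(\<integral>y. f y * G y \<partial>lborel) = (\<integral>x. k x s * M f x \<partial>lborel)"
    using k_swap[OF k_column_integrable f, of s] by (simp add: G_def M_def)
  finally have 1: "(\<integral>y. conn_ker s y * f y \<partial>lborel) = M f s + M' f s + M' (M f) s" by (simp add: M'_def)
  have "integrable lborel (M f)"
  proof -
    have "integrable lborel (\<lambda>x. M f x * indicator {0..T} x)"
      by (rule integrable_mult_bounded[where B = "k_sup * (\<integral>s. \<bar>f s\<bar> \<partial>lborel)"])
         (use k_apply(1)[OF fm] k_apply(3)[OF f] in \<open>auto simp: integrable_indicator_iff emeasure_lborel_Icc_eq M_def\<close>)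
    moreover have "(\<lambda>x. M f x * indicator {0..T} x) = M f"
    proof
      fix x show "M f x * indicator {0..T} x = M f x"
      proof (cases "x \<in> {0..T}")
        case False
        then have "(\<lambda>s. k x s * f s) = (\<lambda>_. 0)" by (auto simp: k_eq)
        then have "M f x = 0" by (simp add: M_def)
        then show ?thesis by simp
      qed simp
    qed
    ultimately show ?thesis by simp
  qed
  from k_transpose_apply(2)[OF this, of s] i(2)
  have "M' (V f) s = M' f s + M' (M f) s"
    by (simp add: M'_def V_def distrib_left)
  with 1 show "f s + (\<integral>y. conn_ker s y * f y \<partial>lborel) = V f s + M' (V f) s"
    by (simp add: V_def)
qed

lemma V_inner:
  assumes f: "f \<in> L2_borel T" and g: "g \<in> L2_borel T"
  shows "(\<integral>x. V f x * V g x \<partial>lborel) = (\<integral>s. (f s + (\<integral>y. conn_ker s y * f y \<partial>lborel)) * g s \<partial>lborel)"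
proof -
  have L2: "h \<in> L2 lborel" if "h \<in> L2_borel T" for h using that by (auto simp: L2_borel_def L2_def)
  have i: "integrable lborel (\<lambda>x. V f x * g x)" "integrable lborel (\<lambda>x. V f x * M g x)"
    by (intro L2_mult_integrable L2 V_L2 M_L2 f g)+
  have i2: "integrable lborel (\<lambda>s. M' (V f) s * g s)"
    unfolding M'_def
    by (rule integrable_mult_bounded[OF L2_borel_integrable[OF g] k_transpose_apply(1)[OF L2_borelD(1)[OF V_L2[OF f]]]
          k_transpose_apply(3)[OF L2_borel_integrable[OF V_L2[OF f]]]])
  have "(\<integral>x. V f x * V g x \<partial>lborel) = (\<integral>x. V f x * g x \<partial>lborel) + (\<integral>x. V f x * M g x \<partial>lborel)"
    using i by (simp add: V_def[of g] distrib_left)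
  also have "(\<integral>x. V f x * M g x \<partial>lborel) = (\<integral>s. M' (V f) s * g s \<partial>lborel)"
    using k_swap[OF L2_borel_integrable[OF V_L2[OF f]] L2_borel_integrable[OF g]]
    by (simp add: M_def M'_def mult.commute)
  also have "(\<integral>x. V f x * g x \<partial>lborel) + (\<integral>s. M' (V f) s * g s \<partial>lborel) = (\<integral>s. (V f s + M' (V f) s) * g s \<partial>lborel)"
    using i i2 by (simp add: distrib_right)
  finally show ?thesis
    using conn_ker_apply(1)[OF L2_borel_integrable[OF f]] by simp
qed

lemma conn_ker_continuous: "continuous_on ({0..T} \<times> {0..T}) (\<lambda>(s, y). conn_ker s y)"
proof -
  let ?S = "{0..T} \<times> {0..T}"
  have mm: "continuous_on UNIV (\<lambda>p :: real \<times> real. min (fst p) (snd p))" "continuous_on UNIV (\<lambda>p :: real \<times> real. max (fst p) (snd p))"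
    by (intro continuous_intros)+
  have c1: "continuous_on ?S (\<lambda>p. W (min (fst p) (snd p)) (max (fst p) (snd p) - min (fst p) (snd p)))"
    by (rule continuous_on_compose2[OF W, of _ "\<lambda>p. (min (fst p) (snd p), max (fst p) (snd p) - min (fst p) (snd p))",
          unfolded split_beta fst_conv snd_conv])
       (auto intro!: continuous_intros continuous_on_subset[OF mm(1)] continuous_on_subset[OF mm(2)])
  have c2: "continuous_on ?S (\<lambda>p. integral {0..min (fst p) (snd p)} (\<lambda>x. W x (fst p - x) * W x (snd p - x)))"
  proof (rule continuous_on_integral_upto[where G = "\<lambda>p x. W x (fst p - x) * W x (snd p - x)" and m = "\<lambda>p. min (fst p) (snd p)"])
    show "continuous_on {(p, r). p \<in> ?S \<and> 0 \<le> r \<and> r \<le> min (fst p) (snd p)} (\<lambda>(p, r). W r (fst p - r) * W r (snd p - r))"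
      unfolding split_beta
      by (intro continuous_intros
          continuous_on_compose2[OF W, of _ "\<lambda>z. (snd z, fst (fst z) - snd z)", unfolded split_beta fst_conv snd_conv]
          continuous_on_compose2[OF W, of _ "\<lambda>z. (snd z, snd (fst z) - snd z)", unfolded split_beta fst_conv snd_conv])
         (auto intro!: continuous_intros)
  qed (auto intro!: continuous_on_subset[OF mm(1)])
  \<comment> \<open>The product \<open>k x s * k x y\<close> vanishes unless \<open>x\<close> is
    below both arguments, so the integral ends at \<open>min s y\<close> and depends continuously on
    its limit.\<close>
  have eq: "conn_ker s y = W (min s y) (max s y - min s y) + integral {0..min s y} (\<lambda>x. W x (s - x) * W x (y - x))"
    if "(s, y) \<in> ?S" for s y
  proof -
    have Wc: "continuous_on {0..min s y} (\<lambda>x. W x (a - x))" if "min s y \<le> a" for a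
      by (rule continuous_on_compose2[OF W, of _ "\<lambda>x. (x, a - x)", unfolded split_beta fst_conv snd_conv])
         (use that in \<open>auto intro!: continuous_intros\<close>)
    have c: "continuous_on {0..min s y} (\<lambda>x. W x (s - x) * W x (y - x))"
      by (intro continuous_on_mult Wc) auto
    have "(\<integral>x. k x s * k x y \<partial>lborel) = (LINT x:{0..min s y}|lborel. W x (s - x) * W x (y - x))"
      unfolding set_lebesgue_integral_def using that
      by (intro Bochner_Integration.integral_cong) (auto simp: k_eq indicator_def)
    also have "\<dots> = integral {0..min s y} (\<lambda>x. W x (s - x) * W x (y - x))"
      by (rule set_borel_integral_eq_integral(2)[OF borel_integrable_atLeastAtMost'[OF c]])
    finally show ?thesis using that by (simp add: conn_ker_def k_eq)
  qed
  have "continuous_on ?S (\<lambda>p. W (min (fst p) (snd p)) (max (fst p) (snd p) - min (fst p) (snd p))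
      + integral {0..min (fst p) (snd p)} (\<lambda>x. W x (fst p - x) * W x (snd p - x)))"
    by (intro continuous_intros c1 c2)
  then show ?thesis
    by (rule continuous_on_eq) (auto simp: eq)
qed

end

section \<open>Identification of the connecting operator and of its kernel\<close>

context control_horizon
begin

lemma L2_solution_V:
  assumes u: "L2_solution q K T f u" and g: "g \<in> L2_borel T" "AE x in L2_measure T. f x = g x"
  shows "AE x in L2_measure T. u x T = V (J T g) x"
proof -
  have "AE x in lebesgue_on {0<..}. u x T = mild g x T"
    by (rule L2_solution_mild[OF T u g]) (use T in auto)
  then have "AE x in lborel. x \<in> {0<..} \<longrightarrow> u x T = mild g x T"
    by (subst (asm) AE_lebesgue_on) auto
  then show ?thesis
    by (subst AE_lebesgue_on) (auto simp: mild_eq_V elim!: eventually_mono)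
qed

lemma conn_ker_apply_L2:
  assumes c: "\<And>t s. t \<in> {0..T} \<Longrightarrow> s \<in> {0..T} \<Longrightarrow> c t s = conn_ker t s"
    and g: "g \<in> L2_borel T" and fg: "AE x in L2_measure T. f x = g x" and t: "t \<in> {0..T}"
  shows "(\<integral>s. c t s * f s \<partial>L2_measure T) = (\<integral>s. conn_ker t s * g s \<partial>lborel)"
proof -
  let ?h = "\<lambda>s. conn_ker t s * g s"
  have i: "integrable lborel ?h" by (rule conn_ker_apply(2)[OF L2_borel_integrable[OF g]])
  have hm: "?h \<in> borel_measurable borel" using borel_measurable_integrable[OF i] by simp
  have S: "{0<..<T} \<in> sets borel" by simp
  have hz: "?h s = 0" if "s \<notin> {0<..<T}" for s using L2_borelD(2)[OF g that] by simp
  have i': "integrable (L2_measure T) ?h" using i lebesgue_on_borel(2)[OF hm S hz] by simp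
  have "AE s in L2_measure T. s \<in> {0<..<T}" by (intro AE_I2) simp
  with fg have ae: "AE s in L2_measure T. ?h s = c t s * f s"
    by eventually_elim (use c t in auto)
  have cont: "continuous_on {0..T} (conn_ker t)"
    using continuous_on_slice(1)[OF conn_ker_continuous t] .
  have "(\<lambda>s. c t s * f s) \<in> borel_measurable (L2_measure T)"
  proof -
    have "f \<in> L2 (L2_measure T)" by (rule L2_measure_cong_AE[OF L2_borel_imp_L2[OF g] fg])
    moreover have "c t \<in> borel_measurable (L2_measure T)"
    proof -
      have "(\<lambda>s. indicator {0<..<T} s * conn_ker t s) \<in> borel_measurable (L2_measure T)"
        using L2_borelD(1)[OF continuous_L2_borel[OF cont]] by (rule borel_measurable_lebesgue_on)
      then show ?thesis
        by (rule measurable_cong[THEN iffD1, rotated]) (use c t in auto)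
    qed
    ultimately show ?thesis by (intro borel_measurable_times) (auto simp: L2_def)
  qed
  then have "(\<integral>s. c t s * f s \<partial>L2_measure T) = (\<integral>s. ?h s \<partial>L2_measure T)"
    by (rule integral_cong_AE[OF _ borel_measurable_integrable[OF i']]) (use ae in \<open>eventually_elim, simp\<close>)
  also have "\<dots> = (\<integral>s. ?h s \<partial>lborel)" by (rule lebesgue_on_borel(1)[OF hm S hz])
  finally show ?thesis .
qed

lemma conn_operator_L2_borel:
  assumes f: "f \<in> L2_borel T"
  shows "(\<lambda>s. indicator {0<..<T} s * (f s + (\<integral>y. conn_ker s y * f y \<partial>lborel))) \<in> L2_borel T"
proof -
  have M'm: "M' (V f) \<in> borel_measurable borel"
    unfolding M'_def using L2_borelD(1)[OF V_L2[OF f]] by (rule k_transpose_apply(1))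
  have M'b: "\<bar>M' (V f) s\<bar> \<le> k_sup * (\<integral>s. \<bar>V f s\<bar> \<partial>lborel)" for s
    unfolding M'_def by (rule k_transpose_apply(3)[OF L2_borel_integrable[OF V_L2[OF f]]])
  have "0 \<le> k_sup * (\<integral>s. \<bar>V f s\<bar> \<partial>lborel)" using k_sup(1) by simp
  then have "(\<lambda>s. - (indicator {0<..<T} s * M' (V f) s)) \<in> L2_borel T"
    using M'm M'b by (intro L2_borel_bounded[where B = "k_sup * (\<integral>s. \<bar>V f s\<bar> \<partial>lborel)"]) (auto simp: indicator_def)
  from L2_borel_diff[OF V_L2[OF f] this]
  have "(\<lambda>s. V f s + indicator {0<..<T} s * M' (V f) s) \<in> L2_borel T" by simp
  moreover have "(\<lambda>s. V f s + indicator {0<..<T} s * M' (V f) s)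
    = (\<lambda>s. indicator {0<..<T} s * (f s + (\<integral>y. conn_ker s y * f y \<partial>lborel)))"
    using L2_borelD(2)[OF V_L2[OF f]]
    by (intro ext) (auto simp: indicator_def conn_ker_apply(1)[OF L2_borel_integrable[OF f]])
  ultimately show ?thesis by simp
qed

text \<open>The operator \<open>J_T (I + C_T) J_T\<close> written out, with \<open>c\<close> as the
  kernel of \<open>C_T\<close>.\<close>

definition conn_op :: "(real \<Rightarrow> real \<Rightarrow> real) \<Rightarrow> (real \<Rightarrow> real) \<Rightarrow> real \<Rightarrow> real" where
  "conn_op c f t = f t + (\<integral>s. c (T - t) s * f (T - s) \<partial>L2_measure T)"

lemma connecting_operator_conn_op:
  assumes c: "\<And>t s. t \<in> {0..T} \<Longrightarrow> s \<in> {0..T} \<Longrightarrow> c t s = conn_ker t s"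
  shows "connecting_operator q K T (conn_op c)"
proof -
  have rep: "conn_op c f t = f t + (\<integral>y. conn_ker (T - t) y * J T g y \<partial>lborel)"
    if g: "g \<in> L2_borel T" "AE x in L2_measure T. f x = g x" and t: "t \<in> {0<..<T}" for f g t
  proof -
    have "AE x in L2_measure T. f (T - x) = J T g x"
      using AE_L2_measure_reflect[OF g(2)] by (simp add: J_def)
    from conn_ker_apply_L2[OF c L2_borel_J[OF g(1)] this, of "T - t"] t show ?thesis
      by (simp add: conn_op_def)
  qed
  \<comment> \<open>The counterpart of \<open>conn_op\<close> on Borel representatives, cut off
    outside the interval so that it stays in \<open>L2_borel T\<close> and Fubini on
    \<open>lborel\<close> can be used.\<close>
  define C where "C = (\<lambda>g. J T (\<lambda>s. indicator {0<..<T} s * (J T g s + (\<integral>y. conn_ker s y * J T g y \<partial>lborel))))"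
  have CL2: "C g \<in> L2_borel T" if "g \<in> L2_borel T" for g
    unfolding C_def by (rule L2_borel_J[OF conn_operator_L2_borel[OF L2_borel_J[OF that]]])
  have Cae: "AE t in L2_measure T. conn_op c f t = C g t"
    if g: "g \<in> L2_borel T" "AE x in L2_measure T. f x = g x" for f g
  proof -
    have "AE t in L2_measure T. t \<in> {0<..<T}" by (intro AE_I2) simp
    with g(2) show ?thesis
      by eventually_elim (use rep[OF g] in \<open>auto simp: C_def J_def\<close>)
  qed
  show ?thesis
    unfolding connecting_operator_def
  proof (intro conjI ballI allI impI)
    fix f assume f: "f \<in> L2 (L2_measure T)"
    obtain g where g: "g \<in> L2_borel T" "AE x in L2_measure T. f x = g x"
      using that by (rule L2_borel_rep[OF f])
    show "conn_op c f \<in> L2 (L2_measure T)"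
      by (rule L2_measure_cong_AE[OF L2_borel_imp_L2[OF CL2[OF g(1)]] Cae[OF g]])
  next
    fix f1 f2 u v assume f1: "f1 \<in> L2 (L2_measure T)" and f2: "f2 \<in> L2 (L2_measure T)"
      and u: "L2_solution q K T f1 u" and v: "L2_solution q K T f2 v"
    obtain g1 where g1: "g1 \<in> L2_borel T" "AE x in L2_measure T. f1 x = g1 x"
      using that by (rule L2_borel_rep[OF f1])
    obtain g2 where g2: "g2 \<in> L2_borel T" "AE x in L2_measure T. f2 x = g2 x"
      using that by (rule L2_borel_rep[OF f2])
    have b: "h1 \<in> L2_borel T \<Longrightarrow> h2 \<in> L2_borel T \<Longrightarrow> (\<lambda>x. h1 x * h2 x) \<in> borel_measurable borel"
      for h1 h2 by (intro borel_measurable_times) (auto dest: L2_borelD(1))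
    have S: "{0<..<T} \<in> sets borel" by simp
    have prod: "(\<integral>x. p1 x * p2 x \<partial>L2_measure T) = (\<integral>x. h1 x * h2 x \<partial>lborel)"
      if h: "h1 \<in> L2_borel T" "h2 \<in> L2_borel T" and p: "AE x in L2_measure T. p1 x = h1 x" "AE x in L2_measure T. p2 x = h2 x"
      for p1 p2 h1 h2
    proof -
      have "p1 \<in> L2 (L2_measure T)" "p2 \<in> L2 (L2_measure T)"
        by (rule L2_measure_cong_AE[OF L2_borel_imp_L2[OF h(1)] p(1)], rule L2_measure_cong_AE[OF L2_borel_imp_L2[OF h(2)] p(2)])
      then have "(\<lambda>x. p1 x * p2 x) \<in> borel_measurable (L2_measure T)"
        by (intro borel_measurable_times) (auto simp: L2_def)
      then have "(\<integral>x. p1 x * p2 x \<partial>L2_measure T) = (\<integral>x. h1 x * h2 x \<partial>L2_measure T)"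
        by (rule integral_cong_AE[OF _ borel_measurable_lebesgue_on[OF b[OF h]]])
           (use p in \<open>eventually_elim, simp\<close>)
      also have "\<dots> = (\<integral>x. h1 x * h2 x \<partial>lborel)"
        by (rule lebesgue_on_borel(1)[OF b[OF h] S]) (use L2_borelD(2)[OF h(1)] in auto)
      finally show ?thesis .
    qed
    have "(\<integral>t. conn_op c f1 t * f2 t \<partial>L2_measure T) = (\<integral>t. C g1 t * g2 t \<partial>lborel)"
      by (rule prod[OF CL2[OF g1(1)] g2(1) Cae[OF g1] g2(2)])
    also have "\<dots> = (\<integral>t. C g1 (T - t) * g2 (T - t) \<partial>lborel)"
      using lborel_integral_real_affine[of "- 1" "\<lambda>t. C g1 t * g2 t" T] by simp
    also have "\<dots> = (\<integral>s. (J T g1 s + (\<integral>y. conn_ker s y * J T g1 y \<partial>lborel)) * J T g2 s \<partial>lborel)"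
    proof (rule Bochner_Integration.integral_cong[OF refl])
      fix t show "C g1 (T - t) * g2 (T - t) = (J T g1 t + (\<integral>y. conn_ker t y * J T g1 y \<partial>lborel)) * J T g2 t"
      proof (cases "t \<in> {0<..<T}")
        case True
        then show ?thesis by (simp add: C_def J_def)
      next
        case False
        then have "g2 (T - t) = 0" by (intro L2_borelD(2)[OF g2(1)]) auto
        then show ?thesis by (simp add: J_def)
      qed
    qed
    also have "\<dots> = (\<integral>x. V (J T g1) x * V (J T g2) x \<partial>lborel)"
      by (rule V_inner[symmetric]; rule L2_borel_J; fact)
    also have "\<dots> = (\<integral>x. u x T * v x T \<partial>L2_measure T)"
      by (rule prod[symmetric]; intro V_L2 L2_borel_J L2_solution_V[OF u] L2_solution_V[OF v] g1 g2)
    finally show "(\<integral>t. conn_op c f1 t * f2 t \<partial>L2_measure T) = (\<integral>x. u x T * v x T \<partial>L2_measure T)" .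
  qed
qed

text \<open>Both operators are tested against the difference \<open>h\<close> of their values. The
  defining identity speaks only about controls with a solution, so existence for every control,
  including \<open>h\<close>, is what makes the test legitimate.\<close>

lemma connecting_operator_unique:
  assumes C: "connecting_operator q K T C" and D: "connecting_operator q K T D" and f: "f \<in> L2 (L2_measure T)"
  shows "AE t in L2_measure T. C f t = D f t"
proof -
  have CD: "C f \<in> L2 (L2_measure T)" "D f \<in> L2 (L2_measure T)"
    using C D f by (auto simp: connecting_operator_def)
  define h where "h = (\<lambda>t. C f t - D f t)"
  have h: "h \<in> L2 (L2_measure T)" unfolding h_def by (rule L2_diff[OF CD])
  have ex: "\<exists>u. L2_solution q K T p u" if "p \<in> L2 (L2_measure T)" for p
    by (rule L2_borel_rep[OF that]) (blast intro: L2_solution_exists[OF T that])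
  obtain u v where "L2_solution q K T f u" "L2_solution q K T h v"
    using ex[OF f] ex[OF h] by blast
  then have "(\<integral>t. C f t * h t \<partial>L2_measure T) = (\<integral>t. D f t * h t \<partial>L2_measure T)"
    using C D f h by (simp add: connecting_operator_def)
  moreover have "(\<integral>t. (h t)\<^sup>2 \<partial>L2_measure T) = (\<integral>t. C f t * h t \<partial>L2_measure T) - (\<integral>t. D f t * h t \<partial>L2_measure T)"
    using L2_mult_integrable[OF CD(1) h] L2_mult_integrable[OF CD(2) h]
    by (subst Bochner_Integration.integral_diff[symmetric]) (auto simp: h_def power2_eq_square algebra_simps)
  ultimately have "AE t in L2_measure T. h t = 0"
    by (intro L2_null[OF h]) simp
  then show ?thesis by (simp add: h_def)
qed

text \<open>For uniqueness, the difference \<open>d\<close> of the two kernels is applied to its own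
  row \<open>d t0\<close>; at \<open>t = t0\<close> the result is the integral of the square of that
  row. The operators agree only almost everywhere, so the result is first zero for almost all
  \<open>t\<close>, then at \<open>t0\<close> by continuity.\<close>

lemma connecting_kernel_iff:
  "connecting_kernel q K T c \<longleftrightarrow> (\<forall>t\<in>{0..T}. \<forall>s\<in>{0..T}. c t s = conn_ker t s)"
proof
  assume eq: "\<forall>t\<in>{0..T}. \<forall>s\<in>{0..T}. c t s = conn_ker t s"
  have "continuous_on ({0..T} \<times> {0..T}) (\<lambda>(t, s). c t s)"
    by (rule continuous_on_eq[OF conn_ker_continuous]) (use eq in auto)
  moreover have "connecting_operator q K T (conn_op c)"
    by (rule connecting_operator_conn_op) (use eq in auto)
  moreover have "J T (conn_op c (J T f)) t - f t = (\<integral>s. c t s * f s \<partial>L2_measure T)" for f t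
    by (simp add: J_def conn_op_def)
  ultimately show "connecting_kernel q K T c"
    unfolding connecting_kernel_def by (intro conjI exI[of _ "conn_op c"]) auto
next
  assume "connecting_kernel q K T c"
  then obtain C where cc: "continuous_on ({0..T} \<times> {0..T}) (\<lambda>(t, s). c t s)" and C: "connecting_operator q K T C"
    and cC: "\<And>f. f \<in> L2 (L2_measure T) \<Longrightarrow> AE t in L2_measure T. J T (C (J T f)) t - f t = (\<integral>s. c t s * f s \<partial>L2_measure T)"
    unfolding connecting_kernel_def by blast
  define d where "d = (\<lambda>t s. c t s - conn_ker t s)"
  have dc: "continuous_on ({0..T} \<times> {0..T}) (\<lambda>(t, s). d t s)"
    using cc conn_ker_continuous unfolding d_def split_beta by (intro continuous_intros)
  note C0 = connecting_operator_conn_op[of conn_ker, OF refl]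
  show "\<forall>t\<in>{0..T}. \<forall>s\<in>{0..T}. c t s = conn_ker t s"
  proof (intro ballI)
    fix t0 s0 assume t0: "t0 \<in> {0..T}" and s0: "s0 \<in> {0..T}"
    define f where "f = (\<lambda>s. indicator {0<..<T} s * d t0 s)"
    have slice: "continuous_on {0..T} (\<lambda>s. e t s)" if "continuous_on ({0..T} \<times> {0..T}) (\<lambda>(t, s). e t s)" "t \<in> {0..T}"
      for e :: "real \<Rightarrow> real \<Rightarrow> real" and t
      using continuous_on_slice(1)[OF that] .
    have fb: "f \<in> L2_borel T" unfolding f_def by (rule continuous_L2_borel[OF slice[OF dc t0]])
    have f: "f \<in> L2 (L2_measure T)" by (rule L2_borel_imp_L2[OF fb])
    define D where "D = (\<lambda>t. integral {0..T} (\<lambda>s. d t s * d t0 s))"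
    have ker: "(\<integral>s. e t s * f s \<partial>L2_measure T) = integral {0..T} (\<lambda>s. e t s * d t0 s)"
      if "continuous_on ({0..T} \<times> {0..T}) (\<lambda>(t, s). e t s)" "t \<in> {0..T}" for e :: "real \<Rightarrow> real \<Rightarrow> real" and t
    proof -
      have "(\<integral>s. e t s * f s \<partial>L2_measure T) = (\<integral>s. e t s * d t0 s \<partial>L2_measure T)"
        by (intro Bochner_Integration.integral_cong) (auto simp: f_def)
      also have "\<dots> = integral {0..T} (\<lambda>s. e t s * d t0 s)"
        by (intro integral_L2_measure_continuous continuous_on_mult slice that dc t0)
      finally show ?thesis .
    qed
    have "AE t in L2_measure T. C (J T f) t = conn_op conn_ker (J T f) t"
      by (rule connecting_operator_unique[OF C C0 L2_J[OF f]])
    from AE_L2_measure_reflect[OF this]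
    have "AE t in L2_measure T. C (J T f) (T - t) = conn_op conn_ker (J T f) (T - t)" .
    moreover have "AE t in L2_measure T. t \<in> {0<..<T}" by (intro AE_I2) simp
    moreover note cC[OF f]
    ultimately have ae: "AE t in L2_measure T. D t = 0"
    proof eventually_elim
      case (elim t)
      then have t: "t \<in> {0..T}" by simp
      have "(\<integral>s. c t s * f s \<partial>L2_measure T) = (\<integral>s. conn_ker t s * f s \<partial>L2_measure T)"
        using elim by (simp add: J_def conn_op_def)
      then have "integral {0..T} (\<lambda>s. c t s * d t0 s) = integral {0..T} (\<lambda>s. conn_ker t s * d t0 s)"
        by (simp add: ker[OF cc t] ker[OF conn_ker_continuous t])
      moreover have "D t = integral {0..T} (\<lambda>s. c t s * d t0 s) - integral {0..T} (\<lambda>s. conn_ker t s * d t0 s)"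
      proof -
        have "d t s * d t0 s = c t s * d t0 s - conn_ker t s * d t0 s" for s
          by (subst d_def) (simp add: left_diff_distrib)
        then show ?thesis unfolding D_def
          by (simp only:, intro Henstock_Kurzweil_Integration.integral_diff integrable_continuous_interval continuous_on_mult
            slice cc conn_ker_continuous t dc t0)
      qed
      ultimately show "D t = 0" by simp
    qed
    have Dc: "continuous_on {0..T} D"
    proof -
      have "continuous_on ({0..T} \<times> cbox 0 T) (\<lambda>(t, s). d t s * d t0 s)"
        using dc slice[OF dc t0] unfolding split_beta cbox_interval
        by (intro continuous_on_mult continuous_on_compose2[OF slice[OF dc t0], of _ snd]) (auto intro!: continuous_intros)
      from integral_continuous_on_param[OF this] show ?thesis by (simp add: D_def)
    qed
    then have D2: "continuous_on {0..T} (\<lambda>t. D t * D t)" by (intro continuous_intros)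
    have "(\<integral>t. D t * D t \<partial>L2_measure T) = 0"
      by (rule integral_eq_zero_AE) (use ae in \<open>eventually_elim, simp\<close>)
    then have "integral {0..T} (\<lambda>t. D t * D t) = 0"
      by (simp add: integral_L2_measure_continuous[OF D2])
    then have "D t0 = 0"
      using integral_eq_0_iff[OF D2 T] t0 by auto
    then have "integral {0..T} (\<lambda>s. d t0 s * d t0 s) = 0" by (simp add: D_def)
    moreover have "continuous_on {0..T} (\<lambda>s. d t0 s * d t0 s)"
      by (intro continuous_on_mult slice dc t0)
    ultimately have "d t0 s0 = 0"
      using integral_eq_0_iff[of 0 T "\<lambda>s. d t0 s * d t0 s"] T s0 by auto
    then show "c t0 s0 = conn_ker t0 s0" by (simp add: d_def)
  qed
qed

end

text \<open>\<open>k x s\<close> involves \<open>W x (s - x)\<close>, and there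
  \<open>2 * x + (s - x) = x + s \<le> 2 * T\<close>: this is why the response is needed up to time
  \<open>2 * T\<close>.\<close>

lemma conn_ker_determined_by_response:
  assumes A: "control_horizon q q1 K W T" and B: "control_horizon q' q1' K W' T"
    and R: "response_operator q' K (2 * T) = response_operator q K (2 * T)"
  shows "control_horizon.conn_ker W T = control_horizon.conn_ker W' T"
proof -
  interpret A: control_horizon q q1 K W T by fact
  interpret B: control_horizon q' q1' K W' T by fact
  have "char_slope q K W 0 t = char_slope q' K W' 0 t" if "0 \<le> t" "t \<le> 2 * T" for t
    using response_determines_slope[OF A.goursat_kernel_axioms B.goursat_kernel_axioms _ R that] A.T by simp
  note W = goursat_kernel_unique[OF A.goursat_kernel_axioms B.goursat_kernel_axioms this]
  have k: "A.k x s = B.k x s" for x s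
  proof (cases "0 \<le> x \<and> x \<le> s \<and> s \<le> T")
    case True
    then have "W x (s - x) = W' x (s - x)" by (intro W) auto
    then show ?thesis by (simp add: A.k_eq B.k_eq)
  qed (auto simp: A.k_eq B.k_eq)
  show ?thesis by (intro ext) (simp only: A.conn_ker_def B.conn_ker_def k)
qed

subsection \<open>The Gelfand--Levitan equation\<close>

text \<open>A non-integrable \<open>h\<close> has integral \<open>0\<close>, so no measurability of
  \<open>h\<close> has to be checked where this is applied.\<close>

lemma abs_lebesgue_integral_le:
  fixes h g :: "real \<Rightarrow> real"
  assumes g: "integrable lborel g" and ae: "AE y in lborel. \<bar>h y\<bar> \<le> g y"
  shows "\<bar>\<integral>y. h y \<partial>lborel\<bar> \<le> (\<integral>y. g y \<partial>lborel)"
proof (cases "integrable lborel h")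
  case True
  have "\<bar>\<integral>y. h y \<partial>lborel\<bar> \<le> (\<integral>y. \<bar>h y\<bar> \<partial>lborel)" by (rule integral_abs_bound)
  also have "\<dots> \<le> (\<integral>y. g y \<partial>lborel)" using True g ae by (intro integral_mono_AE) auto
  finally show ?thesis .
next
  case False
  have "0 \<le> (\<integral>y. g y \<partial>lborel)"
    by (rule integral_nonneg_AE) (use ae in \<open>eventually_elim, auto intro: order_trans[OF abs_ge_zero]\<close>)
  then show ?thesis using False by (simp add: not_integrable_integral_eq)
qed

text \<open>Only a pointwise bound of the integrand by \<open>f\<close> enters, so the same
  statement fits kernels of either sign and their transposes.\<close>

lemma volterra_zero:
  fixes f :: "real \<Rightarrow> real"
  assumes B0: "\<And>x. x \<in> {0<..<b} \<Longrightarrow> \<bar>f x\<bar> \<le> B0" and C: "0 \<le> C"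
    and eq: "\<And>x. x \<in> {0<..<b} \<Longrightarrow> f x = (\<integral>y. h x y \<partial>lborel)"
    and le: "\<And>x y. x \<in> {0<..<b} \<Longrightarrow> y \<in> {0<..<x} \<Longrightarrow> \<bar>h x y\<bar> \<le> C * \<bar>f y\<bar>"
    and zero: "\<And>x y. x \<in> {0<..<b} \<Longrightarrow> y \<notin> {0..x} \<Longrightarrow> h x y = 0"
    and x: "x \<in> {0<..<b}"
  shows "f x = 0"
proof -
  define l where "l = 1 + 2 * C"
  have l: "l > 0" "2 * C \<le> l" using C by (auto simp: l_def)
  define P where "P = (\<lambda>B. \<forall>x\<in>{0<..<b}. \<bar>f x\<bar> \<le> B * exp (l * x))"
  have B0': "0 \<le> B0" using B0[OF x] by linarith
  have "P B0"
    unfolding P_def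
  proof
    fix x assume x: "x \<in> {0<..<b}"
    have "B0 * 1 \<le> B0 * exp (l * x)" using B0' l x by (intro mult_left_mono) auto
    then show "\<bar>f x\<bar> \<le> B0 * exp (l * x)" using B0[OF x] by linarith
  qed
  have "\<bar>f x\<bar> \<le> 0"
  proof (rule nonpos_of_halving[of P, OF \<open>P B0\<close> B0'])
    fix B assume B: "0 \<le> B" "P B"
    have "\<bar>f x\<bar> \<le> B / 2 * exp (l * x)" if x: "x \<in> {0<..<b}" for x
    proof -
      have c: "continuous_on {0..x} (\<lambda>y. C * B * exp (l * y))" by (intro continuous_intros)
      note si = borel_integrable_atLeastAtMost'[OF c]
      have "\<bar>f x\<bar> \<le> (\<integral>y. indicator {0..x} y *\<^sub>R (C * B * exp (l * y)) \<partial>lborel)"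
        unfolding eq[OF x]
      proof (rule abs_lebesgue_integral_le)
        show "integrable lborel (\<lambda>y. indicator {0..x} y *\<^sub>R (C * B * exp (l * y)))"
          using si by (simp add: set_integrable_def)
        \<comment> \<open>The bound on \<open>h\<close> is assumed only strictly between
          \<open>0\<close> and \<open>x\<close>; the two endpoints form a null set.\<close>
        have "AE y in lborel. y \<noteq> (0::real)" "AE y in lborel. y \<noteq> x" by (rule AE_lborel_singleton)+
        then show "AE y in lborel. \<bar>h x y\<bar> \<le> indicator {0..x} y *\<^sub>R (C * B * exp (l * y))"
        proof eventually_elim
          case (elim y)
          show ?case
          proof (cases "y \<in> {0..x}")
            case True
            then have y: "y \<in> {0<..<x}" using elim by auto
            have "\<bar>h x y\<bar> \<le> C * \<bar>f y\<bar>" by (rule le[OF x y])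
            also have "\<dots> \<le> C * (B * exp (l * y))" using B(2) C x y by (intro mult_left_mono) (auto simp: P_def)
            finally show ?thesis using True by simp
          next
            case False
            then show ?thesis using zero[OF x False] by simp
          qed
        qed
      qed
      also have "\<dots> = integral {0..x} (\<lambda>y. C * B * exp (l * y))"
        unfolding set_lebesgue_integral_def[symmetric] by (rule set_borel_integral_eq_integral(2)[OF si])
      also have "\<dots> \<le> C * B / l * exp (l * x)"
        using abs_integral_exp_le[of l "C * B" 0 x "\<lambda>y. C * B * exp (l * y)"] l C B by simp
      also have "\<dots> \<le> B / 2 * exp (l * x)"
        using l mult_right_mono[OF l(2) B(1)] by (intro mult_right_mono) (auto simp: field_simps)
      finally show ?thesis .
    qed
    then show "P (B / 2)" by (auto simp: P_def)
  next
    fix B assume "P B"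
    then show "\<bar>f x\<bar> \<le> B * exp (l * x)" using x by (auto simp: P_def)
  qed
  then show ?thesis by simp
qed

text \<open>The reflection of \<open>x\<close> to \<open>b - x\<close> turns a kernel supported in
  \<open>y \<ge> x\<close> into one supported in \<open>y \<le> x\<close>.\<close>

lemma volterra_zero_backward:
  fixes f :: "real \<Rightarrow> real"
  assumes B0: "\<And>x. x \<in> {0<..<b} \<Longrightarrow> \<bar>f x\<bar> \<le> B0" and C: "0 \<le> C"
    and eq: "\<And>x. x \<in> {0<..<b} \<Longrightarrow> f x = (\<integral>y. h x y \<partial>lborel)"
    and le: "\<And>x y. x \<in> {0<..<b} \<Longrightarrow> y \<in> {x<..<b} \<Longrightarrow> \<bar>h x y\<bar> \<le> C * \<bar>f y\<bar>"
    and zero: "\<And>x y. x \<in> {0<..<b} \<Longrightarrow> y \<notin> {x..b} \<Longrightarrow> h x y = 0"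
    and x: "x \<in> {0<..<b}"
  shows "f x = 0"
proof -
  have "f (b - (b - x)) = 0"
  proof (rule volterra_zero[where f = "\<lambda>x. f (b - x)" and h = "\<lambda>x y. h (b - x) (b - y)" and b = b and C = C and ?B0.0 = B0])
    fix x assume "x \<in> {0<..<b}"
    then have "f (b - x) = (\<integral>y. h (b - x) y \<partial>lborel)" by (intro eq) auto
    also have "\<dots> = (\<integral>y. h (b - x) (b - y) \<partial>lborel)"
      using lborel_integral_real_affine[of "- 1" "h (b - x)" b] by simp
    finally show "f (b - x) = (\<integral>y. h (b - x) (b - y) \<partial>lborel)" .
  qed (use assms in auto)
  then show ?thesis by simp
qed

lemma compact_triangle: "compact {(x, s). 0 \<le> x \<and> x \<le> s \<and> s \<le> (T :: real)}"
proof -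
  have "{(x, s). 0 \<le> x \<and> x \<le> s \<and> s \<le> T} = ({0..T} \<times> {0..T}) \<inter> {p. fst p \<le> snd p}" by auto
  moreover have "closed {p :: real \<times> real. fst p \<le> snd p}" by (intro closed_Collect_le continuous_intros)
  ultimately show ?thesis by (simp add: compact_Int_closed compact_Times)
qed

section \<open>Volterra inversion of \<open>I + M\<close>\<close>

context control_horizon
begin

lemma V_injective:
  assumes f: "f \<in> L2_borel T" and ae: "AE x in lborel. V f x = 0"
  shows "AE x in lborel. f x = 0"
proof -
  \<comment> \<open>\<open>f\<close> solves \<open>f = - M f\<close> only almost everywhere, whereas
    \<open>p\<close> is bounded and solves it at every point, as the Volterra argument
    requires.\<close>
  define p where "p = (\<lambda>x. - M f x)"
  have fp: "AE x in lborel. f x = p x" using ae by eventually_elim (simp add: V_def p_def)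
  have fm: "f \<in> borel_measurable borel" and fi: "integrable lborel f"
    using f by (auto dest: L2_borelD L2_borel_integrable)
  have pm: "p \<in> borel_measurable borel"
    unfolding p_def using L2_borelD(1)[OF M_L2[OF f]] by simp
  have Mfp: "M f x = M p x" for x
    unfolding M_def
  proof (rule integral_cong_AE)
    note [measurable] = fm pm kernel_slice_measurable(1)[OF k_measurable]
    show "(\<lambda>s. k x s * f s) \<in> borel_measurable lborel" "(\<lambda>s. k x s * p s) \<in> borel_measurable lborel"
      by measurable
    show "AE s in lborel. k x s * f s = k x s * p s" using fp by eventually_elim simp
  qed
  have eq: "p x = (\<integral>s. - (k x s * p s) \<partial>lborel)" for x
  proof -
    have "p x = - M f x" by (simp add: p_def)
    also have "\<dots> = - M p x" by (simp only: Mfp)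
    finally show ?thesis by (simp add: M_def)
  qed
  have p0: "p x = 0" if x: "x \<in> {0<..<T}" for x
  proof (rule volterra_zero_backward[OF _ k_sup(1) eq _ _ x])
    show "\<bar>p x\<bar> \<le> k_sup * (\<integral>s. \<bar>f s\<bar> \<partial>lborel)" for x
      using k_apply(3)[OF fi] by (simp add: p_def M_def)
    show "\<bar>- (k x y * p y)\<bar> \<le> k_sup * \<bar>p y\<bar>" for x y
      using k_sup(2)[of x y] by (simp add: abs_mult mult_right_mono)
    show "- (k x y * p y) = 0" if "y \<notin> {x..T}" for x y using that by (auto simp: k_eq)
  qed
  from fp show ?thesis
    by eventually_elim (use p0 L2_borelD(2)[OF f] in metis)
qed

text \<open>Column by column this is \<open>(I + M) z = - k\<close>, with the integration variable
  shifted to \<open>x + r\<close>. The triangle is compact, so the exhaustion is constant.\<close>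

lemma resolvent_exists:
  "\<exists>z. continuous_on {(x, s). 0 \<le> x \<and> x \<le> s \<and> s \<le> T} (\<lambda>(x, s). z x s) \<and>
    (\<forall>x s. 0 \<le> x \<and> x \<le> s \<and> s \<le> T \<longrightarrow> z x s = - W x (s - x) - integral {0..s - x} (\<lambda>r. W x r * z (x + r) s))"
proof -
  define D where "D = {(x, s). 0 \<le> x \<and> x \<le> s \<and> s \<le> T}"
  define A where "A = (\<lambda>u p. - W (fst p) (snd p - fst p) - integral {0..snd p - fst p} (\<lambda>r. W (fst p) r * u (fst p + r, snd p)))"
  have cD: "compact D" unfolding D_def by (rule compact_triangle)
  define C where "C = k_sup"
  have C: "C \<ge> 0" "\<And>x e. 0 \<le> x \<Longrightarrow> 0 \<le> e \<Longrightarrow> x + e \<le> T \<Longrightarrow> \<bar>W x e\<bar> \<le> C"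
  proof -
    show "C \<ge> 0" using k_sup(1) by (simp add: C_def)
    show "\<bar>W x e\<bar> \<le> C" if "0 \<le> x" "0 \<le> e" "x + e \<le> T" for x e
      using k_sup(2)[of x "x + e"] that by (simp add: k_eq C_def)
  qed
  define l where "l = 1 + 2 * C"
  have l: "l > 0" "2 * C \<le> l" using C(1) by (auto simp: l_def)
  have int: "(\<lambda>r. W (fst p) r * u (fst p + r, snd p)) integrable_on {0..snd p - fst p}"
    if u: "continuous_on D u" and p: "p \<in> D" for u p
    using p by (intro integrable_continuous_interval continuous_on_mult
        continuous_on_subset[OF continuous_on_slice(1)[OF W, of "fst p"]] continuous_on_compose2[OF u])
      (auto simp: D_def intro!: continuous_intros)
  have "\<exists>w. continuous_on D w \<and> (\<forall>p\<in>D. w p = A w p)"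
  \<comment> \<open>The equation at \<open>x\<close> uses only larger first arguments, so the weight
    decreases in \<open>x\<close>.\<close>
  proof (rule volterra_fixpoint[where R = "\<lambda>_. D" and om = "\<lambda>_ p. exp (l * (T - fst p))" and Om = "\<lambda>_. exp (l * T)"])
    fix u :: "real \<times> real \<Rightarrow> real" assume u: "continuous_on D u"
    have "continuous_on D (\<lambda>p. W (fst p) (snd p - fst p))"
      by (rule continuous_on_compose2[OF W, of _ "\<lambda>p. (fst p, snd p - fst p)", unfolded split_beta fst_conv snd_conv])
         (auto intro!: continuous_intros simp: D_def)
    moreover have "continuous_on D (\<lambda>p. integral {0..snd p - fst p} (\<lambda>r. W (fst p) r * u (fst p + r, snd p)))"
    proof (rule continuous_on_integral_upto[where G = "\<lambda>p r. W (fst p) r * u (fst p + r, snd p)" and m = "\<lambda>p. snd p - fst p"])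
      show "continuous_on {(p, r). p \<in> D \<and> 0 \<le> r \<and> r \<le> snd p - fst p} (\<lambda>(p, r). W (fst p) r * u (fst p + r, snd p))"
        unfolding split_beta
        by (intro continuous_on_mult continuous_on_compose2[OF u]
            continuous_on_compose2[OF W, of _ "\<lambda>z. (fst (fst z), snd z)", unfolded split_beta fst_conv snd_conv])
           (auto intro!: continuous_intros simp: D_def)
    qed (auto intro!: continuous_intros simp: D_def)
    ultimately show "continuous_on D (A u)"
      unfolding A_def by (intro continuous_intros)
  next
    fix p :: "real \<times> real" assume "p \<in> D"
    have "(1 :: real) > 0 \<and> D \<inter> ball p 1 \<subseteq> D" by auto
    then show "\<exists>n e. e > 0 \<and> D \<inter> ball p e \<subseteq> D" by blast
  next
    fix p :: "real \<times> real" assume "p \<in> D"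
    then show "1 \<le> exp (l * (T - fst p)) \<and> exp (l * (T - fst p)) \<le> exp (l * T)"
      using l by (auto simp: D_def intro!: mult_nonneg_nonneg)
  next
    fix u v :: "real \<times> real \<Rightarrow> real" and B p
    assume u: "continuous_on D u" and v: "continuous_on D v" and B: "B \<ge> 0" and p: "p \<in> D"
      and le: "\<And>p. p \<in> D \<Longrightarrow> \<bar>u p - v p\<bar> \<le> B * exp (l * (T - fst p))"
    obtain x s where ps: "p = (x, s)" by (cases p)
    have xs: "0 \<le> x" "x \<le> s" "s \<le> T" using p by (auto simp: D_def ps)
    define a where "a = C * B * exp (l * (T - x))"
    have hi: "((\<lambda>r. a * exp (- l * r)) has_integral a / - l * exp (- l * (s - x)) - a / - l * exp (- l * 0)) {0..s - x}"
      using xs l by (intro has_integral_exp) auto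
    have "A v p - A u p = integral {0..s - x} (\<lambda>r. W x r * (u (x + r, s) - v (x + r, s)))"
      using int[OF u p] int[OF v p]
      by (simp add: A_def ps right_diff_distrib Henstock_Kurzweil_Integration.integral_diff)
    moreover have "\<bar>integral {0..s - x} (\<lambda>r. W x r * (u (x + r, s) - v (x + r, s)))\<bar> \<le> integral {0..s - x} (\<lambda>r. a * exp (- l * r))"
    proof (rule abs_integral_le)
      fix r assume r: "r \<in> {0..s - x}"
      have "\<bar>W x r\<bar> * \<bar>u (x + r, s) - v (x + r, s)\<bar> \<le> C * (B * exp (l * (T - (x + r))))"
        using r xs C le[of "(x + r, s)"] by (intro mult_mono) (auto simp: D_def)
      also have "\<dots> = a * exp (- l * r)"
        by (simp add: a_def mult.assoc flip: exp_add) (simp add: algebra_simps)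
      finally show "\<bar>W x r * (u (x + r, s) - v (x + r, s))\<bar> \<le> a * exp (- l * r)" by (simp add: abs_mult)
    qed (use hi in auto)
    moreover have "integral {0..s - x} (\<lambda>r. a * exp (- l * r)) \<le> B / 2 * exp (l * (T - x))"
    proof -
      have "integral {0..s - x} (\<lambda>r. a * exp (- l * r)) = a / - l * exp (- l * (s - x)) - a / - l * exp (- l * 0)"
        using hi by (rule integral_unique)
      also have "\<dots> \<le> a / l" using l B C(1) by (simp add: a_def)
      also have "\<dots> = C * B / l * exp (l * (T - x))" by (simp add: a_def)
      also have "\<dots> \<le> B / 2 * exp (l * (T - x))"
        using l mult_right_mono[OF l(2) B] by (intro mult_right_mono) (auto simp: field_simps)
      finally show ?thesis .
    qed
    ultimately show "\<bar>A u p - A v p\<bar> \<le> B / 2 * exp (l * (T - fst p))"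
      unfolding ps fst_conv by linarith
  qed (use cD in auto)
  then obtain w where w: "continuous_on D w" "\<And>p. p \<in> D \<Longrightarrow> w p = A w p" by blast
  show ?thesis
    by (rule exI[of _ "curry w"]) (use w in \<open>auto simp: A_def D_def\<close>)
qed

end

section \<open>The resolvent kernel as the solution of the Gelfand--Levitan equation\<close>

locale resolvent_kernel = control_horizon +
  fixes z :: "real \<Rightarrow> real \<Rightarrow> real"
  assumes z: "continuous_on {(x, s). 0 \<le> x \<and> x \<le> s \<and> s \<le> T} (\<lambda>(x, s). z x s)"
    and z_eq: "\<And>x s. 0 \<le> x \<Longrightarrow> x \<le> s \<Longrightarrow> s \<le> T \<Longrightarrow>
      z x s = - W x (s - x) - integral {0..s - x} (\<lambda>r. W x r * z (x + r) s)"
begin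

definition Z :: "real \<Rightarrow> real \<Rightarrow> real" where
  "Z x s = (if 0 \<le> x \<and> x \<le> s \<and> s \<le> T then z x s else 0)"

lemma Z_measurable: "(\<lambda>(x, s). Z x s) \<in> borel_measurable (borel \<Otimes>\<^sub>M borel)"
proof -
  let ?D = "{(x, s). 0 \<le> x \<and> x \<le> s \<and> s \<le> T}"
  have "(\<lambda>p. indicator ?D p *\<^sub>R (\<lambda>(x, s). z x s) p) \<in> borel_measurable borel"
    using compact_imp_closed[OF compact_triangle] z by (intro borel_measurable_continuous_on_indicator) auto
  moreover have "indicator ?D p *\<^sub>R (\<lambda>(x, s). z x s) p = (\<lambda>(x, s). Z x s) p" for p
    by (cases p) (auto simp: Z_def indicator_def)
  ultimately show ?thesis by (simp add: borel_prod)
qed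

lemma Z_bound: obtains B where "B \<ge> 0" "\<And>x s. \<bar>Z x s\<bar> \<le> B"
proof -
  obtain B where B: "B \<ge> 0" "\<And>p. p \<in> {(x, s). 0 \<le> x \<and> x \<le> s \<and> s \<le> T} \<Longrightarrow> \<bar>(\<lambda>(x, s). z x s) p\<bar> \<le> B"
    using compact_continuous_bound[OF z compact_triangle] by blast
  have "\<bar>Z x s\<bar> \<le> B" for x s using B(1) B(2)[of "(x, s)"] by (auto simp: Z_def)
  then show ?thesis using that B(1) by blast
qed

lemma z_column: "0 \<le> a \<Longrightarrow> s \<le> T \<Longrightarrow> continuous_on {a..s} (\<lambda>x. z x s)"
  by (rule continuous_on_compose2[OF z, of _ "\<lambda>x. (x, s)", unfolded split_beta fst_conv snd_conv])
     (auto intro!: continuous_intros)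

text \<open>In operator form \<open>L + M + M L = 0\<close>, that is, \<open>I + L\<close> is a
  right inverse of \<open>I + M\<close>. Off the triangle all three terms vanish, since
  \<open>k x s * Z s y\<close> can be nonzero only for \<open>x \<le> s \<le> y\<close>.\<close>

lemma Z_resolvent: "Z x y + k x y + (\<integral>s. k x s * Z s y \<partial>lborel) = 0"
proof (cases "0 \<le> x \<and> x \<le> y \<and> y \<le> T")
  case True
  have "continuous_on {x..y} (\<lambda>s. W x (s - x))"
    using True by (intro continuous_on_compose2[OF continuous_on_slice(1)[OF W]] continuous_intros) auto
  then have c: "continuous_on {x..y} (\<lambda>s. W x (s - x) * z s y)"
    using True by (intro continuous_on_mult z_column) auto
  have "(\<integral>s. k x s * Z s y \<partial>lborel) = (LINT s:{x..y}|lborel. W x (s - x) * z s y)"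
    unfolding set_lebesgue_integral_def using True
    by (intro Bochner_Integration.integral_cong) (auto simp: k_eq Z_def indicator_def)
  also have "\<dots> = integral {x..y} (\<lambda>s. W x (s - x) * z s y)"
    by (rule set_borel_integral_eq_integral(2)[OF borel_integrable_atLeastAtMost'[OF c]])
  also have "\<dots> = integral {0..y - x} (\<lambda>r. W x r * z (x + r) y)"
    using integral_shift_real_ivl[of x x y "\<lambda>s. W x (s - x) * z s y"] by (simp add: add.commute)
  finally show ?thesis using z_eq[of x y] True by (simp add: Z_def k_eq)
next
  case False
  have "(\<lambda>s. k x s * Z s y) = (\<lambda>_. 0)" using False by (auto simp: k_eq Z_def)
  then show ?thesis using False by (auto simp: k_eq Z_def)
qed

lemma z_diag: "0 \<le> x \<Longrightarrow> x \<le> T \<Longrightarrow> z x x = 1 / 2 * integral {0..x} q"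
  using z_eq[of x x] W_diag[of x] by simp

lemma conn_ker_column:
  assumes x: "x \<in> {0..T}" and s: "0 \<le> s" "s \<le> T" and f: "continuous_on {0..s} f"
  shows "(\<integral>y. conn_ker x y * (indicator {0..s} y * f y) \<partial>lborel) = integral {0..s} (\<lambda>y. conn_ker x y * f y)"
proof -
  have "continuous_on {0..s} (conn_ker x)"
    by (rule continuous_on_subset[OF continuous_on_slice(1)[OF conn_ker_continuous x]]) (use s in auto)
  then have c: "continuous_on {0..s} (\<lambda>y. conn_ker x y * f y)" using f by (rule continuous_on_mult)
  have "(\<integral>y. conn_ker x y * (indicator {0..s} y * f y) \<partial>lborel) = (LINT y:{0..s}|lborel. conn_ker x y * f y)"
    unfolding set_lebesgue_integral_def by (simp add: mult.left_commute)
  also have "\<dots> = integral {0..s} (\<lambda>y. conn_ker x y * f y)"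
    by (rule set_borel_integral_eq_integral(2)[OF borel_integrable_atLeastAtMost'[OF c]])
  finally show ?thesis .
qed

lemma column_integrable:
  fixes f :: "real \<Rightarrow> real"
  assumes f: "continuous_on {0..s} f"
  shows "integrable lborel (\<lambda>y. indicator {0..s} y * f y)"
  using borel_integrable_atLeastAtMost'[OF f] by (simp add: set_integrable_def)

text \<open>On a column, \<open>(I + C\<^sub>T) z = (I + M') (I + M) z\<close> and \<open>(I + M) z = - k\<close>.\<close>

lemma z_gelfand_levitan:
  assumes xs: "0 < x" "x < s" "s < T"
  shows "z x s + conn_ker x s + integral {0..s} (\<lambda>y. conn_ker x y * z y s) = 0"
proof -
  define f where "f = (\<lambda>y. indicator {0..s} y * z y s)"
  have f: "integrable lborel f"
    unfolding f_def using xs by (intro column_integrable z_column) auto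
  have fZ: "f = (\<lambda>y. Z y s)" using xs by (auto simp: f_def Z_def indicator_def)
  have "V f y = - k y s" for y
    using Z_resolvent[of y s] by (simp add: V_def M_def fZ)
  then have "V f x + M' (V f) x = - (k x s + (\<integral>y. k y x * k y s \<partial>lborel))"
    by (simp add: M'_def)
  also have "\<dots> = - conn_ker x s" using xs by (simp add: conn_ker_def)
  finally have "f x + (\<integral>y. conn_ker x y * f y \<partial>lborel) = - conn_ker x s"
    using conn_ker_apply(1)[OF f, of x] by simp
  moreover have "(\<integral>y. conn_ker x y * f y \<partial>lborel) = integral {0..s} (\<lambda>y. conn_ker x y * z y s)"
    unfolding f_def using xs by (intro conn_ker_column z_column) auto
  ultimately show ?thesis using xs by (simp add: f_def)
qed

lemma gelfand_levitan_z:
  assumes c: "\<And>t s. t \<in> {0..T} \<Longrightarrow> s \<in> {0..T} \<Longrightarrow> c t s = conn_ker t s"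
  shows "gelfand_levitan T c z"
  unfolding gelfand_levitan_def
proof (intro conjI allI impI z)
  fix x s assume xs: "0 < x \<and> x < s \<and> s < T"
  have "integral {0..s} (\<lambda>y. c x y * z y s) = integral {0..s} (\<lambda>y. conn_ker x y * z y s)"
    using xs c by (intro Henstock_Kurzweil_Integration.integral_cong) auto
  then show "z x s + c x s + integral {0..s} (\<lambda>\<tau>. c x \<tau> * z \<tau> s) = 0"
    using z_gelfand_levitan[of x s] c[of x s] xs by simp
qed

text \<open>The difference of two solutions on a column is annihilated by
  \<open>(I + M') (I + M)\<close> on \<open>(0, s)\<close>. Although the equation says nothing
  beyond \<open>s\<close>, \<open>M'\<close> looks only at smaller arguments, so \<open>V f\<close>
  vanishes on \<open>(0, s)\<close>; \<open>M\<close> looks only at larger ones, where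
  \<open>f\<close> is cut off at \<open>s\<close>, so \<open>f\<close> vanishes as well. The
  endpoints follow by continuity.\<close>

lemma gelfand_levitan_unique:
  assumes c: "\<And>t s. t \<in> {0..T} \<Longrightarrow> s \<in> {0..T} \<Longrightarrow> c t s = conn_ker t s"
    and gl: "gelfand_levitan T c z'" and s: "0 < s" "s < T" and x: "0 \<le> x" "x \<le> s"
  shows "z' x s = z x s"
proof -
  have z'c: "continuous_on {(x, s). 0 \<le> x \<and> x \<le> s \<and> s \<le> T} (\<lambda>(x, s). z' x s)"
    and z'gl: "\<And>x s. 0 < x \<Longrightarrow> x < s \<Longrightarrow> s < T \<Longrightarrow> z' x s + c x s + integral {0..s} (\<lambda>\<tau>. c x \<tau> * z' \<tau> s) = 0"
    using gl by (auto simp: gelfand_levitan_def)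
  have z'col: "continuous_on {0..s} (\<lambda>x. z' x s)"
    by (rule continuous_on_compose2[OF z'c, of _ "\<lambda>x. (x, s)", unfolded split_beta fst_conv snd_conv])
       (use s in \<open>auto intro!: continuous_intros\<close>)
  have zcol: "continuous_on {0..s} (\<lambda>x. z x s)" using s by (intro z_column) auto
  define d where "d = (\<lambda>x. z' x s - z x s)"
  have d: "continuous_on {0..s} d" unfolding d_def by (intro continuous_intros zcol z'col)
  define f where "f = (\<lambda>y. indicator {0..s} y * d y)"
  have f: "integrable lborel f" unfolding f_def by (rule column_integrable[OF d])
  obtain B where B: "B \<ge> 0" "\<And>y. y \<in> {0..s} \<Longrightarrow> \<bar>d y\<bar> \<le> B"
    using compact_continuous_bound[OF d] by auto
  have fB: "\<bar>f y\<bar> \<le> B" for y using B by (auto simp: f_def indicator_def)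
  have VB: "\<bar>V f y\<bar> \<le> B + k_sup * (\<integral>s. \<bar>f s\<bar> \<partial>lborel)" for y
    using fB[of y] k_apply(3)[OF f, of y] unfolding V_def M_def by linarith
  have "V f x + M' (V f) x = 0" if x: "x \<in> {0<..<s}" for x
  proof -
    have xT: "x \<in> {0..T}" and xs: "0 < x" "x < s" "s < T" using x s by auto
    have cc: "continuous_on {0..s} (conn_ker x)"
      by (rule continuous_on_subset[OF continuous_on_slice(1)[OF conn_ker_continuous xT]]) (use s in auto)
    have "integral {0..s} (\<lambda>y. c x y * z' y s) = integral {0..s} (\<lambda>y. conn_ker x y * z' y s)"
      using s xT c by (intro Henstock_Kurzweil_Integration.integral_cong) auto
    moreover have "integral {0..s} (\<lambda>y. conn_ker x y * d y)
      = integral {0..s} (\<lambda>y. conn_ker x y * z' y s) - integral {0..s} (\<lambda>y. conn_ker x y * z y s)"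
      unfolding d_def right_diff_distrib
      by (intro Henstock_Kurzweil_Integration.integral_diff integrable_continuous_interval continuous_on_mult cc zcol z'col)
    ultimately have "d x + integral {0..s} (\<lambda>y. conn_ker x y * d y) = 0"
      using z'gl[OF xs] z_gelfand_levitan[OF xs] c[of x s] s xT by (simp add: d_def)
    moreover have "(\<integral>y. conn_ker x y * f y \<partial>lborel) = integral {0..s} (\<lambda>y. conn_ker x y * d y)"
      unfolding f_def using s by (intro conn_ker_column xT d) auto
    ultimately show ?thesis
      using conn_ker_apply(1)[OF f, of x] x by (simp add: f_def)
  qed
  then have eq: "V f x = (\<integral>y. - (k y x * V f y) \<partial>lborel)" if "x \<in> {0<..<s}" for x
    using that by (fastforce simp: M'_def)
  have V0: "V f x = 0" if x: "x \<in> {0<..<s}" for x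
  proof (rule volterra_zero[OF VB k_sup(1) eq _ _ x])
    show "\<bar>- (k y x * V f y)\<bar> \<le> k_sup * \<bar>V f y\<bar>" for x y
      using k_sup(2)[of y x] by (simp add: abs_mult mult_right_mono)
    show "- (k y x * V f y) = 0" if "y \<notin> {0..x}" for x y using that by (auto simp: k_eq)
  qed
  have f0: "f x = 0" if x: "x \<in> {0<..<s}" for x
  proof (rule volterra_zero_backward[OF fB k_sup(1) _ _ _ x])
    show "f x = (\<integral>y. - (k x y * f y) \<partial>lborel)" if "x \<in> {0<..<s}" for x
      using V0[OF that] by (simp add: V_def M_def)
    show "\<bar>- (k x y * f y)\<bar> \<le> k_sup * \<bar>f y\<bar>" for x y
      using k_sup(2)[of x y] by (simp add: abs_mult mult_right_mono)
    show "- (k x y * f y) = 0" if "y \<notin> {x..s}" for x y using that by (auto simp: k_eq f_def)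
  qed
  have "d x = 0"
  proof (rule continuous_constant_on_closure[of "{0<..<s}" d 0 x])
    show "d y = 0" if "y \<in> {0<..<s}" for y using f0[OF that] that by (simp add: f_def)
  qed (use d x s in auto)
  then show ?thesis by (simp add: d_def)
qed

end

section \<open>The inverse of the control operator and the derivative on the diagonal\<close>

context resolvent_kernel
begin

text \<open>\<open>I + L\<close> on representatives; the cut-off to the open interval keeps the
  result in \<open>L2_borel T\<close>.\<close>

definition inverse_op :: "(real \<Rightarrow> real) \<Rightarrow> real \<Rightarrow> real" where
  "inverse_op h x = indicator {0<..<T} x * (h x + (\<integral>s. Z x s * h s \<partial>lborel))"

lemma k_row_integrable: "integrable lborel (\<lambda>s. k x s)"
proof -
  have "integrable lborel (\<lambda>s. indicator {0..T} s :: real)"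
    by (auto simp: integrable_indicator_iff emeasure_lborel_Icc_eq)
  then have "integrable lborel (\<lambda>s. k x s * indicator {0..T} s)"
    by (rule integrable_mult_bounded) (use kernel_slice_measurable(1)[OF k_measurable] k_sup in auto)
  moreover have "(\<lambda>s. k x s * indicator {0..T} s) = (\<lambda>s. k x s)"
    by (auto simp: k_eq indicator_def)
  ultimately show ?thesis by simp
qed

lemma inverse_op_L2:
  assumes h: "h \<in> L2_borel T" shows "inverse_op h \<in> L2_borel T"
proof -
  obtain B where B: "B \<ge> 0" "\<And>x s. \<bar>Z x s\<bar> \<le> B" using Z_bound by metis
  have m: "(\<lambda>x. \<integral>s. Z x s * h s \<partial>lborel) \<in> borel_measurable borel"
    by (rule kernel_apply_measurable[OF Z_measurable L2_borelD(1)[OF h]])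
  have b: "\<bar>\<integral>s. Z x s * h s \<partial>lborel\<bar> \<le> B * (\<integral>s. \<bar>h s\<bar> \<partial>lborel)" for x
    by (rule kernel_apply_integrable(2)[OF Z_measurable B(2) L2_borel_integrable[OF h]])
  have "0 \<le> B * (\<integral>s. \<bar>h s\<bar> \<partial>lborel)" using B(1) by simp
  then have "(\<lambda>x. - (indicator {0<..<T} x * (\<integral>s. Z x s * h s \<partial>lborel))) \<in> L2_borel T"
    using m b by (intro L2_borel_bounded[where B = "B * (\<integral>s. \<bar>h s\<bar> \<partial>lborel)"]) (auto simp: indicator_def)
  from L2_borel_diff[OF h this]
  have "(\<lambda>x. h x + indicator {0<..<T} x * (\<integral>s. Z x s * h s \<partial>lborel)) \<in> L2_borel T" by simp
  moreover have "(\<lambda>x. h x + indicator {0<..<T} x * (\<integral>s. Z x s * h s \<partial>lborel)) = inverse_op h"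
  proof
    fix x show "h x + indicator {0<..<T} x * (\<integral>s. Z x s * h s \<partial>lborel) = inverse_op h x"
      using L2_borelD(2)[OF h, of x] by (cases "x \<in> {0<..<T}") (auto simp: inverse_op_def)
  qed
  ultimately show ?thesis by simp
qed

text \<open>After exchanging the integrals in \<open>M (L h)\<close>, the inner integral is
  \<open>M\<close> applied to a column of \<open>Z\<close>, which \<open>Z_resolvent\<close>
  evaluates; everything but \<open>h\<close> cancels.\<close>

lemma V_inverse_op:
  assumes h: "h \<in> L2_borel T" shows "V (inverse_op h) x = h x"
proof (cases "x \<in> {0<..<T}")
  case True
  obtain B where B: "B \<ge> 0" "\<And>x s. \<bar>Z x s\<bar> \<le> B" using Z_bound by metis
  define l where "l = (\<lambda>x. \<integral>s. Z x s * h s \<partial>lborel)"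
  note hi = L2_borel_integrable[OF h]
  have hm: "h \<in> borel_measurable borel" by (rule L2_borelD(1)[OF h])
  have lm: "l \<in> borel_measurable borel"
    unfolding l_def by (rule kernel_apply_measurable[OF Z_measurable hm])
  have lb: "\<bar>l x\<bar> \<le> B * (\<integral>s. \<bar>h s\<bar> \<partial>lborel)" for x
    unfolding l_def by (rule kernel_apply_integrable(2)[OF Z_measurable B(2) hi])
  have kl: "integrable lborel (\<lambda>s. k x s * l s)"
    using integrable_mult_bounded[OF k_row_integrable lm lb, of x] by (simp add: mult.commute)
  have kh: "integrable lborel (\<lambda>s. k x s * h s)" by (rule k_apply(2)[OF hi])
  have zh: "integrable lborel (\<lambda>s. Z x s * h s)" by (rule kernel_apply_integrable(1)[OF Z_measurable B(2) hi])
  define G where "G = (\<lambda>y. \<integral>s. k x s * Z s y \<partial>lborel)"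
  have G: "G y = - Z x y - k x y" for y using Z_resolvent[of x y] by (simp add: G_def)
  have "M (inverse_op h) x = (\<integral>s. k x s * h s + k x s * l s \<partial>lborel)"
    unfolding M_def
  proof (rule integral_cong_AE)
    show "(\<lambda>s. k x s * inverse_op h s) \<in> borel_measurable lborel"
      using kernel_slice_measurable(1)[OF k_measurable, of x] L2_borelD(1)[OF inverse_op_L2[OF h]] by simp
    show "(\<lambda>s. k x s * h s + k x s * l s) \<in> borel_measurable lborel"
      using kl kh by (intro borel_measurable_integrable Bochner_Integration.integrable_add)
    have "AE s in lborel. s \<noteq> (0::real)" "AE s in lborel. s \<noteq> T" by (rule AE_lborel_singleton)+
    then show "AE s in lborel. k x s * inverse_op h s = k x s * h s + k x s * l s"
    proof eventually_elim
      case (elim s)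
      show ?case
      proof (cases "s \<in> {0<..<T}")
        case True
        then show ?thesis by (simp add: inverse_op_def l_def distrib_left)
      next
        case False
        then have "k x s = 0" using elim \<open>x \<in> {0<..<T}\<close> by (auto simp: k_eq)
        then show ?thesis by simp
      qed
    qed
  qed
  also have "\<dots> = (\<integral>s. k x s * h s \<partial>lborel) + (\<integral>s. k x s * l s \<partial>lborel)"
    using kh kl by simp
  also have "(\<integral>s. k x s * l s \<partial>lborel) = (\<integral>y. h y * G y \<partial>lborel)"
    using kernel_swap[OF Z_measurable B(2) k_row_integrable hi, of x] by (simp add: l_def G_def mult.commute)
  also have "\<dots> = (\<integral>y. - (Z x y * h y) - k x y * h y \<partial>lborel)"
    by (simp add: G algebra_simps)
  also have "\<dots> = - l x - (\<integral>s. k x s * h s \<partial>lborel)"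
    using zh kh by (simp add: l_def)
  finally show ?thesis using True by (simp add: V_def inverse_op_def[of h x] l_def)
next
  case False
  then show ?thesis using L2_borelD(2)[OF V_L2[OF inverse_op_L2[OF h]] False] L2_borelD(2)[OF h False] by simp
qed

text \<open>A right inverse of an injective operator is a two-sided inverse; injectivity is
  \<open>V_injective\<close>, applied to the difference of \<open>p\<close> and
  \<open>inverse_op h\<close>.\<close>

lemma V_inverse_iff:
  assumes p: "p \<in> L2_borel T" and h: "h \<in> L2_borel T"
  shows "(AE x in lborel. h x = V p x) \<longleftrightarrow> (AE x in lborel. p x = inverse_op h x)"
proof
  note i = inverse_op_L2[OF h]
  have d: "V (\<lambda>x. p x - inverse_op h x) x = V p x - h x" for x
    using M_diff[OF L2_borel_integrable[OF p] L2_borel_integrable[OF i], of x] V_inverse_op[OF h, of x]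
    by (simp add: V_def)
  {
    assume "AE x in lborel. h x = V p x"
    then have "AE x in lborel. V (\<lambda>x. p x - inverse_op h x) x = 0" by eventually_elim (simp add: d)
    from V_injective[OF L2_borel_diff[OF p i] this] show "AE x in lborel. p x = inverse_op h x" by simp
  next
    assume ae: "AE x in lborel. p x = inverse_op h x"
    have "M p x = M (inverse_op h) x" for x
      unfolding M_def
    proof (rule integral_cong_AE)
      show "AE s in lborel. k x s * p s = k x s * inverse_op h s" using ae by eventually_elim simp
    qed (use kernel_slice_measurable(1)[OF k_measurable, of x] L2_borelD(1)[OF p] L2_borelD(1)[OF i] in simp_all)
    then have "h x = V p x" if "p x = inverse_op h x" for x
      using V_inverse_op[OF h, of x] that by (simp add: V_def)
    with ae show "AE x in lborel. h x = V p x" by (auto elim: eventually_mono)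
  }
qed

lemma L_operator_eq:
  assumes z': "\<And>s. x < s \<Longrightarrow> s < T \<Longrightarrow> z' x s = z x s" and x: "x \<in> {0<..<T}"
    and h: "h \<in> L2 (L2_measure T)" and g: "g \<in> L2_borel T" "AE s in L2_measure T. h s = g s"
  shows "L_operator T z' h x = (\<integral>s. Z x s * g s \<partial>lborel)"
proof -
  have S: "{x<..<T} \<in> sets borel" by simp
  have [measurable]: "Z x \<in> borel_measurable borel" "g \<in> borel_measurable borel"
    using kernel_slice_measurable(1)[OF Z_measurable, of x] L2_borelD(1)[OF g(1)] by auto
  define F where "F = (\<lambda>s. indicator {x<..<T} s * (Z x s * g s))"
  have Fm: "F \<in> borel_measurable borel" unfolding F_def by measurable
  have "L_operator T z' h x = (\<integral>s. F s \<partial>lebesgue_on {x<..<T})"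
    unfolding L_operator_def
  proof (rule integral_cong_AE)
    have "h \<in> borel_measurable (lebesgue_on {x<..<T})"
      by (rule measurable_restrict_mono[of _ _ "{0<..<T}"]) (use h x in \<open>auto simp: L2_def\<close>)
    moreover have "z' x \<in> borel_measurable (lebesgue_on {x<..<T})"
    proof -
      have "Z x \<in> borel_measurable (lebesgue_on {x<..<T})" by (rule borel_measurable_lebesgue_on) measurable
      then show ?thesis by (rule measurable_cong[THEN iffD1, rotated]) (use z' x in \<open>auto simp: Z_def\<close>)
    qed
    ultimately show "(\<lambda>s. z' x s * h s) \<in> borel_measurable (lebesgue_on {x<..<T})" by (intro borel_measurable_times)
    show "F \<in> borel_measurable (lebesgue_on {x<..<T})" by (rule borel_measurable_lebesgue_on[OF Fm])
    have "AE s in lborel. s \<in> {0<..<T} \<longrightarrow> h s = g s" using g(2) by (simp add: AE_lebesgue_on)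
    then show "AE s in lebesgue_on {x<..<T}. z' x s * h s = F s"
      unfolding AE_lebesgue_on[OF S] by eventually_elim (use x z' in \<open>auto simp: F_def Z_def\<close>)
  qed
  also have "\<dots> = (\<integral>s. F s \<partial>lborel)"
    by (rule lebesgue_on_borel(1)[OF Fm S]) (auto simp: F_def)
  also have "\<dots> = (\<integral>s. Z x s * g s \<partial>lborel)"
  proof (rule integral_cong_AE)
    show "F \<in> borel_measurable lborel" using Fm by simp
    show "(\<lambda>s. Z x s * g s) \<in> borel_measurable lborel" by measurable
    show "AE s in lborel. F s = Z x s * g s"
      using AE_lborel_singleton[of x]
    proof eventually_elim
      case (elim s)
      show ?case
      proof (cases "s \<in> {x<..<T}")
        case False
        then have "Z x s = 0 \<or> g s = 0" using elim L2_borelD(2)[OF g(1), of s] by (auto simp: Z_def)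
        then show ?thesis by (auto simp: F_def)
      qed (simp add: F_def)
    qed
  qed
  finally show ?thesis .
qed

lemma inverse_control_kernelI:
  assumes z': "\<And>x s. 0 < x \<Longrightarrow> x < s \<Longrightarrow> s < T \<Longrightarrow> z' x s = z x s"
  shows "inverse_control_kernel q K T z'"
  unfolding inverse_control_kernel_def
proof (intro ballI)
  fix f h assume f: "f \<in> L2 (L2_measure T)" and h: "h \<in> L2 (L2_measure T)"
  obtain g where g: "g \<in> L2_borel T" "AE x in L2_measure T. f x = g x"
    using that by (rule L2_borel_rep[OF f])
  obtain h' where h': "h' \<in> L2_borel T" "AE x in L2_measure T. h x = h' x"
    using that by (rule L2_borel_rep[OF h])
  note Jg = L2_borel_J[OF g(1)]
  \<comment> \<open>Elements of \<open>L2_borel T\<close> vanish off the interval, so equality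
    almost everywhere there and on the whole line are the same.\<close>
  have outside: "(AE x in L2_measure T. a x = b x) \<longleftrightarrow> (AE x in lborel. a x = b x)"
    if "a \<in> L2_borel T" "b \<in> L2_borel T" for a b
  proof -
    have "(x \<in> {0<..<T} \<longrightarrow> a x = b x) \<longleftrightarrow> a x = b x" for x
      using L2_borelD(2)[OF that(1), of x] L2_borelD(2)[OF that(2), of x] by (cases "x \<in> {0<..<T}") simp_all
    then show ?thesis by (simp add: AE_lebesgue_on)
  qed
  have "control_operator q K T f h \<longleftrightarrow> (AE x in L2_measure T. h x = V (J T g) x)"
  proof
    assume "control_operator q K T f h"
    then obtain u where u: "L2_solution q K T f u" "AE x in L2_measure T. h x = u x T"
      by (auto simp: control_operator_def)
    from L2_solution_V[OF u(1) g] u(2) show "AE x in L2_measure T. h x = V (J T g) x"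
      by eventually_elim simp
  next
    assume "AE x in L2_measure T. h x = V (J T g) x"
    then show "control_operator q K T f h"
      using L2_solution_exists[OF T f g] by (auto simp: control_operator_def mild_eq_V intro!: exI[of _ "mild g"])
  qed
  also have "\<dots> \<longleftrightarrow> (AE x in L2_measure T. h' x = V (J T g) x)"
    by (rule eventually_subst) (use h'(2) in \<open>eventually_elim, simp\<close>)
  also have "\<dots> \<longleftrightarrow> (AE x in lborel. h' x = V (J T g) x)"
    by (rule outside[OF h'(1) V_L2[OF Jg]])
  also have "\<dots> \<longleftrightarrow> (AE x in lborel. J T g x = inverse_op h' x)"
    by (rule V_inverse_iff[OF Jg h'(1)])
  also have "\<dots> \<longleftrightarrow> (AE x in L2_measure T. J T g x = inverse_op h' x)"
    by (rule outside[OF Jg inverse_op_L2[OF h'(1)], symmetric])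
  \<comment> \<open>Reflection in \<open>T / 2\<close> is an involution, so
    \<open>AE_L2_measure_reflect\<close> yields both directions.\<close>
  also have "\<dots> \<longleftrightarrow> (AE t in L2_measure T. g t = inverse_op h' (T - t))"
    using AE_L2_measure_reflect[where T = T and P = "\<lambda>x. J T g x = inverse_op h' x"]
      AE_L2_measure_reflect[where T = T and P = "\<lambda>t. g t = inverse_op h' (T - t)"]
    by (simp add: J_def) blast
  also have "\<dots> \<longleftrightarrow> (AE t in L2_measure T. f t = J T (\<lambda>x. h x + L_operator T z' h x) t)"
  proof -
    have L: "L_operator T z' h x = (\<integral>s. Z x s * h' s \<partial>lborel)" if "x \<in> {0<..<T}" for x
      using that z' by (intro L_operator_eq[OF _ that h h']) auto
    have "AE t in L2_measure T. t \<in> {0<..<T}" by (intro AE_I2) simp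
    with AE_L2_measure_reflect[OF h'(2)]
    have ae: "AE t in L2_measure T. J T (\<lambda>x. h x + L_operator T z' h x) t = inverse_op h' (T - t)"
      by eventually_elim (simp add: J_def L inverse_op_def)
    show ?thesis
      by (rule eventually_subst) (use g(2) ae in \<open>eventually_elim, simp\<close>)
  qed
  finally show "control_operator q K T f h \<longleftrightarrow> (AE t in L2_measure T. f t = J T (\<lambda>x. h x + L_operator T z' h x) t)" .
qed

lemma diagonal_derivative:
  assumes z': "\<And>y. 0 < y \<Longrightarrow> y < T \<Longrightarrow> z' y y = z y y" and x: "x \<in> {0<..<T}"
  shows "((\<lambda>y. z' y y) has_real_derivative q x / 2) (at x)"
proof -
  have "((\<lambda>y. integral {0..y} q) has_real_derivative q x) (at x within {0..})"
    using x by (intro integral_has_real_derivative_atLeast q_cont) auto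
  moreover have "at x within {0..} = at x" using x by (intro at_within_interior) auto
  ultimately have "((\<lambda>y. integral {0..y} q) has_real_derivative q x) (at x)" by simp
  from DERIV_cmult[OF this, of "1 / 2"]
  have "((\<lambda>y. 1 / 2 * integral {0..y} q) has_real_derivative q x / 2) (at x)" by simp
  then show ?thesis
    by (rule has_field_derivative_transform_within_open[where S = "{0<..<T}"]) (use x z' z_diag in auto)
qed

end

theorem mainTheorem2:
  fixes K q :: "real \<Rightarrow> real" and T :: real
  assumes "C2_loc K" and "C2_loc q" and "T > 0"
  shows "(\<exists>c. connecting_kernel q K T c)
    \<and> (\<forall>q'. C2_loc q' \<longrightarrow> response_operator q' K (2 * T) = response_operator q K (2 * T) \<longrightarrow>
          (\<forall>c. connecting_kernel q' K T c \<longleftrightarrow> connecting_kernel q K T c))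
    \<and> (\<forall>c. connecting_kernel q K T c \<longrightarrow>
          (\<exists>z. gelfand_levitan T c z)
          \<and> (\<forall>z. gelfand_levitan T c z \<longrightarrow>
                inverse_control_kernel q K T z
                \<and> (\<forall>x\<in>{0<..<T}. (\<lambda>y. z y y) differentiable at x
                      \<and> q x = 2 * deriv (\<lambda>y. z y y) x)))"
proof -
  \<comment> \<open>Stated for an arbitrary potential because the competitor \<open>q'\<close> needs
    its own kernel as well.\<close>
  have hz: "\<exists>q1 W. control_horizon q q1 K W T" if "C2_loc q" for q
    by (rule goursat_kernel_of_C2[OF that assms(1)])
       (use assms(3) in \<open>auto simp: control_horizon_def control_horizon_axioms_def\<close>)
  obtain q1 W where ch: "control_horizon q q1 K W T" using hz[OF assms(2)] by blast
  interpret control_horizon q q1 K W T by (rule ch)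
  \<comment> \<open>The resolvent built from \<open>W\<close> is the reference: every
    Gelfand--Levitan solution agrees with it on all columns \<open>0 < s < T\<close>, up to and
    including the diagonal.\<close>
  obtain z0 where z0: "continuous_on {(x, s). 0 \<le> x \<and> x \<le> s \<and> s \<le> T} (\<lambda>(x, s). z0 x s)"
    "\<And>x s. 0 \<le> x \<Longrightarrow> x \<le> s \<Longrightarrow> s \<le> T \<Longrightarrow> z0 x s = - W x (s - x) - integral {0..s - x} (\<lambda>r. W x r * z0 (x + r) s)"
    using resolvent_exists by blast
  interpret resolvent_kernel q q1 K W T z0 by unfold_locales (use z0 in auto)
  show ?thesis
  proof (intro conjI allI impI ballI)
    show "\<exists>c. connecting_kernel q K T c"
      by (rule exI[of _ conn_ker]) (simp add: connecting_kernel_iff)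
  next
    fix q' c assume "C2_loc q'" and R: "response_operator q' K (2 * T) = response_operator q K (2 * T)"
    then obtain q1' W' where ch': "control_horizon q' q1' K W' T" using hz by blast
    show "connecting_kernel q' K T c \<longleftrightarrow> connecting_kernel q K T c"
      unfolding control_horizon.connecting_kernel_iff[OF ch'] connecting_kernel_iff
        conn_ker_determined_by_response[OF ch ch' R] ..
  next
    fix c assume "connecting_kernel q K T c"
    then have c: "c t s = conn_ker t s" if "t \<in> {0..T}" "s \<in> {0..T}" for t s
      using that by (simp add: connecting_kernel_iff)
    show "\<exists>z. gelfand_levitan T c z" using gelfand_levitan_z[OF c] by blast
    fix z assume "gelfand_levitan T c z"
    then have z: "z x s = z0 x s" if "0 < s" "s < T" "0 \<le> x" "x \<le> s" for x s
      using gelfand_levitan_unique[OF c] that by blast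
    show "inverse_control_kernel q K T z" by (rule inverse_control_kernelI) (simp add: z)
    fix x assume "x \<in> {0<..<T}"
    then have d: "((\<lambda>y. z y y) has_real_derivative q x / 2) (at x)"
      by (intro diagonal_derivative) (auto simp: z)
    then show "(\<lambda>y. z y y) differentiable at x" by (auto simp: real_differentiable_def)
    show "q x = 2 * deriv (\<lambda>y. z y y) x" using DERIV_imp_deriv[OF d] by simp
  qed
qed

end
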